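(* Let $H$ be a cosemisimple Hopf algebra over a field $K$ and let $C$ be a coalgebra in $\mathfrak{M}_H$ whose coradical is $C_0=H$. Let $\pi_C:C\to H$ be a right $H$-linear coalgebra map with $\pi_C|_H=\mathrm{Id}_H$ (such a map exists), let $C$ be regarded via $\pi_C$ as an object of ${}^H\mathfrak{M}^H_H$, and let $R$ be the space of right coinvariants of $C$ with its left $H$-comodule coalgebra structure (see context). Let $(C_n)_{n\in\mathbb{N}}$ and $(R_n)_{n\in\mathbb{N}}$ be the coradical filtrations of $C$ and $R$. (a) For every natural number $n$ we have $C_n\simeq R_n\#H$ (isomorphism in ${}^H\mathfrak{M}^H_H$). In particular, for $n\ge1$, $C_n$ is freely generated as a right $H$-module by elements $r\in C$ satisfying $$\Delta(r)\in\sum r_{\langle-1\rangle}\otimes r_{\langle0\rangle}+r\otimes1_H+C_{n-1}\otimes C_{n-1}.$$ (b) $C_1$ verifies the equation $$C_1=C_0+\sum_{\tau\in\widehat H}\bigl(C(\tau)\wedge K1_H\bigr)H.$$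
   Context: $\mathfrak{M}_H$: right $H$-modules with $\otimes_K$ and diagonal action; a coalgebra in $\mathfrak{M}_H$ is a right $H$-module coalgebra; "$C_0=H$" identifies $C_0$ with $H$ as a right $H$-module coalgebra. The coactions on $C$ are $\rho^l=(\pi_C\otimes C)\Delta$, written $\rho^l(c)=\sum c_{\langle-1\rangle}\otimes c_{\langle0\rangle}\in H\otimes C\subseteq C\otimes C$, and $\rho^r=(C\otimes\pi_C)\Delta$. ${}^H\mathfrak{M}^H_H$ is the category of $(H,H)$-bicomodules that are right $H$-modules with both coactions right $H$-linear (diagonal actions). $R=\{c\in C:\rho^r(c)=c\otimes1_H\}$, a left subcomodule of $C$ containing $1_H$. Its coalgebra structure is $\delta(r)=\sum r_{(1)}S(\pi_C(r_{(2)}))\otimes r_{(3)}$ (using the right $H$-action on $C$) with counit $\varepsilon_C|_R$; this makes $R$ a left $H$-comodule coalgebra. Writing $\delta(r)=\sum r^{(1)}\otimes r^{(2)}$, the smash coproduct $R\#H$ is $R\otimes H$ with $\Delta(r\#h)=\sum(r^{(1)}\#r^{(2)}_{\langle-1\rangle}h_{(1)})\otimes(r^{(2)}_{\langle0\rangle}\#h_{(2)})$ and counit $\varepsilon\otimes\varepsilon_H$, with diagonal left coaction and right action and coaction coming from $H$; $R\#H\to C$, $r\#h\mapsto rh$, is an isomorphism of coalgebras in ${}^H\mathfrak{M}^H_H$. $\widehat H$ is the set of isomorphism classes of simple left $H$-comodules; for $\tau\in\widehat H$, $C(\tau)$ is the simple subcoalgebra of $H$ with $\rho_V(V)\subseteq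 C(\tau)\otimes V$ for $V\in\tau$. For subspaces $X,Y\subseteq C$, $X\wedge Y=\{c\in C:\Delta(c)\in X\otimes C+C\otimes Y\}$. *)

theory Defs
  imports Complex_Main "HOL-Library.Function_Algebras"
begin

section \<open>Linear and bilinear maps on subspaces\<close>

definition lin_on ::
  "('k::field \<Rightarrow> 'v::ab_group_add \<Rightarrow> 'v) \<Rightarrow> ('k \<Rightarrow> 'w::ab_group_add \<Rightarrow> 'w) \<Rightarrow> 'v set \<Rightarrow> ('v \<Rightarrow> 'w) \<Rightarrow> bool"
  where "lin_on sV sW V f \<longleftrightarrow>
    (\<forall>x\<in>V. \<forall>y\<in>V. f (x + y) = f x + f y) \<and> (\<forall>a. \<forall>x\<in>V. f (sV a x) = sW a (f x))"

definition bilin_on ::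
  "('k::field \<Rightarrow> 'a::ab_group_add \<Rightarrow> 'a) \<Rightarrow> ('k \<Rightarrow> 'b::ab_group_add \<Rightarrow> 'b) \<Rightarrow>
   ('k \<Rightarrow> 'u::ab_group_add \<Rightarrow> 'u) \<Rightarrow> 'a set \<Rightarrow> 'b set \<Rightarrow> ('a \<Rightarrow> 'b \<Rightarrow> 'u) \<Rightarrow> bool"
  where "bilin_on sA sB sU X Y f \<longleftrightarrow>
    (\<forall>x\<in>X. lin_on sB sU Y (f x)) \<and> (\<forall>y\<in>Y. lin_on sA sU X (\<lambda>x. f x y))"

abbreviation lspan :: "('k::field \<Rightarrow> 'v::ab_group_add \<Rightarrow> 'v) \<Rightarrow> 'v set \<Rightarrow> 'v set"
  where "lspan s \<equiv> module.span s"

definition ssum :: "'v::ab_group_add set \<Rightarrow> 'v set \<Rightarrow> 'v set"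
  where "ssum X Y = {x + y | x y. x \<in> X \<and> y \<in> Y}"


section \<open>Tensor products over a field\<close>

text \<open>
  The tensor product of two vector spaces is realised inside the dual of the space of bilinear
  forms: a pure tensor is evaluation at a pair of vectors, and the tensor product is spanned by the
  pure tensors.  For subspaces \<open>X\<close> of \<open>A\<close> and \<open>Y\<close> of \<open>B\<close>,
  \<open>tspace sA sB X Y\<close> is the tensor product of \<open>X\<close> and \<open>Y\<close>, viewed inside that of \<open>A\<close> and \<open>B\<close>.
  The universal property is \<open>tlift_tens\<close>, \<open>tlift_linear\<close> and \<open>tlift_unique\<close>.
\<close>

type_synonym ('a, 'b, 'k) tensor = "('a \<Rightarrow> 'b \<Rightarrow> 'k) \<Rightarrow> 'k"

definition tscale :: "'k::field \<Rightarrow> ('a, 'b, 'k) tensor \<Rightarrow> ('a, 'b, 'k) tensor"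
  where "tscale a t = (\<lambda>B. a * t B)"

definition tens ::
  "('k::field \<Rightarrow> 'a::ab_group_add \<Rightarrow> 'a) \<Rightarrow> ('k \<Rightarrow> 'b::ab_group_add \<Rightarrow> 'b) \<Rightarrow> 'a \<Rightarrow> 'b \<Rightarrow> ('a, 'b, 'k) tensor"
  where "tens sA sB x y = (\<lambda>B. if bilin_on sA sB (*) UNIV UNIV B then B x y else 0)"

definition tspace ::
  "('k::field \<Rightarrow> 'a::ab_group_add \<Rightarrow> 'a) \<Rightarrow> ('k \<Rightarrow> 'b::ab_group_add \<Rightarrow> 'b) \<Rightarrow> 'a set \<Rightarrow> 'b set \<Rightarrow> ('a, 'b, 'k) tensor set"
  where "tspace sA sB X Y = lspan tscale {tens sA sB x y | x y. x \<in> X \<and> y \<in> Y}"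

text \<open>
  \<open>tlift sA sB X Y f\<close> is the linear map on \<open>tspace sA sB X Y\<close> induced by a bilinear \<open>f\<close> on
  \<open>X \<times> Y\<close>: it sends the sum of the pure tensors of \<open>x\<close> and \<open>y\<close>, for \<open>(x, y)\<close> in a finite list,
  to the sum of the \<open>f x y\<close>.  For \<open>t = \<Delta> c\<close>, the term \<open>tsum s s (\<lambda>x y. f x y) t\<close> is the
  Sweedler sum of all \<open>f c\<^sub>(\<^sub>1\<^sub>) c\<^sub>(\<^sub>2\<^sub>)\<close>.
\<close>

definition tlift ::
  "('k::field \<Rightarrow> 'a::ab_group_add \<Rightarrow> 'a) \<Rightarrow> ('k \<Rightarrow> 'b::ab_group_add \<Rightarrow> 'b) \<Rightarrow> 'a set \<Rightarrow> 'b set \<Rightarrow>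
   ('a \<Rightarrow> 'b \<Rightarrow> 'u::ab_group_add) \<Rightarrow> ('a, 'b, 'k) tensor \<Rightarrow> 'u"
  where "tlift sA sB X Y f t = (THE u. \<exists>l. set l \<subseteq> X \<times> Y \<and>
    t = sum_list (map (\<lambda>(x, y). tens sA sB x y) l) \<and> u = sum_list (map (\<lambda>(x, y). f x y) l))"

abbreviation tsum ::
  "('k::field \<Rightarrow> 'a::ab_group_add \<Rightarrow> 'a) \<Rightarrow> ('k \<Rightarrow> 'b::ab_group_add \<Rightarrow> 'b) \<Rightarrow>
   ('a \<Rightarrow> 'b \<Rightarrow> 'u::ab_group_add) \<Rightarrow> ('a, 'b, 'k) tensor \<Rightarrow> 'u"
  where "tsum sA sB \<equiv> tlift sA sB UNIV UNIV"

lemma vector_space_tscale: "vector_space (tscale :: 'k::field \<Rightarrow> ('a, 'b, 'k) tensor \<Rightarrow> _)"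
  by (simp add: vector_space_def tscale_def fun_eq_iff algebra_simps)

lemma vector_space_mult: "vector_space ((*) :: 'k::field \<Rightarrow> 'k \<Rightarrow> 'k)"
  by (simp add: vector_space_def algebra_simps)

lemma bilin_on_tens:
  assumes "vector_space sA" "vector_space sB"
  shows "bilin_on sA sB tscale UNIV UNIV (tens sA sB)"
  using assms
  by (auto simp: bilin_on_def lin_on_def tens_def tscale_def fun_eq_iff)

lemma tens_list_unique:
  fixes sU :: "'k::field \<Rightarrow> 'u::ab_group_add \<Rightarrow> 'u"
  assumes A: "vector_space sA" and B: "vector_space sB" and U: "vector_space sU"
    and X: "module.subspace sA X" and Y: "module.subspace sB Y"
    and f: "bilin_on sA sB sU X Y f"
    and l: "set l \<subseteq> X \<times> Y" and m: "set m \<subseteq> X \<times> Y"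
    and eq: "sum_list (map (\<lambda>(x, y). tens sA sB x y) l) = sum_list (map (\<lambda>(x, y). tens sA sB x y) m)"
  shows "sum_list (map (\<lambda>(x, y). f x y) l) = sum_list (map (\<lambda>(x, y). f x y) m)"
proof (rule ccontr)
  assume ne: "\<not> ?thesis"
  define u where "u = sum_list (map (\<lambda>(x, y). f x y) l) - sum_list (map (\<lambda>(x, y). f x y) m)"
  interpret A: vector_space sA by fact
  interpret B: vector_space sB by fact
  interpret U: vector_space sU by fact
  interpret K: vector_space "(*) :: 'k \<Rightarrow> 'k \<Rightarrow> 'k" by (rule vector_space_mult)
  interpret AA: vector_space_pair sA sA ..
  interpret BB: vector_space_pair sB sB ..
  interpret UK: vector_space_pair sU "(*) :: 'k \<Rightarrow> 'k \<Rightarrow> 'k" ..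
  have "U.independent {u}" using ne by (simp add: u_def)
  from UK.linear_independent_extend[OF this, of "\<lambda>_. 1"]
  obtain \<phi> where \<phi>: "Vector_Spaces.linear sU (*) \<phi>" and \<phi>u: "\<phi> u = 1" by auto
  interpret \<phi>: Vector_Spaces.linear sU "(*)" \<phi> by (rule \<phi>)
  obtain p where p: "range p \<subseteq> X" "Vector_Spaces.linear sA sA p" "\<forall>x\<in>X. p (id x) = x"
    using AA.linear_exists_left_inverse_on[of id X] X A.linear_id by auto
  obtain q where q: "range q \<subseteq> Y" "Vector_Spaces.linear sB sB q" "\<forall>y\<in>Y. q (id y) = y"
    using BB.linear_exists_left_inverse_on[of id Y] Y B.linear_id by auto
  interpret p: Vector_Spaces.linear sA sA p by (rule p)
  interpret q: Vector_Spaces.linear sB sB q by (rule q)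
  define b where "b = (\<lambda>x y. \<phi> (f (p x) (q y)))"
  have pX: "p x \<in> X" and qY: "q y \<in> Y" for x y using p(1) q(1) by auto
  have b: "bilin_on sA sB (*) UNIV UNIV b"
    using f pX qY
    by (auto simp: b_def bilin_on_def lin_on_def p.add q.add p.scale q.scale \<phi>.add \<phi>.scale)
  have tb: "tens sA sB x y b = \<phi> (f x y)" if "x \<in> X" "y \<in> Y" for x y
    using b p(3) q(3) that unfolding tens_def by (simp add: b_def)
  have *: "sum_list (map (\<lambda>(x, y). tens sA sB x y) n) b = \<phi> (sum_list (map (\<lambda>(x, y). f x y) n))"
    if "set n \<subseteq> X \<times> Y" for n
    using that by (induction n) (auto simp: tb \<phi>.add)
  have "\<phi> u = 0"
    unfolding u_def using *[OF l] *[OF m] eq by (simp add: \<phi>.diff)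
  with \<phi>u show False by simp
qed

lemma tspace_list:
  assumes A: "vector_space sA" and B: "vector_space sB"
    and X: "module.subspace sA X"
  shows "t \<in> tspace sA sB X Y \<longleftrightarrow>
    (\<exists>l. set l \<subseteq> X \<times> Y \<and> t = sum_list (map (\<lambda>(x, y). tens sA sB x y) l))"
proof -
  interpret A: vector_space sA by fact
  interpret B: vector_space sB by fact
  interpret T: vector_space "tscale :: 'a \<Rightarrow> ('b, 'c, 'a) tensor \<Rightarrow> _" by (rule vector_space_tscale)
  show ?thesis
  proof
    assume "t \<in> tspace sA sB X Y"
    then have "t \<in> T.span {tens sA sB x y | x y. x \<in> X \<and> y \<in> Y}" by (simp add: tspace_def)
    then show "\<exists>l. set l \<subseteq> X \<times> Y \<and> t = sum_list (map (\<lambda>(x, y). tens sA sB x y) l)"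
    proof (induction rule: T.span_induct_alt)
      case base
      show ?case by (rule exI[of _ "[]"]) auto
    next
      case (step c x y)
      then obtain l v w where l: "set l \<subseteq> X \<times> Y" "y = sum_list (map (\<lambda>(x, y). tens sA sB x y) l)"
        and vw: "v \<in> X" "w \<in> Y" "x = tens sA sB v w" by auto
      have "tscale c x = tens sA sB (sA c v) w"
        using bilin_on_tens[OF A B] vw by (auto simp: bilin_on_def lin_on_def)
      moreover have "sA c v \<in> X" using X vw by (simp add: A.subspace_scale)
      ultimately show ?case
        using l vw by (intro exI[of _ "(sA c v, w) # l"]) auto
    qed
  next
    assume "\<exists>l. set l \<subseteq> X \<times> Y \<and> t = sum_list (map (\<lambda>(x, y). tens sA sB x y) l)"
    then obtain l where l: "set l \<subseteq> X \<times> Y" "t = sum_list (map (\<lambda>(x, y). tens sA sB x y) l)" by auto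
    from l(1) have "sum_list (map (\<lambda>(x, y). tens sA sB x y) l) \<in> tspace sA sB X Y"
      unfolding tspace_def
      by (induction l) (auto intro!: T.span_zero T.span_add intro: T.span_base)
    with l show "t \<in> tspace sA sB X Y" by simp
  qed
qed

lemma tlift_list:
  assumes "vector_space sA" "vector_space sB" "vector_space sU"
    "module.subspace sA X" "module.subspace sB Y" "bilin_on sA sB sU X Y f"
    and l: "set l \<subseteq> X \<times> Y"
  shows "tlift sA sB X Y f (sum_list (map (\<lambda>(x, y). tens sA sB x y) l)) = sum_list (map (\<lambda>(x, y). f x y) l)"
  unfolding tlift_def
proof (rule the_equality)
  show "\<exists>m. set m \<subseteq> X \<times> Y \<and>
      sum_list (map (\<lambda>(x, y). tens sA sB x y) l) = sum_list (map (\<lambda>(x, y). tens sA sB x y) m) \<and>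
      sum_list (map (\<lambda>(x, y). f x y) l) = sum_list (map (\<lambda>(x, y). f x y) m)"
    using l by (intro exI[of _ l]) simp
next
  fix u
  assume "\<exists>m. set m \<subseteq> X \<times> Y \<and>
      sum_list (map (\<lambda>(x, y). tens sA sB x y) l) = sum_list (map (\<lambda>(x, y). tens sA sB x y) m) \<and>
      u = sum_list (map (\<lambda>(x, y). f x y) m)"
  then obtain m where m: "set m \<subseteq> X \<times> Y"
    "sum_list (map (\<lambda>(x, y). tens sA sB x y) l) = sum_list (map (\<lambda>(x, y). tens sA sB x y) m)"
    "u = sum_list (map (\<lambda>(x, y). f x y) m)" by (elim exE conjE)
  show "u = sum_list (map (\<lambda>(x, y). f x y) l)"
    unfolding m(3) by (rule tens_list_unique[OF assms(1-6) l m(1,2), symmetric])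
qed

lemma tlift_tens:
  assumes "vector_space sA" "vector_space sB" "vector_space sU"
    "module.subspace sA X" "module.subspace sB Y" "bilin_on sA sB sU X Y f"
    and "x \<in> X" "y \<in> Y"
  shows "tlift sA sB X Y f (tens sA sB x y) = f x y"
  using tlift_list[OF assms(1-6), of "[(x, y)]"] assms(7,8) by simp

lemma tlift_linear:
  assumes vs: "vector_space sA" "vector_space sB" "vector_space sU"
    "module.subspace sA X" "module.subspace sB Y" "bilin_on sA sB sU X Y f"
  shows "lin_on tscale sU (tspace sA sB X Y) (tlift sA sB X Y f)"
proof -
  interpret A: vector_space sA by fact
  interpret U: vector_space sU by fact
  note L = tlift_list[OF vs]
  show ?thesis unfolding lin_on_def
  proof (intro conjI ballI allI)
    fix t u assume "t \<in> tspace sA sB X Y" "u \<in> tspace sA sB X Y"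
    then obtain l m where l: "set l \<subseteq> X \<times> Y" "t = sum_list (map (\<lambda>(x, y). tens sA sB x y) l)"
      and m: "set m \<subseteq> X \<times> Y" "u = sum_list (map (\<lambda>(x, y). tens sA sB x y) m)"
      by (auto simp: tspace_list[OF vs(1,2,4)])
    show "tlift sA sB X Y f (t + u) = tlift sA sB X Y f t + tlift sA sB X Y f u"
      using L[of "l @ m"] L[of l] L[of m] l m by simp
  next
    fix c t assume "t \<in> tspace sA sB X Y"
    then obtain l where l: "set l \<subseteq> X \<times> Y" "t = sum_list (map (\<lambda>(x, y). tens sA sB x y) l)"
      by (auto simp: tspace_list[OF vs(1,2,4)])
    define m where "m = map (\<lambda>(x, y). (sA c x, y)) l"
    have m: "set m \<subseteq> X \<times> Y" using l(1) vs(4) by (auto simp: m_def A.subspace_scale)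
    have s: "tens sA sB (sA c x) y = tscale c (tens sA sB x y)" for x y
      using bilin_on_tens[OF vs(1,2)] by (auto simp: bilin_on_def lin_on_def)
    interpret T: vector_space "tscale :: 'a \<Rightarrow> ('b, 'c, 'a) tensor \<Rightarrow> _" by (rule vector_space_tscale)
    have 1: "tscale c t = sum_list (map (\<lambda>(x, y). tens sA sB x y) m)"
      unfolding l(2) m_def by (induction l) (auto simp: s T.scale_right_distrib simp del: plus_fun_apply zero_fun_apply)
    have 2: "sum_list (map (\<lambda>(x, y). f x y) m) = sU c (sum_list (map (\<lambda>(x, y). f x y) l))"
      using l(1) vs(6) unfolding m_def
      by (induction l) (auto simp: U.scale_right_distrib bilin_on_def lin_on_def)
    show "tlift sA sB X Y f (tscale c t) = sU c (tlift sA sB X Y f t)"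
      using L[OF m] L[OF l(1)] 1 2 l(2) by simp
  qed
qed

lemma tlift_unique:
  assumes vs: "vector_space sA" "vector_space sB" "vector_space sU"
    "module.subspace sA X" "module.subspace sB Y" "bilin_on sA sB sU X Y f"
    and g: "lin_on tscale sU (tspace sA sB X Y) g"
    and gf: "\<And>x y. x \<in> X \<Longrightarrow> y \<in> Y \<Longrightarrow> g (tens sA sB x y) = f x y"
    and t: "t \<in> tspace sA sB X Y"
  shows "g t = tlift sA sB X Y f t"
proof -
  interpret U: vector_space sU by fact
  interpret T: vector_space "tscale :: 'a \<Rightarrow> ('b, 'c, 'a) tensor \<Rightarrow> _" by (rule vector_space_tscale)
  obtain l where l: "set l \<subseteq> X \<times> Y" "t = sum_list (map (\<lambda>(x, y). tens sA sB x y) l)"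
    using t by (auto simp: tspace_list[OF vs(1,2,4)])
  have z: "0 \<in> tspace sA sB X Y" unfolding tspace_def by (rule T.span_zero)
  have "g (0 + 0) = g 0 + g 0" using g z unfolding lin_on_def by blast
  then have g0: "g 0 = 0" by simp
  have "g (sum_list (map (\<lambda>(x, y). tens sA sB x y) l)) = sum_list (map (\<lambda>(x, y). f x y) l)"
    using l(1)
  proof (induction l)
    case (Cons a l)
    obtain x y where a: "a = (x, y)" "x \<in> X" "y \<in> Y" using Cons.prems by auto
    have "tens sA sB x y \<in> tspace sA sB X Y"
      unfolding tspace_list[OF vs(1,2,4)] using a by (intro exI[of _ "[(x, y)]"]) auto
    moreover have "sum_list (map (\<lambda>(x, y). tens sA sB x y) l) \<in> tspace sA sB X Y"
      unfolding tspace_list[OF vs(1,2,4)] using Cons.prems by auto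
    ultimately show ?case using Cons a gf g by (simp add: lin_on_def del: plus_fun_apply zero_fun_apply)
  qed (simp add: g0)
  then show ?thesis using tlift_list[OF vs l(1)] l(2) by simp
qed


section \<open>Coalgebras and the coradical filtration\<close>

locale coalgebra = vector_space s
  for s :: "'k::field \<Rightarrow> 'c::ab_group_add \<Rightarrow> 'c"
    and \<Delta> :: "'c \<Rightarrow> ('c, 'c, 'k) tensor" and \<epsilon> :: "'c \<Rightarrow> 'k" +
  assumes comult_linear: "Vector_Spaces.linear s tscale \<Delta>"
    and comult_mem: "\<Delta> c \<in> tspace s s UNIV UNIV"
    and counit_linear: "Vector_Spaces.linear s (*) \<epsilon>"
    and coassoc:
      "tsum s s (\<lambda>x y. tsum s s (\<lambda>a b. tens tscale s (tens s s a b) y) (\<Delta> x)) (\<Delta> c) =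
       tsum s s (\<lambda>x y. tsum s s (\<lambda>a b. tens tscale s (tens s s x a) b) (\<Delta> y)) (\<Delta> c)"
    and counit_left: "tsum s s (\<lambda>x y. s (\<epsilon> x) y) (\<Delta> c) = c"
    and counit_right: "tsum s s (\<lambda>x y. s (\<epsilon> y) x) (\<Delta> c) = c"

definition coalgebra_map where
  "coalgebra_map sA \<Delta>A \<epsilon>A sB \<Delta>B \<epsilon>B f \<longleftrightarrow>
    Vector_Spaces.linear sA sB f \<and>
    (\<forall>x. \<Delta>B (f x) = tsum sA sA (\<lambda>a b. tens sB sB (f a) (f b)) (\<Delta>A x)) \<and>
    (\<forall>x. \<epsilon>B (f x) = \<epsilon>A x)"

definition subcoalgebra where
  "subcoalgebra s \<Delta> D \<longleftrightarrow> module.subspace s D \<and> \<Delta> ` D \<subseteq> tspace s s D D"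

definition simple_subcoalgebra where
  "simple_subcoalgebra s \<Delta> D \<longleftrightarrow> subcoalgebra s \<Delta> D \<and> D \<noteq> {0} \<and>
    (\<forall>E. subcoalgebra s \<Delta> E \<and> E \<subseteq> D \<longrightarrow> E = {0} \<or> E = D)"

text \<open>
  In the next three definitions the coalgebra in question is the subspace \<open>A\<close> with
  comultiplication (the restriction of) \<open>\<Delta>\<close>.
\<close>

definition coradical where
  "coradical s \<Delta> A = lspan s (\<Union>{D. simple_subcoalgebra s \<Delta> D \<and> D \<subseteq> A})"

definition wedge where
  "wedge s \<Delta> A X Y = {c \<in> A. \<Delta> c \<in> ssum (tspace s s X A) (tspace s s A Y)}"

fun corad_filt where
  "corad_filt s \<Delta> A 0 = coradical s \<Delta> A"
| "corad_filt s \<Delta> A (Suc n) = wedge s \<Delta> A (coradical s \<Delta> A) (corad_filt s \<Delta> A n)"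

definition cosemisimple where
  "cosemisimple s \<Delta> \<longleftrightarrow> coradical s \<Delta> UNIV = UNIV"


section \<open>Hopf algebras and right module coalgebras\<close>

locale hopf_algebra = coalgebra s \<Delta> \<epsilon>
  for s :: "'k::field \<Rightarrow> 'h::ring_1 \<Rightarrow> 'h" and \<Delta> \<epsilon>
    and S :: "'h \<Rightarrow> 'h" +
  assumes scale_mult_left: "s a x * y = s a (x * y)"
    and scale_mult_right: "x * s a y = s a (x * y)"
    and comult_mult:
      "\<Delta> (x * y) = tsum s s (\<lambda>a b. tsum s s (\<lambda>c d. tens s s (a * c) (b * d)) (\<Delta> y)) (\<Delta> x)"
    and comult_one: "\<Delta> 1 = tens s s 1 1"
    and counit_mult: "\<epsilon> (x * y) = \<epsilon> x * \<epsilon> y"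
    and counit_one: "\<epsilon> 1 = 1"
    and antipode_linear: "Vector_Spaces.linear s s S"
    and antipode_left: "tsum s s (\<lambda>a b. S a * b) (\<Delta> x) = s (\<epsilon> x) 1"
    and antipode_right: "tsum s s (\<lambda>a b. a * S b) (\<Delta> x) = s (\<epsilon> x) 1"

locale right_module_coalgebra =
  H: hopf_algebra sH \<Delta>H \<epsilon>H S + C: coalgebra sC \<Delta>C \<epsilon>C
  for sH :: "'k::field \<Rightarrow> 'h::ring_1 \<Rightarrow> 'h" and \<Delta>H \<epsilon>H S
    and sC :: "'k \<Rightarrow> 'c::ab_group_add \<Rightarrow> 'c" and \<Delta>C \<epsilon>C +
  fixes act :: "'c \<Rightarrow> 'h \<Rightarrow> 'c"
  assumes act_bilinear: "bilin_on sC sH sC UNIV UNIV act"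
    and act_one: "act c 1 = c"
    and act_act: "act (act c g) h = act c (g * h)"
    and comult_act:
      "\<Delta>C (act c h) =
        tsum sC sC (\<lambda>a b. tsum sH sH (\<lambda>g k. tens sC sC (act a g) (act b k)) (\<Delta>H h)) (\<Delta>C c)"
    and counit_act: "\<epsilon>C (act c h) = \<epsilon>C c * \<epsilon>H h"


section \<open>Left comodules and the subcoalgebras \<open>C(\<tau>)\<close>\<close>

text \<open>
  A comodule is a subspace \<open>V\<close> of an ambient vector space with a coaction, of which only
  the values on \<open>V\<close> matter.
\<close>

definition left_comodule where
  "left_comodule sH \<Delta>H \<epsilon>H sV V \<rho> \<longleftrightarrow>
    vector_space sV \<and> module.subspace sV V \<and>
    lin_on sV tscale V \<rho> \<and> \<rho> ` V \<subseteq> tspace sH sV UNIV V \<and>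
    (\<forall>v\<in>V.
      tlift sH sV UNIV V (\<lambda>h w. tsum sH sH (\<lambda>a b. tens tscale sV (tens sH sH a b) w) (\<Delta>H h)) (\<rho> v) =
      tlift sH sV UNIV V (\<lambda>h w. tlift sH sV UNIV V (\<lambda>k u. tens tscale sV (tens sH sH h k) u) (\<rho> w)) (\<rho> v)) \<and>
    (\<forall>v\<in>V. tlift sH sV UNIV V (\<lambda>h w. sV (\<epsilon>H h) w) (\<rho> v) = v)"

definition right_comodule where
  "right_comodule sH \<Delta>H \<epsilon>H sV V \<rho> \<longleftrightarrow>
    vector_space sV \<and> module.subspace sV V \<and>
    lin_on sV tscale V \<rho> \<and> \<rho> ` V \<subseteq> tspace sV sH V UNIV \<and>
    (\<forall>v\<in>V.
      tlift sV sH V UNIV (\<lambda>w h. tlift sV sH V UNIV (\<lambda>u k. tens tscale sH (tens sV sH u k) h) (\<rho> w)) (\<rho> v) =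
      tlift sV sH V UNIV (\<lambda>w h. tsum sH sH (\<lambda>a b. tens tscale sH (tens sV sH w a) b) (\<Delta>H h)) (\<rho> v)) \<and>
    (\<forall>v\<in>V. tlift sV sH V UNIV (\<lambda>w h. sV (\<epsilon>H h) w) (\<rho> v) = v)"

definition simple_left_comodule where
  "simple_left_comodule sH \<Delta>H \<epsilon>H sV V \<rho> \<longleftrightarrow>
    left_comodule sH \<Delta>H \<epsilon>H sV V \<rho> \<and> V \<noteq> {0} \<and>
    (\<forall>W. module.subspace sV W \<and> W \<subseteq> V \<and> \<rho> ` W \<subseteq> tspace sH sV UNIV W \<longrightarrow> W = {0} \<or> W = V)"

definition left_colinear where
  "left_colinear sH sV V \<rho> sW W \<sigma> f \<longleftrightarrow>
    lin_on sV sW V f \<and> f ` V \<subseteq> W \<and>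
    (\<forall>v\<in>V. \<sigma> (f v) = tlift sH sV UNIV V (\<lambda>h w. tens sH sW h (f w)) (\<rho> v))"

text \<open>
  The set \<open>comod_classes\<close> of isomorphism classes of simple left comodules.  It uses the comodules
  whose underlying space is a subspace of \<open>H\<close> (with an arbitrary coaction, not necessarily \<open>\<Delta>\<close>).
  All isomorphism classes are represented: for a simple left comodule \<open>V\<close> and a nonzero linear
  functional \<open>f\<close> on \<open>V\<close>, applying \<open>f\<close> to the second factor of \<open>\<rho> v\<close> defines an injective linear
  map from \<open>V\<close> to \<open>H\<close>.
\<close>

definition simple_comodules where
  "simple_comodules sH \<Delta>H \<epsilon>H = {(V, \<rho>). simple_left_comodule sH \<Delta>H \<epsilon>H sH V \<rho>}"

definition comodule_iso_rel where
  "comodule_iso_rel sH \<Delta>H \<epsilon>H =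
    {((V, \<rho>), (W, \<sigma>)). (V, \<rho>) \<in> simple_comodules sH \<Delta>H \<epsilon>H \<and> (W, \<sigma>) \<in> simple_comodules sH \<Delta>H \<epsilon>H \<and>
      (\<exists>f. left_colinear sH sH V \<rho> sH W \<sigma> f \<and> bij_betw f V W)}"

definition comod_classes where
  "comod_classes sH \<Delta>H \<epsilon>H = simple_comodules sH \<Delta>H \<epsilon>H // comodule_iso_rel sH \<Delta>H \<epsilon>H"

definition class_coalg where
  "class_coalg sH \<Delta>H \<tau> =
    (THE D. simple_subcoalgebra sH \<Delta>H D \<and> (\<forall>(V, \<rho>)\<in>\<tau>. \<rho> ` V \<subseteq> tspace sH sH D V))"


section \<open>The category of bicomodules with a compatible right action\<close>

record ('k, 'h, 'm) bicomod =
  carr :: "'m set"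
  scl :: "'k \<Rightarrow> 'm \<Rightarrow> 'm"
  ract :: "'m \<Rightarrow> 'h \<Rightarrow> 'm"
  lco :: "'m \<Rightarrow> ('h, 'm, 'k) tensor"
  rco :: "'m \<Rightarrow> ('m, 'h, 'k) tensor"

definition HMHH_object where
  "HMHH_object sH \<Delta>H \<epsilon>H M \<longleftrightarrow>
    left_comodule sH \<Delta>H \<epsilon>H (scl M) (carr M) (lco M) \<and>
    right_comodule sH \<Delta>H \<epsilon>H (scl M) (carr M) (rco M) \<and>
    (\<forall>m\<in>carr M.
      tlift sH (scl M) UNIV (carr M) (\<lambda>h v. tlift (scl M) sH (carr M) UNIV
        (\<lambda>w k. tens tscale sH (tens sH (scl M) h w) k) (rco M v)) (lco M m) =
      tlift (scl M) sH (carr M) UNIV (\<lambda>v k. tlift sH (scl M) UNIV (carr M)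
        (\<lambda>h w. tens tscale sH (tens sH (scl M) h w) k) (lco M v)) (rco M m)) \<and>
    bilin_on (scl M) sH (scl M) (carr M) UNIV (ract M) \<and>
    (\<forall>m\<in>carr M. \<forall>h. ract M m h \<in> carr M) \<and>
    (\<forall>m\<in>carr M. ract M m 1 = m) \<and>
    (\<forall>m\<in>carr M. \<forall>g h. ract M (ract M m g) h = ract M m (g * h)) \<and>
    (\<forall>m\<in>carr M. \<forall>h. lco M (ract M m h) =
      tlift sH (scl M) UNIV (carr M) (\<lambda>a v. tsum sH sH
        (\<lambda>g k. tens sH (scl M) (a * g) (ract M v k)) (\<Delta>H h)) (lco M m)) \<and>
    (\<forall>m\<in>carr M. \<forall>h. rco M (ract M m h) =
      tlift (scl M) sH (carr M) UNIV (\<lambda>v a. tsum sH sH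
        (\<lambda>g k. tens (scl M) sH (ract M v g) (a * k)) (\<Delta>H h)) (rco M m))"

definition HMHH_morphism where
  "HMHH_morphism sH M N f \<longleftrightarrow>
    left_colinear sH (scl M) (carr M) (lco M) (scl N) (carr N) (lco N) f \<and>
    (\<forall>m\<in>carr M. rco N (f m) =
      tlift (scl M) sH (carr M) UNIV (\<lambda>w h. tens (scl N) sH (f w) h) (rco M m)) \<and>
    (\<forall>m\<in>carr M. \<forall>h. f (ract M m h) = ract N (f m) h)"

definition HMHH_isomorphic where
  "HMHH_isomorphic sH \<Delta>H \<epsilon>H M N \<longleftrightarrow>
    HMHH_object sH \<Delta>H \<epsilon>H M \<and> HMHH_object sH \<Delta>H \<epsilon>H N \<and>
    (\<exists>f g. HMHH_morphism sH M N f \<and> HMHH_morphism sH N M g \<and>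
      (\<forall>m\<in>carr M. g (f m) = m) \<and> (\<forall>n\<in>carr N. f (g n) = n))"


section \<open>Coinvariants and the smash coproduct\<close>

context
  fixes sH :: "'k::field \<Rightarrow> 'h::ring_1 \<Rightarrow> 'h"
    and \<Delta>H :: "'h \<Rightarrow> ('h, 'h, 'k) tensor"
    and S :: "'h \<Rightarrow> 'h"
    and sC :: "'k \<Rightarrow> 'c::ab_group_add \<Rightarrow> 'c"
    and \<Delta>C :: "'c \<Rightarrow> ('c, 'c, 'k) tensor"
    and act :: "'c \<Rightarrow> 'h \<Rightarrow> 'c"
    and \<pi> :: "'c \<Rightarrow> 'h"
begin

definition left_coact :: "'c \<Rightarrow> ('h, 'c, 'k) tensor"
  where "left_coact c = tsum sC sC (\<lambda>x y. tens sH sC (\<pi> x) y) (\<Delta>C c)"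

definition right_coact :: "'c \<Rightarrow> ('c, 'h, 'k) tensor"
  where "right_coact c = tsum sC sC (\<lambda>x y. tens sC sH x (\<pi> y)) (\<Delta>C c)"

definition coinv :: "'c set"
  where "coinv = {c. right_coact c = tens sC sH c 1}"

text \<open>
  The comultiplication \<open>\<delta>\<close> of \<open>R\<close>, given by the same formula on all of \<open>C\<close>; only its restriction to
  \<open>coinv\<close> is used.
\<close>

definition coinv_comult :: "'c \<Rightarrow> ('c, 'c, 'k) tensor"
  where "coinv_comult c =
    tsum sC sC (\<lambda>x y. tsum sC sC (\<lambda>a b. tens sC sC (act a (S (\<pi> b))) y) (\<Delta>C x)) (\<Delta>C c)"

definition sub_bicomod :: "'c set \<Rightarrow> ('k, 'h, 'c) bicomod"
  where "sub_bicomod X =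
    \<lparr>carr = X, scl = sC, ract = act, lco = left_coact, rco = right_coact\<rparr>"

text \<open>
  The object underlying the smash coproduct of \<open>X\<close> and \<open>H\<close>, for a left subcomodule \<open>X\<close> of \<open>R\<close>: left
  coaction \<open>r # h \<mapsto> r\<^sub>\<langle>\<^sub>-\<^sub>1\<^sub>\<rangle> h\<^sub>(\<^sub>1\<^sub>) \<otimes> (r\<^sub>\<langle>\<^sub>0\<^sub>\<rangle> # h\<^sub>(\<^sub>2\<^sub>))\<close>, right action \<open>(r # h) k = r # h k\<close>,
  right coaction \<open>r # h \<mapsto> (r # h\<^sub>(\<^sub>1\<^sub>)) \<otimes> h\<^sub>(\<^sub>2\<^sub>)\<close>.
\<close>

definition smash_bicomod :: "'c set \<Rightarrow> ('k, 'h, ('c, 'h, 'k) tensor) bicomod"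
  where "smash_bicomod X =
    \<lparr>carr = tspace sC sH X UNIV,
     scl = tscale,
     ract = (\<lambda>t k. tsum sC sH (\<lambda>r h. tens sC sH r (h * k)) t),
     lco = tsum sC sH (\<lambda>r h. tsum sH sC (\<lambda>a c. tsum sH sH
       (\<lambda>g k. tens sH tscale (a * g) (tens sC sH c k)) (\<Delta>H h)) (left_coact r)),
     rco = tsum sC sH (\<lambda>r h. tsum sH sH (\<lambda>g k. tens tscale sH (tens sC sH r g) k) (\<Delta>H h))\<rparr>"

end

definition free_right_basis :: "('c::ab_group_add \<Rightarrow> 'h::ring_1 \<Rightarrow> 'c) \<Rightarrow> 'c set \<Rightarrow> 'c set \<Rightarrow> bool"
  where "free_right_basis act M B \<longleftrightarrow>
    B \<subseteq> M \<and> (\<forall>m\<in>M. \<forall>h. act m h \<in> M) \<and>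
    (\<forall>m\<in>M. \<exists>!f :: 'c \<Rightarrow> 'h. finite {b. f b \<noteq> 0} \<and> {b. f b \<noteq> 0} \<subseteq> B \<and>
      m = (\<Sum>b | f b \<noteq> 0. act b (f b)))"

definition right_span where
  "right_span s act X = lspan s {act x h | x h. x \<in> X}"

end

theory Submission
  imports Defs
begin

text \<open>
  The map \<open>proj c = c\<^sub>(\<^sub>1\<^sub>) S(\<pi> c\<^sub>(\<^sub>2\<^sub>))\<close> projects \<open>C\<close> onto \<open>R\<close> and preserves every \<open>C\<^sub>n\<close>, because \<open>C\<^sub>n\<close> is a
  subcoalgebra stable under \<open>H\<close>.  Hence \<open>c \<mapsto> proj c\<^sub>(\<^sub>1\<^sub>) # \<pi> c\<^sub>(\<^sub>2\<^sub>)\<close>, the inverse of \<open>r # h \<mapsto> r h\<close>, identifies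
  \<open>C\<^sub>n\<close> with \<open>(R \<inter> C\<^sub>n) # H\<close>, and it remains to see that \<open>R\<^sub>n = R \<inter> C\<^sub>n\<close>.  As \<open>\<delta> = (proj \<otimes> id) \<Delta>\<close> on \<open>R\<close>, and
  conversely \<open>\<Delta>\<close> is recovered from \<open>\<delta>\<close> by \<open>x \<otimes> y \<mapsto> x y\<^sub>\<langle>\<^sub>-\<^sub>1\<^sub>\<rangle> \<otimes> y\<^sub>\<langle>\<^sub>0\<^sub>\<rangle>\<close>, the spaces \<open>R \<inter> C\<^sub>n\<close> satisfy the recursion
  of a coradical filtration; their bottom term is the line through \<open>1\<close>, and it is the coradical of \<open>R\<close> because
  the coradical filtration of \<open>C\<close> is exhaustive.

  The form of \<open>\<Delta> r\<close> comes from the projection \<open>p = \<iota> \<pi>\<close> of \<open>C\<close> onto \<open>C\<^sub>0\<close>: since \<open>\<Delta> C\<^sub>n\<close> lies in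
  \<open>C\<^sub>0 \<otimes> C + C \<otimes> C\<^sub>n\<^sub>-\<^sub>1\<close> and in \<open>C\<^sub>n\<^sub>-\<^sub>1 \<otimes> C + C \<otimes> C\<^sub>0\<close>, the map \<open>((1 - p) \<otimes> (1 - p)) \<Delta>\<close> sends \<open>C\<^sub>n\<close> to
  \<open>C\<^sub>n\<^sub>-\<^sub>1 \<otimes> C\<^sub>n\<^sub>-\<^sub>1\<close>, and to \<open>0\<close> if \<open>n = 1\<close>.  For (b), \<open>R\<^sub>1\<close> is split into isotypic components by the
  functionals equal to the counit on one simple subcoalgebra of \<open>H\<close> and to zero on the others.
\<close>

text \<open>R is a left coideal of \<open>C\<close> but in general not a subcoalgebra, so
  \<open>\<delta>\<close> is a genuinely different comultiplication and the filtration of R cannot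
  be obtained by restricting that of \<open>C\<close>. It is handled as a linear map with \<delta> R
  \<subseteq> R \<otimes> R, and the coradical of R is found by playing each simple subcoalgebra of
  R against the filtration of \<open>C\<close>. Exhaustiveness of that filtration is proved for an
  arbitrary coalgebra over an arbitrary field, without passing to finite-dimensional dual algebras:
  a minimal left coideal outside the union has a simple quotient comodule, and the coefficient
  coalgebra of a simple comodule is simple. The same fact on coefficients makes the subcoalgebras
  C(\<tau>) well defined and shows that every simple subcoalgebra of H is one of them. The
  filtration is defined one-sidedly, with C_0 on the left of the wedge; the second of the two
  inclusions for \<Delta> C_n rests on associativity of the wedge.\<close>

text \<open>Tensors are functions, and unfolding their sums pointwise would hide their linear structure.\<close>

declare plus_fun_apply [simp del] zero_fun_apply [simp del] minus_apply [simp del]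

section \<open>Linear and bilinear maps\<close>

abbreviation lin where "lin \<equiv> Vector_Spaces.linear"

definition bilin where
  "bilin sA sB sU f \<longleftrightarrow> (\<forall>x. lin sB sU (f x)) \<and> (\<forall>y. lin sA sU (\<lambda>x. f x y))"

lemma linI:
  assumes "vector_space sA" "vector_space sB"
    "\<And>x y. f (x + y) = f x + f y" "\<And>a x. f (sA a x) = sB a (f x)"
  shows "lin sA sB f"
proof -
  interpret A: vector_space sA by fact
  interpret B: vector_space sB by fact
  show ?thesis by unfold_locales (use assms in auto)
qed

lemma lin_add: "lin sA sB f \<Longrightarrow> f (x + y) = f x + f y"
  by (simp add: Vector_Spaces.linear_iff)

lemma lin_scale: "lin sA sB f \<Longrightarrow> f (sA a x) = sB a (f x)"
  by (simp add: Vector_Spaces.linear_iff)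

lemma lin_zero: "lin sA sB f \<Longrightarrow> f 0 = 0"
  using lin_add[of sA sB f 0 0] by simp

lemma lin_minus: "lin sA sB f \<Longrightarrow> f (- x) = - f x"
  using lin_add[of sA sB f x "- x"] by (simp add: lin_zero eq_neg_iff_add_eq_0 add.commute)

lemma lin_diff: "lin sA sB f \<Longrightarrow> f (x - y) = f x - f y"
  using lin_add[of sA sB f x "- y"] by (simp add: lin_minus)

lemma lin_sum: "lin sA sB f \<Longrightarrow> f (sum g F) = (\<Sum>x\<in>F. f (g x))"
  by (induction F rule: infinite_finite_induct) (auto simp: lin_add lin_zero)

lemma lin_vs1: "lin sA sB f \<Longrightarrow> vector_space sA"
  and lin_vs2: "lin sA sB f \<Longrightarrow> vector_space sB"
  by (simp_all add: Vector_Spaces.linear_def)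

lemma lin_id: "vector_space s \<Longrightarrow> lin s s (\<lambda>x. x)"
  by (rule linI) auto

lemma lin_comp:
  assumes "lin sB sU f" "lin sA sB g"
  shows "lin sA sU (\<lambda>x. f (g x))"
  using assms by (intro linI) (auto simp: lin_add lin_scale dest: lin_vs1 lin_vs2)

lemma lin_plus:
  assumes "lin sA sB f" "lin sA sB g"
  shows "lin sA sB (\<lambda>x. f x + g x)"
proof -
  interpret B: vector_space sB using assms by (auto dest: lin_vs2)
  show ?thesis using assms
    by (intro linI) (auto simp: lin_add lin_scale B.scale_right_distrib dest: lin_vs1 lin_vs2)
qed

lemma lin_sub:
  assumes "lin sA sB f" "lin sA sB g"
  shows "lin sA sB (\<lambda>x. f x - g x)"
proof -
  interpret B: vector_space sB using assms by (auto dest: lin_vs2)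
  show ?thesis using assms
    by (intro linI) (auto simp: lin_add lin_scale B.scale_right_diff_distrib dest: lin_vs1 lin_vs2)
qed

lemma lin_scaled:
  assumes "lin sV sA g"
  shows "lin sV sA (\<lambda>x. sA a (g x))"
proof -
  interpret A: vector_space sA using assms by (rule lin_vs2)
  show ?thesis using assms
    by (intro linI) (auto simp: lin_add lin_scale A.scale_right_distrib A.scale_left_commute dest: lin_vs1 lin_vs2)
qed

lemma lin_scalar:
  assumes "lin sV (*) g" "vector_space sA"
  shows "lin sV sA (\<lambda>x. sA (g x) a)"
proof -
  interpret A: vector_space sA by fact
  show ?thesis using assms
    by (intro linI) (auto simp: lin_add lin_scale A.scale_left_distrib dest: lin_vs1)
qed

lemma bilinI:
  "(\<And>x. lin sB sU (f x)) \<Longrightarrow> (\<And>y. lin sA sU (\<lambda>x. f x y)) \<Longrightarrow> bilin sA sB sU f"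
  by (simp add: bilin_def)

lemma bilin_vs:
  assumes "bilin sA sB sU f"
  shows "vector_space sA" "vector_space sB" "vector_space sU"
  using assms by (auto simp: bilin_def dest: lin_vs1 lin_vs2)

lemma bilin_left: "bilin sA sB sU f \<Longrightarrow> lin sV sA g \<Longrightarrow> lin sV sU (\<lambda>x. f (g x) y)"
  using lin_comp[of sA sU "\<lambda>x. f x y"] by (simp add: bilin_def)

lemma bilin_right: "bilin sA sB sU f \<Longrightarrow> lin sV sB g \<Longrightarrow> lin sV sU (\<lambda>x. f y (g x))"
  using lin_comp[of sB sU "f y"] by (simp add: bilin_def)

lemma bilin_on_UNIV:
  assumes "vector_space sA" "vector_space sB" "vector_space sU" "bilin_on sA sB sU UNIV UNIV f"
  shows "bilin sA sB sU f"
  using assms by (auto simp: bilin_on_def lin_on_def intro!: bilinI linI)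

lemma lin_imp_lin_on: "lin sA sB f \<Longrightarrow> lin_on sA sB X f"
  by (auto simp: lin_on_def dest: lin_add lin_scale)

lemma bilin_imp_bilin_on: "bilin sA sB sU f \<Longrightarrow> bilin_on sA sB sU X Y f"
  by (simp add: bilin_on_def bilin_def lin_imp_lin_on)

section \<open>Subspaces, sums of subspaces and linear projections\<close>

lemma subspace_kernel: "lin sA sB f \<Longrightarrow> module.subspace sA {x. f x = 0}"
proof -
  assume f: "lin sA sB f"
  interpret A: vector_space sA using f by (rule lin_vs1)
  interpret B: vector_space sB using f by (rule lin_vs2)
  show ?thesis using f by (auto simp: A.subspace_def lin_zero lin_add lin_scale)
qed

lemma subspace_vimage:
  assumes f: "lin sA sB f" and Y: "module.subspace sB Y"
  shows "module.subspace sA {x. f x \<in> Y}"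
proof -
  interpret A: vector_space sA using f by (rule lin_vs1)
  interpret B: vector_space sB using f by (rule lin_vs2)
  show ?thesis using f Y
    by (auto simp: A.subspace_def lin_zero lin_add lin_scale B.subspace_0 B.subspace_add B.subspace_scale)
qed

lemma subspace_image:
  assumes f: "lin sA sB f" and X: "module.subspace sA X"
  shows "module.subspace sB (f ` X)"
proof -
  interpret f: Vector_Spaces.linear sA sB f by fact
  show ?thesis using X by (rule f.subspace_image)
qed

lemma subspace_ssum:
  assumes s: "vector_space s" and X: "module.subspace s X" and Y: "module.subspace s Y"
  shows "module.subspace s (ssum X Y)"
proof -
  interpret vector_space s by fact
  have "{x + y |x y. x \<in> X \<and> y \<in> Y} = (\<Union>x\<in>X. \<Union>y\<in>Y. {x + y})" by auto
  then show ?thesis unfolding ssum_def using subspace_sums[OF X Y] by simp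
qed

lemma ssumI: "x \<in> X \<Longrightarrow> y \<in> Y \<Longrightarrow> x + y \<in> ssum X Y"
  by (auto simp: ssum_def)

lemma ssum_left: "0 \<in> Y \<Longrightarrow> X \<subseteq> ssum X (Y :: 'a::ab_group_add set)"
  by (auto simp: ssum_def) (metis add.right_neutral)

lemma ssum_right: "0 \<in> X \<Longrightarrow> Y \<subseteq> ssum X (Y :: 'a::ab_group_add set)"
  by (auto simp: ssum_def) (metis add.left_neutral)

lemma ssum_mono: "X \<subseteq> X' \<Longrightarrow> Y \<subseteq> Y' \<Longrightarrow> ssum X Y \<subseteq> ssum X' Y'"
  by (auto simp: ssum_def)

text \<open>If \<open>e\<close> projects onto X, then \<open>x - e x\<close> has kernel X, hence is
  injective on D, and composing it with a left inverse that takes values in D gives the required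
  map. The case X = {0} yields a projection onto any subspace, the usual device here for extending a
  map beyond the subspace on which it is given.\<close>

lemma ex_projection:
  assumes s: "vector_space s" and D: "module.subspace s D" and X: "module.subspace s X"
    and DX: "D \<inter> X = {0}"
  obtains p where "lin s s p" "range p \<subseteq> D" "\<And>x. x \<in> D \<Longrightarrow> p x = x" "\<And>x. x \<in> X \<Longrightarrow> p x = 0"
proof -
  interpret vector_space s by fact
  interpret P: vector_space_pair s s ..
  obtain e where e: "range e \<subseteq> X" "lin s s e" "\<forall>x\<in>X. e (id x) = x"
    using P.linear_exists_left_inverse_on[of id X] X linear_id by auto
  have q: "lin s s (\<lambda>x. x - e x)"
    by (intro lin_sub lin_id s e(2))
  have "inj_on (\<lambda>x. x - e x) D"
  proof (rule inj_onI)
    fix x y assume xy: "x \<in> D" "y \<in> D" "x - e x = y - e y"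
    then have "x - y = e x - e y" by (simp add: algebra_simps)
    moreover have "x - y \<in> D" using xy D by (simp add: subspace_diff)
    moreover have "e x - e y \<in> X" using e(1) X by (auto intro: subspace_diff)
    ultimately have "e x - e y \<in> D \<inter> X" by auto
    then have "e x - e y = 0" using DX by blast
    with xy(3) show "x = y" by (simp add: algebra_simps)
  qed
  then obtain g where g: "range g \<subseteq> D" "lin s s g" "\<forall>x\<in>D. g (x - e x) = x"
    using P.linear_exists_left_inverse_on[OF q D] by auto
  show ?thesis
    by (rule that[of "\<lambda>x. g (x - e x)"])
      (use g e in \<open>auto intro: lin_comp[OF g(2) q] simp: lin_zero[OF g(2)]\<close>)
qed

section \<open>Tensors\<close>

lemma bilin_tens:
  assumes "vector_space sA" "vector_space sB"
  shows "bilin sA sB tscale (tens sA sB)"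
  using assms bilin_on_tens[OF assms] by (intro bilin_on_UNIV vector_space_tscale)

lemma lin_tens1: "lin sV sA g \<Longrightarrow> vector_space sB \<Longrightarrow> lin sV tscale (\<lambda>x. tens sA sB (g x) y)"
  by (rule bilin_left[OF bilin_tens]) (auto dest: lin_vs2)

lemma lin_tens2: "lin sV sB g \<Longrightarrow> vector_space sA \<Longrightarrow> lin sV tscale (\<lambda>x. tens sA sB y (g x))"
  by (rule bilin_right[OF bilin_tens]) (auto dest: lin_vs2)

lemma subspace_tspace:
  fixes sA :: "'k::field \<Rightarrow> 'a::ab_group_add \<Rightarrow> 'a" and sB :: "'k \<Rightarrow> 'b::ab_group_add \<Rightarrow> 'b"
  shows "module.subspace tscale (tspace sA sB X Y)"
proof -
  interpret T: vector_space "tscale :: 'k \<Rightarrow> ('a, 'b, 'k) tensor \<Rightarrow> _" by (rule vector_space_tscale)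
  show ?thesis by (simp add: tspace_def)
qed

lemma tens_mem:
  fixes sA :: "'k::field \<Rightarrow> 'a::ab_group_add \<Rightarrow> 'a" and sB :: "'k \<Rightarrow> 'b::ab_group_add \<Rightarrow> 'b"
  shows "x \<in> X \<Longrightarrow> y \<in> Y \<Longrightarrow> tens sA sB x y \<in> tspace sA sB X Y"
proof -
  interpret T: vector_space "tscale :: 'k \<Rightarrow> ('a, 'b, 'k) tensor \<Rightarrow> _" by (rule vector_space_tscale)
  show "x \<in> X \<Longrightarrow> y \<in> Y \<Longrightarrow> tens sA sB x y \<in> tspace sA sB X Y"
    unfolding tspace_def by (rule T.span_base) auto
qed

lemma tspace_zero_add_scale_diff:
  fixes sA :: "'k::field \<Rightarrow> 'a::ab_group_add \<Rightarrow> 'a" and sB :: "'k \<Rightarrow> 'b::ab_group_add \<Rightarrow> 'b"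
  shows tspace_zero: "0 \<in> tspace sA sB X Y"
  and tspace_add: "t \<in> tspace sA sB X Y \<Longrightarrow> u \<in> tspace sA sB X Y \<Longrightarrow> t + u \<in> tspace sA sB X Y"
  and tspace_scale: "t \<in> tspace sA sB X Y \<Longrightarrow> tscale a t \<in> tspace sA sB X Y"
  and tspace_diff: "t \<in> tspace sA sB X Y \<Longrightarrow> u \<in> tspace sA sB X Y \<Longrightarrow> t - u \<in> tspace sA sB X Y"
proof -
  interpret T: vector_space "tscale :: 'k \<Rightarrow> ('a, 'b, 'k) tensor \<Rightarrow> _" by (rule vector_space_tscale)
  note s = subspace_tspace[of sA sB X Y]
  show "0 \<in> tspace sA sB X Y" using s by (rule T.subspace_0)
  show "t + u \<in> tspace sA sB X Y" if "t \<in> tspace sA sB X Y" "u \<in> tspace sA sB X Y"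
    using s that by (rule T.subspace_add)
  show "tscale a t \<in> tspace sA sB X Y" if "t \<in> tspace sA sB X Y"
    using s that by (rule T.subspace_scale)
  show "t - u \<in> tspace sA sB X Y" if "t \<in> tspace sA sB X Y" "u \<in> tspace sA sB X Y"
    using s that by (rule T.subspace_diff)
qed

lemma tspace_mono:
  fixes sA :: "'k::field \<Rightarrow> 'a::ab_group_add \<Rightarrow> 'a" and sB :: "'k \<Rightarrow> 'b::ab_group_add \<Rightarrow> 'b"
  shows "X \<subseteq> X' \<Longrightarrow> Y \<subseteq> Y' \<Longrightarrow> tspace sA sB X Y \<subseteq> tspace sA sB X' Y'"
proof -
  interpret T: vector_space "tscale :: 'k \<Rightarrow> ('a, 'b, 'k) tensor \<Rightarrow> _" by (rule vector_space_tscale)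
  show "X \<subseteq> X' \<Longrightarrow> Y \<subseteq> Y' \<Longrightarrow> tspace sA sB X Y \<subseteq> tspace sA sB X' Y'"
    unfolding tspace_def by (intro T.span_mono) auto
qed

lemma tspace_UNIV: "t \<in> tspace sA sB X Y \<Longrightarrow> t \<in> tspace sA sB UNIV UNIV"
  using tspace_mono[of X UNIV Y UNIV] by auto

lemma tspace_induct [consumes 4, case_names zero add]:
  assumes A: "vector_space sA" and B: "vector_space sB" and X: "module.subspace sA X"
    and t: "t \<in> tspace sA sB X Y"
    and z: "P 0"
    and a: "\<And>x y u. x \<in> X \<Longrightarrow> y \<in> Y \<Longrightarrow> u \<in> tspace sA sB X Y \<Longrightarrow> P u \<Longrightarrow> P (tens sA sB x y + u)"
  shows "P t"
proof -
  obtain l where l: "set l \<subseteq> X \<times> Y" "t = sum_list (map (\<lambda>(x, y). tens sA sB x y) l)"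
    using t unfolding tspace_list[OF A B X] by auto
  have "sum_list (map (\<lambda>(x, y). tens sA sB x y) l) \<in> tspace sA sB X Y \<and>
    P (sum_list (map (\<lambda>(x, y). tens sA sB x y) l))"
    using l(1)
  proof (induction l)
    case (Cons p l)
    then show ?case by (cases p) (auto intro!: a tspace_add tens_mem)
  qed (auto intro: z tspace_zero)
  with l(2) show ?thesis by simp
qed

lemma subspace_univ: "vector_space s \<Longrightarrow> module.subspace s UNIV"
  by (simp add: module_iff_vector_space[symmetric] module.subspace_UNIV)

lemma tsum_tens: "bilin sA sB sU f \<Longrightarrow> tsum sA sB f (tens sA sB x y) = f x y"
  by (rule tlift_tens) (auto intro: bilin_vs subspace_univ bilin_imp_bilin_on)

lemma tsum_lin_on:
  "bilin sA sB sU f \<Longrightarrow> lin_on tscale sU (tspace sA sB UNIV UNIV) (tsum sA sB f)"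
  by (rule tlift_linear) (auto intro: bilin_vs subspace_univ bilin_imp_bilin_on)

lemma tsum_add:
  "bilin sA sB sU f \<Longrightarrow> t \<in> tspace sA sB UNIV UNIV \<Longrightarrow> u \<in> tspace sA sB UNIV UNIV \<Longrightarrow>
    tsum sA sB f (t + u) = tsum sA sB f t + tsum sA sB f u"
  using tsum_lin_on unfolding lin_on_def by blast

lemma tsum_scale:
  "bilin sA sB sU f \<Longrightarrow> t \<in> tspace sA sB UNIV UNIV \<Longrightarrow>
    tsum sA sB f (tscale a t) = sU a (tsum sA sB f t)"
  using tsum_lin_on unfolding lin_on_def by blast

lemma tsum_zero: "bilin sA sB sU f \<Longrightarrow> tsum sA sB f 0 = 0"
  using tsum_add[of sA sB sU f 0 0] by (simp add: tspace_zero)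

text \<open>The type of tensors also contains functionals outside the span of the pure tensors, and
  \<open>tsum\<close> is linear only on that span. For this reason membership in
  \<open>tspace\<close> accompanies every composition with \<open>tsum\<close>, here as the second
  part of the assumption on \<open>g\<close>.\<close>

lemma lin_tsum:
  assumes f: "bilin sA sB sU f" and g: "lin sV tscale g" "\<And>x. g x \<in> tspace sA sB UNIV UNIV"
  shows "lin sV sU (\<lambda>x. tsum sA sB f (g x))"
  using assms
  by (intro linI) (auto simp: lin_add[OF g(1)] lin_scale[OF g(1)] tsum_add tsum_scale
      dest: bilin_vs lin_vs1)

lemma tspace_induct_UNIV [consumes 3, case_names zero add]:
  assumes "vector_space sA" "vector_space sB" "t \<in> tspace sA sB UNIV UNIV" "P 0"
    "\<And>x y u. u \<in> tspace sA sB UNIV UNIV \<Longrightarrow> P u \<Longrightarrow> P (tens sA sB x y + u)"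
  shows "P t"
  using tspace_induct[OF assms(1,2) subspace_univ[OF assms(1)] assms(3), of P] assms(4,5) by blast

lemmas tsum_simps = tsum_add tsum_zero tsum_tens

lemma tsum_comp:
  assumes f: "bilin sA sB sU f" and h: "lin sU sW h" and t: "t \<in> tspace sA sB UNIV UNIV"
  shows "h (tsum sA sB f t) = tsum sA sB (\<lambda>x y. h (f x y)) t"
proof -
  have hf: "bilin sA sB sW (\<lambda>x y. h (f x y))"
    using f h by (auto simp: bilin_def intro: lin_comp)
  from bilin_vs(1,2)[OF f] t show ?thesis
    by (induction rule: tspace_induct_UNIV)
      (simp_all add: tsum_simps[OF f] tsum_simps[OF hf] tens_mem lin_zero[OF h] lin_add[OF h])
qed

text \<open>Here the integrand varies, as against \<open>lin_tsum\<close>, where the tensor does.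
  Together the two rules let a nested Sweedler sum be recognised as linear in each variable by
  introduction rules alone.\<close>

lemma tsum_param:
  assumes F: "\<And>x. bilin sA sB sU (F x)" and L: "\<And>a b. lin sV sU (\<lambda>x. F x a b)"
    and t: "t \<in> tspace sA sB UNIV UNIV"
  shows "lin sV sU (\<lambda>x. tsum sA sB (F x) t)"
proof -
  interpret U: vector_space sU using F by (rule bilin_vs)
  have "tsum sA sB (F (v + w)) t = tsum sA sB (F v) t + tsum sA sB (F w) t" for v w
    using bilin_vs(1,2)[OF F] t
  proof (induction rule: tspace_induct_UNIV)
    case (add x y u)
    then show ?case using lin_add[OF L[of x y], of v w] by (simp add: tsum_simps[OF F] tens_mem)
  qed (simp add: tsum_simps[OF F])
  moreover have "tsum sA sB (F (sV a v)) t = sU a (tsum sA sB (F v) t)" for a v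
    using bilin_vs(1,2)[OF F] t
  proof (induction rule: tspace_induct_UNIV)
    case (add x y u)
    then show ?case using lin_scale[OF L[of x y], of a v]
      by (simp add: tsum_simps[OF F] tens_mem U.scale_right_distrib)
  qed (simp add: tsum_simps[OF F])
  ultimately show ?thesis using lin_vs1[OF L] U.vector_space_axioms by (intro linI) auto
qed

lemma tsum_mem:
  assumes f: "bilin sA sB sU f" and X: "module.subspace sA X" and t: "t \<in> tspace sA sB X Y"
    and Z: "module.subspace sU Z" and fZ: "\<And>x y. x \<in> X \<Longrightarrow> y \<in> Y \<Longrightarrow> f x y \<in> Z"
  shows "tsum sA sB f t \<in> Z"
proof -
  interpret U: vector_space sU using f by (rule bilin_vs)
  from bilin_vs(1,2)[OF f] X t show ?thesis
    by (induction rule: tspace_induct)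
      (auto simp: tsum_simps[OF f] tspace_UNIV tens_mem Z U.subspace_0 fZ
        intro!: U.subspace_add[OF Z])
qed

lemma tsum_cong_on:
  assumes f: "bilin sA sB sU f" and g: "bilin sA sB sU g" and X: "module.subspace sA X"
    and t: "t \<in> tspace sA sB X Y"
    and fg: "\<And>x y. x \<in> X \<Longrightarrow> y \<in> Y \<Longrightarrow> f x y = g x y"
  shows "tsum sA sB f t = tsum sA sB g t"
  using bilin_vs(1,2)[OF f] X t
  by (induction rule: tspace_induct)
    (auto simp: tsum_simps[OF f] tsum_simps[OF g] tspace_UNIV tens_mem fg)

lemma tsum_id:
  assumes "vector_space sA" "vector_space sB" "t \<in> tspace sA sB UNIV UNIV"
  shows "tsum sA sB (tens sA sB) t = t"
  using assms
  by (induction rule: tspace_induct_UNIV)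
    (auto simp: tsum_simps[OF bilin_tens[OF assms(1,2)]] tens_mem)

lemma tsum_in_tspace:
  assumes f: "bilin sA sB tscale f" and "\<And>x y. f x y \<in> tspace sC sD X Y"
    and t: "t \<in> tspace sA sB UNIV UNIV"
  shows "tsum sA sB f t \<in> tspace sC sD X Y"
  by (rule tsum_mem[OF f subspace_univ t subspace_tspace]) (use assms bilin_vs in auto)

lemma tsum_tsum:
  assumes f: "bilin sC sD sU f" and g: "bilin sA sB tscale g"
    and gT: "\<And>x y. g x y \<in> tspace sC sD UNIV UNIV"
    and t: "t \<in> tspace sA sB UNIV UNIV"
  shows "tsum sC sD f (tsum sA sB g t) = tsum sA sB (\<lambda>x y. tsum sC sD f (g x y)) t"
proof -
  have fg: "bilin sA sB sU (\<lambda>x y. tsum sC sD f (g x y))"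
    using g gT by (auto simp: bilin_def intro!: lin_tsum[OF f])
  from bilin_vs(1,2)[OF g] t show ?thesis
    by (induction rule: tspace_induct_UNIV)
      (auto simp: tsum_simps[OF f] tsum_simps[OF g] tsum_simps[OF fg] tens_mem gT
        tsum_in_tspace[OF g gT])
qed

text \<open>The axioms of comodules are stated with \<open>tlift\<close> over the carrier, where the
  integrand matters only on X \<times> Y. Choosing an everywhere bilinear \<open>F'\<close> that
  agrees with it there moves the computation to \<open>tsum\<close>, for which the Sweedler calculus
  is developed.\<close>

lemma tlift_eq_tsum:
  assumes F': "bilin sA sB sU F'" and X: "module.subspace sA X" and Y: "module.subspace sB Y"
    and F: "\<And>x y. x \<in> X \<Longrightarrow> y \<in> Y \<Longrightarrow> F x y = F' x y"
    and t: "t \<in> tspace sA sB X Y"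
  shows "tlift sA sB X Y F t = tsum sA sB F' t"
proof -
  note vs = bilin_vs[OF F']
  obtain l where l: "set l \<subseteq> X \<times> Y" "t = sum_list (map (\<lambda>(x, y). tens sA sB x y) l)"
    using t unfolding tspace_list[OF vs(1,2) X] by auto
  interpret A: vector_space sA by (fact vs)
  interpret B: vector_space sB by (fact vs)
  have "bilin_on sA sB sU X Y F \<longleftrightarrow> bilin_on sA sB sU X Y F'"
    using F X Y by (auto simp: bilin_on_def lin_on_def A.subspace_add A.subspace_scale
        B.subspace_add B.subspace_scale)
  then have FF: "bilin_on sA sB sU X Y F" using F' by (simp add: bilin_imp_bilin_on)
  have "tlift sA sB X Y F t = sum_list (map (\<lambda>(x, y). F x y) l)"
    unfolding l(2) by (rule tlift_list[OF vs X Y FF l(1)])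
  also have "map (\<lambda>(x, y). F x y) l = map (\<lambda>(x, y). F' x y) l"
    using l(1) F by (intro map_cong) auto
  also have "sum_list \<dots> = tsum sA sB F' t"
    unfolding l(2)
    by (rule tlift_list[OF vs subspace_univ subspace_univ bilin_imp_bilin_on[OF F'], symmetric]) (use vs in auto)
  finally show ?thesis .
qed

lemma bilin_tmap:
  assumes "lin sA sA' f" "lin sB sB' g"
  shows "bilin sA sB tscale (\<lambda>x y. tens sA' sB' (f x) (g y))"
  using assms by (intro bilinI lin_tens1 lin_tens2) (auto dest: lin_vs2)

lemma bilin_sub:
  "bilin sA sB sU f \<Longrightarrow> bilin sA sB sU g \<Longrightarrow> bilin sA sB sU (\<lambda>x y. f x y - g x y)"
  by (simp add: bilin_def lin_sub)

lemma bilin_plus: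
  "bilin sA sB sU f \<Longrightarrow> bilin sA sB sU g \<Longrightarrow> bilin sA sB sU (\<lambda>x y. f x y + g x y)"
  by (simp add: bilin_def lin_plus)

lemma bilin_scale1: "vector_space sB \<Longrightarrow> lin sA (*) f \<Longrightarrow> bilin sA sB sB (\<lambda>x y. sB (f x) y)"
  by (intro bilinI lin_scaled lin_scalar lin_id)

lemma bilin_scale2: "vector_space sA \<Longrightarrow> lin sB (*) f \<Longrightarrow> bilin sA sB sA (\<lambda>x y. sA (f y) x)"
  by (intro bilinI lin_scaled lin_scalar lin_id)

lemma tsum_plus:
  assumes f: "bilin sA sB sU f" and g: "bilin sA sB sU g" and t: "t \<in> tspace sA sB UNIV UNIV"
  shows "tsum sA sB (\<lambda>x y. f x y + g x y) t = tsum sA sB f t + tsum sA sB g t"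
  using bilin_vs(1,2)[OF f] t
  by (induction rule: tspace_induct_UNIV)
    (auto simp: tsum_simps[OF f] tsum_simps[OF g] tsum_simps[OF bilin_plus[OF f g]] tens_mem
     )

lemma tsum_sub:
  assumes f: "bilin sA sB sU f" and g: "bilin sA sB sU g" and t: "t \<in> tspace sA sB UNIV UNIV"
  shows "tsum sA sB (\<lambda>x y. f x y - g x y) t = tsum sA sB f t - tsum sA sB g t"
  using bilin_vs(1,2)[OF f] t
  by (induction rule: tspace_induct_UNIV)
    (auto simp: tsum_simps[OF f] tsum_simps[OF g] tsum_simps[OF bilin_sub[OF f g]] tens_mem
     )

section \<open>Kernels and intersections in tensor products\<close>

lemma ex_splitting:
  assumes f: "lin sA sB f"
  obtains L where "lin sB sA L" "\<And>x. f (x - L (f x)) = 0"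
proof -
  interpret A: vector_space sA using f by (rule lin_vs1)
  interpret B: vector_space sB using f by (rule lin_vs2)
  interpret P: vector_space_pair sA sB ..
  obtain g where g: "lin sB sA g" "\<forall>v\<in>f ` UNIV. f (g v) = v"
    using P.linear_exists_right_inverse_on[OF f A.subspace_UNIV] by auto
  show ?thesis
    by (rule that[OF g(1)]) (use g in \<open>auto simp: lin_diff[OF f]\<close>)
qed

text \<open>With \<open>L\<close> and \<open>M\<close> such that f L f = f and g M g = g, a pure
  tensor x \<otimes> y splits as (x - L f x) \<otimes> y + L f x \<otimes> (y - M g y) + L f x
  \<otimes> M g y. The last terms sum to L \<otimes> M applied to the vanishing (f \<otimes> g) t;
  each of the first two has a factor in a kernel.\<close>

lemma tensor_kernel:
  assumes f: "lin sA sA' f" and g: "lin sB sB' g" and t: "t \<in> tspace sA sB UNIV UNIV"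
    and 0: "tsum sA sB (\<lambda>x y. tens sA' sB' (f x) (g y)) t = 0"
  shows "t \<in> ssum (tspace sA sB {x. f x = 0} UNIV) (tspace sA sB UNIV {y. g y = 0})"
proof -
  note vs = lin_vs1[OF f] lin_vs1[OF g]
  obtain L where L: "lin sA' sA L" "\<And>x. f (x - L (f x)) = 0" by (rule ex_splitting[OF f]) blast
  obtain M where M: "lin sB' sB M" "\<And>x. g (x - M (g x)) = 0" by (rule ex_splitting[OF g]) blast
  have Lf: "lin sA sA (\<lambda>x. L (f x))" and Mg: "lin sB sB (\<lambda>x. M (g x))"
    using lin_comp L(1) M(1) f g by blast+
  note b = bilin_tmap[OF Lf lin_sub[OF lin_id[OF vs(2)] Mg]]
    bilin_tmap[OF lin_sub[OF lin_id[OF vs(1)] Lf] lin_id[OF vs(2)]]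
  have bl: "lin sA tscale (\<lambda>x. tens sA sB x y)" "lin sB tscale (\<lambda>y. tens sA sB x y)" for x y
    using bilin_tens[OF vs] by (auto simp: bilin_def)
  have "tsum sA sB (\<lambda>x y. tens sA sB (L (f x)) (M (g y))) t =
      tsum sA' sB' (\<lambda>x y. tens sA sB (L x) (M y)) (tsum sA sB (\<lambda>x y. tens sA' sB' (f x) (g y)) t)"
    by (subst tsum_tsum[OF bilin_tmap[OF L(1) M(1)] bilin_tmap[OF f g] _ t])
      (auto simp: tens_mem tsum_tens[OF bilin_tmap[OF L(1) M(1)]])
  then have 1: "tsum sA sB (\<lambda>x y. tens sA sB (L (f x)) (M (g y))) t = 0"
    by (simp add: 0 tsum_zero[OF bilin_tmap[OF L(1) M(1)]])
  have "t = tsum sA sB (tens sA sB) t" using tsum_id[OF vs t] by simp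
  also have "tens sA sB = (\<lambda>x y. (tens sA sB (x - L (f x)) y + tens sA sB (L (f x)) (y - M (g y)))
      + tens sA sB (L (f x)) (M (g y)))"
    by (rule ext, rule ext) (simp add: lin_diff[OF bl(1)] lin_diff[OF bl(2)])
  also have "tsum sA sB \<dots> t = tsum sA sB (\<lambda>x y. tens sA sB (x - L (f x)) y) t +
      tsum sA sB (\<lambda>x y. tens sA sB (L (f x)) (y - M (g y))) t"
    by (simp add: tsum_plus[OF bilin_plus[OF b(2,1)] bilin_tmap[OF Lf Mg] t] tsum_plus[OF b(2,1) t] 1)
  finally have "t = tsum sA sB (\<lambda>x y. tens sA sB (x - L (f x)) y) t +
      tsum sA sB (\<lambda>x y. tens sA sB (L (f x)) (y - M (g y))) t" .
  note eq = this
  have k1: "tsum sA sB (\<lambda>x y. tens sA sB (x - L (f x)) y) t \<in> tspace sA sB {x. f x = 0} UNIV"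
    by (intro tsum_in_tspace[OF b(2) _ t] tens_mem) (simp_all add: L(2))
  have k2: "tsum sA sB (\<lambda>x y. tens sA sB (L (f x)) (y - M (g y))) t \<in> tspace sA sB UNIV {y. g y = 0}"
    by (intro tsum_in_tspace[OF b(1) _ t] tens_mem) (simp_all add: M(2))
  show ?thesis using ssumI[OF k1 k2] unfolding eq[symmetric] .
qed

text \<open>For a projection \<open>p\<close> onto X, the map p \<otimes> id fixes X \<otimes> B
  pointwise and carries A \<otimes> Y into X \<otimes> Y.\<close>

lemma tspace_Int:
  assumes A: "vector_space sA" and B: "vector_space sB"
    and X: "module.subspace sA X" and Y: "module.subspace sB Y"
    and t1: "t \<in> tspace sA sB X UNIV" and t2: "t \<in> tspace sA sB UNIV Y"
  shows "t \<in> tspace sA sB X Y"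
proof -
  interpret A: vector_space sA by fact
  interpret B: vector_space sB by fact
  have "X \<inter> {0} = {0}" using A.subspace_0[OF X] by auto
  then obtain p where p: "lin sA sA p" "range p \<subseteq> X" "\<And>x. x \<in> X \<Longrightarrow> p x = x"
    using ex_projection[OF A X A.subspace_single_0] by metis
  have b: "bilin sA sB tscale (\<lambda>x y. tens sA sB (p x) y)"
    by (rule bilin_tmap[OF p(1) lin_id[OF B]])
  have "tsum sA sB (\<lambda>x y. tens sA sB (p x) y) t = tsum sA sB (tens sA sB) t"
    by (rule tsum_cong_on[OF b bilin_tens[OF A B] X t1]) (simp add: p(3))
  also have "\<dots> = t" by (rule tsum_id[OF A B tspace_UNIV[OF t1]])
  finally have "t = tsum sA sB (\<lambda>x y. tens sA sB (p x) y) t" by simp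
  moreover have "tsum sA sB (\<lambda>x y. tens sA sB (p x) y) t \<in> tspace sA sB X Y"
    by (rule tsum_mem[OF b A.subspace_UNIV t2 subspace_tspace]) (use p(2) in \<open>auto intro!: tens_mem\<close>)
  ultimately show ?thesis by simp
qed

text \<open>Projections \<open>p\<close>, \<open>q\<close> onto D that kill X and Y give a map p
  \<otimes> q which fixes D \<otimes> D and annihilates both summands. This is the argument behind
  the directness of sums of simple subcoalgebras and behind the uniqueness of the simple
  subcoalgebra of R.\<close>

lemma tensor_disjoint:
  assumes s: "vector_space s" and D: "module.subspace s D"
    and X: "module.subspace s X" "D \<inter> X = {0}" and Y: "module.subspace s Y" "D \<inter> Y = {0}"
    and t: "t \<in> tspace s s D D" "t \<in> ssum (tspace s s X UNIV) (tspace s s UNIV Y)"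
  shows "t = 0"
proof -
  obtain p where p: "lin s s p" "range p \<subseteq> D" "\<And>x. x \<in> D \<Longrightarrow> p x = x" "\<And>x. x \<in> X \<Longrightarrow> p x = 0"
    using ex_projection[OF s D X] by metis
  obtain q where q: "lin s s q" "range q \<subseteq> D" "\<And>x. x \<in> D \<Longrightarrow> q x = x" "\<And>x. x \<in> Y \<Longrightarrow> q x = 0"
    using ex_projection[OF s D Y] by metis
  note b = bilin_tmap[OF p(1) q(1)] and c = bilin_tens[OF s s]
  let ?pq = "tsum s s (\<lambda>x y. tens s s (p x) (q y))"
  have z: "tens s s 0 y = 0" "tens s s x 0 = 0" for x y
    using c by (auto simp: bilin_def dest: lin_zero)
  have z0: "bilin s s tscale (\<lambda>x y. 0 :: ('b, 'b, 'a) tensor)"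
    using vector_space_tscale s by (intro bilinI linI) (auto simp: tscale_def fun_eq_iff zero_fun_apply)
  have z1: "tsum s s (\<lambda>x y. 0 :: ('b, 'b, 'a) tensor) u = 0" if "u \<in> tspace s s UNIV UNIV" for u
    using s s that by (induction rule: tspace_induct_UNIV) (simp_all add: tsum_simps[OF z0] tens_mem)
  obtain u v where uv: "t = u + v" "u \<in> tspace s s X UNIV" "v \<in> tspace s s UNIV Y"
    using t(2) by (auto simp: ssum_def)
  have "?pq u = tsum s s (\<lambda>x y. 0) u"
    by (rule tsum_cong_on[OF b z0 X(1) uv(2)]) (simp add: p(4) z)
  moreover have "?pq v = tsum s s (\<lambda>x y. 0) v"
    by (rule tsum_cong_on[OF b z0 subspace_univ[OF s] uv(3)]) (simp add: q(4) z)
  ultimately have "?pq t = 0"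
    using uv by (simp add: tsum_add[OF b] z1 tspace_UNIV)
  moreover have "?pq t = tsum s s (tens s s) t"
    by (rule tsum_cong_on[OF b c D t(1)]) (simp add: p(3) q(3))
  ultimately show ?thesis by (simp add: tsum_id[OF s s tspace_UNIV[OF t(1)]])
qed

section \<open>Expansion of tensors along a basis\<close>

lemma ex_coordinates:
  assumes s: "vector_space s"
  obtains B \<beta> where "\<And>b. b \<in> B \<Longrightarrow> lin s (*) (\<beta> b)" "\<And>x. finite {b \<in> B. \<beta> b x \<noteq> 0}"
    "\<And>x. x = (\<Sum>b\<in>{b \<in> B. \<beta> b x \<noteq> 0}. s (\<beta> b x) b)"
proof -
  interpret vector_space s by fact
  obtain B where B: "independent B" "UNIV \<subseteq> span B" by (rule basis_exists[of UNIV]) auto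
  have sB: "span B = UNIV" using B(2) by auto
  have nz: "{b \<in> B. representation B x b \<noteq> 0} = {b. representation B x b \<noteq> 0}" for x
    using representation_ne_zero by auto
  show ?thesis
  proof (rule that[of B "\<lambda>b x. representation B x b"])
    show "lin s (*) (\<lambda>x. representation B x b)" if "b \<in> B" for b
      using s vector_space_mult representation_add[OF B(1)] representation_scale[OF B(1)]
      by (intro linI) (auto simp: sB)
    show "finite {b \<in> B. representation B x b \<noteq> 0}" for x
      unfolding nz by (rule finite_representation)
    show "x = (\<Sum>b\<in>{b \<in> B. representation B x b \<noteq> 0}. s (representation B x b) b)" for x
      unfolding nz using sum_nonzero_representation_eq[OF B(1), of x] sB by simp
  qed
qed

lemma tensor_expand_left:
  assumes A: "vector_space sA" and B: "vector_space sB" and t: "t \<in> tspace sA sB UNIV UNIV"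
  obtains F \<beta> where "finite F" "\<And>b. b \<in> F \<Longrightarrow> lin sA (*) (\<beta> b)"
    "t = (\<Sum>b\<in>F. tens sA sB b (tsum sA sB (\<lambda>x y. sB (\<beta> b x) y) t))"
proof -
  interpret A: vector_space sA by fact
  interpret B: vector_space sB by fact
  obtain E \<beta> where E: "\<And>b. b \<in> E \<Longrightarrow> lin sA (*) (\<beta> b)" "\<And>x. finite {b \<in> E. \<beta> b x \<noteq> 0}"
    "\<And>x. x = (\<Sum>b\<in>{b \<in> E. \<beta> b x \<noteq> 0}. sA (\<beta> b x) b)" by (rule ex_coordinates[OF A]) blast
  note b = bilin_scale1[OF B E(1)] and c = bilin_tens[OF A B]
  have c1: "lin sA tscale (\<lambda>x. tens sA sB x y)" "lin sB tscale (\<lambda>y. tens sA sB x y)" for x y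
    using c by (auto simp: bilin_def)
  let ?P = "\<lambda>u F. u = (\<Sum>b\<in>F. tens sA sB b (tsum sA sB (\<lambda>x y. sB (\<beta> b x) y) u))"
  \<comment> \<open>The identity is claimed for all finite index sets beyond some \<open>F0\<close>:
    adding a pure tensor enlarges the support, and the induction hypothesis must then be available
    for the larger set.\<close>
  have "\<exists>F0. finite F0 \<and> F0 \<subseteq> E \<and> (\<forall>F. finite F \<longrightarrow> F0 \<subseteq> F \<longrightarrow> F \<subseteq> E \<longrightarrow> ?P t F)"
    using A B t
  proof (induction rule: tspace_induct_UNIV)
    case zero
    show ?case
    proof (intro exI[of _ "{}"] conjI allI impI)
      fix F assume "F \<subseteq> E"
      then show "0 = (\<Sum>b\<in>F. tens sA sB b (tsum sA sB (\<lambda>x y. sB (\<beta> b x) y) 0))"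
        by (intro sum.neutral[symmetric]) (use lin_zero[OF c1(2)] in \<open>auto simp: tsum_zero[OF b]\<close>)
    qed auto
  next
    case (add x y u)
    then obtain F0 where F0: "finite F0" "F0 \<subseteq> E" "\<And>F. finite F \<Longrightarrow> F0 \<subseteq> F \<Longrightarrow> F \<subseteq> E \<Longrightarrow> ?P u F" by blast
    show ?case
    proof (intro exI[of _ "F0 \<union> {b \<in> E. \<beta> b x \<noteq> 0}"] conjI allI impI)
      show "finite (F0 \<union> {b \<in> E. \<beta> b x \<noteq> 0})" using F0(1) E(2) by blast
      show "F0 \<union> {b \<in> E. \<beta> b x \<noteq> 0} \<subseteq> E" using F0(2) by auto
    next
      fix F assume F: "finite F" "F0 \<union> {b \<in> E. \<beta> b x \<noteq> 0} \<subseteq> F" "F \<subseteq> E"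
      have "x = (\<Sum>b\<in>{b \<in> E. \<beta> b x \<noteq> 0}. sA (\<beta> b x) b)" by (rule E(3))
      also have "\<dots> = (\<Sum>b\<in>F. sA (\<beta> b x) b)"
        by (rule sum.mono_neutral_left) (use F in auto)
      finally have "tens sA sB x y = (\<Sum>b\<in>F. tens sA sB (sA (\<beta> b x) b) y)"
        by (metis (no_types) lin_sum[OF c1(1)])
      also have "\<dots> = (\<Sum>b\<in>F. tens sA sB b (sB (\<beta> b x) y))"
        by (simp add: lin_scale[OF c1(1)] lin_scale[OF c1(2)])
      finally have "tens sA sB x y + u = (\<Sum>b\<in>F. tens sA sB b (sB (\<beta> b x) y)) +
          (\<Sum>b\<in>F. tens sA sB b (tsum sA sB (\<lambda>x y. sB (\<beta> b x) y) u))"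
        using F0(3)[of F] F by simp
      also have "\<dots> = (\<Sum>b\<in>F. tens sA sB b (tsum sA sB (\<lambda>x y. sB (\<beta> b x) y) (tens sA sB x y + u)))"
        unfolding sum.distrib[symmetric]
        by (rule sum.cong) (use F in \<open>auto simp: tsum_simps[OF b] tens_mem add.hyps lin_add[OF c1(2)]\<close>)
      finally show "?P (tens sA sB x y + u) F" .
    qed
  qed
  then obtain F where "finite F" "F \<subseteq> E" "?P t F" by blast
  with E(1) show ?thesis by (intro that[of F \<beta>]) auto
qed

definition tswap where
  "tswap sA sB t = tsum sA sB (\<lambda>x y. tens sB sA y x) t"

lemma bilin_swap: "bilin sA sB sU f \<Longrightarrow> bilin sB sA sU (\<lambda>x y. f y x)"
  by (simp add: bilin_def)

lemma tswap_mem: "vector_space sA \<Longrightarrow> vector_space sB \<Longrightarrow> t \<in> tspace sA sB UNIV UNIV \<Longrightarrow>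
    tswap sA sB t \<in> tspace sB sA UNIV UNIV"
  unfolding tswap_def by (rule tsum_in_tspace[OF bilin_swap[OF bilin_tens]]) (auto intro: tens_mem)

lemma tsum_tswap:
  assumes f: "bilin sB sA sU f" and t: "t \<in> tspace sA sB UNIV UNIV"
  shows "tsum sB sA f (tswap sA sB t) = tsum sA sB (\<lambda>x y. f y x) t"
  unfolding tswap_def
  by (subst tsum_tsum[OF f bilin_swap[OF bilin_tens] _ t])
    (auto simp: tsum_tens[OF f] intro: tens_mem bilin_vs[OF f])

lemma tensor_expand_right:
  assumes A: "vector_space sA" and B: "vector_space sB" and t: "t \<in> tspace sA sB UNIV UNIV"
  obtains F \<beta> where "finite F" "\<And>b. b \<in> F \<Longrightarrow> lin sB (*) (\<beta> b)"
    "t = (\<Sum>b\<in>F. tens sA sB (tsum sA sB (\<lambda>x y. sA (\<beta> b y) x) t) b)"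
proof -
  let ?u = "tswap sA sB t"
  have u: "?u \<in> tspace sB sA UNIV UNIV" by (rule tswap_mem[OF A B t])
  obtain F \<beta> where F: "finite F" "\<And>b. b \<in> F \<Longrightarrow> lin sB (*) (\<beta> b)"
    "?u = (\<Sum>b\<in>F. tens sB sA b (tsum sB sA (\<lambda>x y. sA (\<beta> b x) y) ?u))"
    by (rule tensor_expand_left[OF B A u]) blast
  have "t = tsum sA sB (tens sA sB) t" using tsum_id[OF A B t] by simp
  also have "\<dots> = tsum sB sA (\<lambda>x y. tens sA sB y x) ?u"
    by (rule tsum_tswap[OF bilin_swap[OF bilin_tens[OF A B]] t, symmetric])
  also have "\<dots> = tswap sB sA ?u" by (simp add: tswap_def)
  also have "\<dots> = (\<Sum>b\<in>F. tens sA sB (tsum sB sA (\<lambda>x y. sA (\<beta> b x) y) ?u) b)"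
  proof -
    let ?g = "\<lambda>b. tsum sB sA (\<lambda>x y. sA (\<beta> b x) y) ?u"
    have "tswap sB sA (\<Sum>b\<in>G. tens sB sA b (?g b)) = (\<Sum>b\<in>G. tens sA sB (?g b) b) \<and>
        (\<Sum>b\<in>G. tens sB sA b (?g b)) \<in> tspace sB sA UNIV UNIV" if "finite G" for G
      using that
      by (induction G) (auto simp: tswap_def tsum_simps[OF bilin_swap[OF bilin_tens[OF A B]]] tens_mem
          tspace_zero intro!: tspace_add tens_mem)
    from this[OF F(1)] show ?thesis using F(3) by simp
  qed
  also have "\<dots> = (\<Sum>b\<in>F. tens sA sB (tsum sA sB (\<lambda>x y. sA (\<beta> b y) x) t) b)"
    by (rule sum.cong) (auto simp: tsum_tswap[OF bilin_scale1[OF A F(2)] t])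
  finally show ?thesis using F by (intro that[of F \<beta>]) auto
qed

section \<open>Coalgebras\<close>

lemma tsum_eq_zero:
  assumes f: "bilin sA sB sU f" and X: "module.subspace sA X" and t: "t \<in> tspace sA sB X Y"
    and "\<And>x y. x \<in> X \<Longrightarrow> y \<in> Y \<Longrightarrow> f x y = 0"
  shows "tsum sA sB f t = 0"
proof -
  interpret U: vector_space sU using f by (rule bilin_vs)
  show ?thesis using tsum_mem[OF f X t U.subspace_single_0] assms(4) by auto
qed

lemma tsum_ssum_zero:
  assumes f: "bilin sA sB sU f" and X: "module.subspace sA X"
    and t: "t \<in> ssum (tspace sA sB X UNIV) (tspace sA sB UNIV Y)"
    and "\<And>x y. x \<in> X \<Longrightarrow> f x y = 0" "\<And>x y. y \<in> Y \<Longrightarrow> f x y = 0"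
  shows "tsum sA sB f t = 0"
proof -
  obtain u v where uv: "t = u + v" "u \<in> tspace sA sB X UNIV" "v \<in> tspace sA sB UNIV Y"
    using t by (auto simp: ssum_def)
  have "tsum sA sB f u = 0" by (rule tsum_eq_zero[OF f X uv(2)]) (rule assms)
  moreover have "tsum sA sB f v = 0"
    by (rule tsum_eq_zero[OF f subspace_univ uv(3)]) (use assms bilin_vs(1)[OF f] in auto)
  ultimately show ?thesis using uv by (simp add: tsum_add[OF f] tspace_UNIV)
qed

lemma ex_subspace_kernel:
  assumes s: "vector_space s" and X: "module.subspace s X"
  obtains q where "lin s s q" "\<And>x. q x = 0 \<longleftrightarrow> x \<in> X"
proof -
  interpret vector_space s by fact
  have "X \<inter> {0} = {0}" using subspace_0[OF X] by auto
  then obtain p where p: "lin s s p" "range p \<subseteq> X" "\<And>x. x \<in> X \<Longrightarrow> p x = x"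
    using ex_projection[OF s X subspace_single_0] by metis
  show ?thesis
  proof (rule that[of "\<lambda>x. x - p x"])
    show "lin s s (\<lambda>x. x - p x)" by (intro lin_sub lin_id s p(1))
    show "x - p x = 0 \<longleftrightarrow> x \<in> X" for x
    proof
      assume "x - p x = 0"
      then have "x = p x" by simp
      moreover have "p x \<in> X" using p(2) by blast
      ultimately show "x \<in> X" by simp
    qed (simp add: p(3))
  qed
qed

text \<open>In a basis expansion of \<open>t\<close> along the second factor, the coefficients are
  contractions of \<open>t\<close> with coordinate functionals. Membership in X \<otimes> B is
  thereby tested by functionals, which turns conditions on coactions into stability under an action
  of the dual.\<close>

lemma tspace_leftI:
  assumes "vector_space sA" "vector_space sB" "t \<in> tspace sA sB UNIV UNIV"
    and X: "\<And>\<beta>. lin sB (*) \<beta> \<Longrightarrow> tsum sA sB (\<lambda>x y. sA (\<beta> y) x) t \<in> X"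
  shows "t \<in> tspace sA sB X UNIV"
proof -
  obtain F \<beta> where F: "finite F" "\<And>b. b \<in> F \<Longrightarrow> lin sB (*) (\<beta> b)"
    and t: "t = (\<Sum>b\<in>F. tens sA sB (tsum sA sB (\<lambda>x y. sA (\<beta> b y) x) t) b)"
    by (rule tensor_expand_right[OF assms(1-3)]) blast
  have "(\<Sum>b\<in>G. tens sA sB (tsum sA sB (\<lambda>x y. sA (\<beta> b y) x) t) b) \<in> tspace sA sB X UNIV"
    if "G \<subseteq> F" for G
    using that by (induction G rule: infinite_finite_induct)
      (auto intro!: tspace_zero tspace_add tens_mem X F(2))
  from this[of F] show ?thesis using t by simp
qed

lemma tspace_rightI:
  assumes "vector_space sA" "vector_space sB" "t \<in> tspace sA sB UNIV UNIV"
    and Y: "\<And>\<beta>. lin sA (*) \<beta> \<Longrightarrow> tsum sA sB (\<lambda>x y. sB (\<beta> x) y) t \<in> Y"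
  shows "t \<in> tspace sA sB UNIV Y"
proof -
  obtain F \<beta> where F: "finite F" "\<And>b. b \<in> F \<Longrightarrow> lin sA (*) (\<beta> b)"
    and t: "t = (\<Sum>b\<in>F. tens sA sB b (tsum sA sB (\<lambda>x y. sB (\<beta> b x) y) t))"
    by (rule tensor_expand_left[OF assms(1-3)]) blast
  have "(\<Sum>b\<in>G. tens sA sB b (tsum sA sB (\<lambda>x y. sB (\<beta> b x) y) t)) \<in> tspace sA sB UNIV Y"
    if "G \<subseteq> F" for G
    using that by (induction G rule: infinite_finite_induct)
      (auto intro!: tspace_zero tspace_add tens_mem Y F(2))
  from this[of F] show ?thesis using t by simp
qed

lemma tspace_zero_left:
  assumes "vector_space sA" "vector_space sB" "t \<in> tspace sA sB {0} Y"
  shows "t = 0"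
proof -
  interpret A: vector_space sA by fact
  have "tens sA sB 0 y = 0" for y by (rule lin_zero[OF lin_tens1[OF lin_id]]) fact+
  then have "tsum sA sB (tens sA sB) t = 0"
    by (intro tsum_eq_zero[OF bilin_tens A.subspace_single_0 assms(3)] assms) auto
  then show ?thesis using tsum_id[OF assms(1,2) tspace_UNIV[OF assms(3)]] by simp
qed

lemma tspace_zero_right:
  assumes "vector_space sA" "vector_space sB" "t \<in> tspace sA sB UNIV {0}"
  shows "t = 0"
proof -
  have "tens sA sB x 0 = 0" for x by (rule lin_zero[OF lin_tens2[OF lin_id]]) fact+
  then have "tsum sA sB (tens sA sB) t = 0"
    by (intro tsum_eq_zero[OF bilin_tens subspace_univ assms(3)] assms) auto
  then show ?thesis using tsum_id[OF assms(1,2) tspace_UNIV[OF assms(3)]] by simp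
qed

lemma tensor_kernel_right:
  assumes f: "lin sB sB' f" and A: "vector_space sA" and t: "t \<in> tspace sA sB UNIV UNIV"
    and 0: "tsum sA sB (\<lambda>x y. tens sA sB' x (f y)) t = 0"
  shows "t \<in> tspace sA sB UNIV {x. f x = 0}"
proof -
  have "t \<in> ssum (tspace sA sB {0} UNIV) (tspace sA sB UNIV {x. f x = 0})"
    using tensor_kernel[OF lin_id[OF A] f t 0] by simp
  then obtain u v where "t = u + v" "u \<in> tspace sA sB {0} UNIV" "v \<in> tspace sA sB UNIV {x. f x = 0}"
    by (auto simp: ssum_def)
  moreover from this(2) have "u = 0" by (rule tspace_zero_left[OF A lin_vs1[OF f]])
  ultimately show ?thesis by simp
qed

text \<open>A map defined through \<open>tsum\<close> is linear only on genuine tensors; after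
  precomposition with this projection it is linear on the whole type, as \<open>lin\<close>
  demands.\<close>

lemma ex_tensor_projection:
  fixes sA :: "'k::field \<Rightarrow> 'a::ab_group_add \<Rightarrow> 'a" and sB :: "'k \<Rightarrow> 'b::ab_group_add \<Rightarrow> 'b"
  obtains q where "lin tscale tscale q" "\<And>t. q t \<in> tspace sA sB UNIV UNIV"
    "\<And>t. t \<in> tspace sA sB UNIV UNIV \<Longrightarrow> q t = t"
proof -
  interpret T: vector_space "tscale :: 'k \<Rightarrow> ('a, 'b, 'k) tensor \<Rightarrow> _" by (rule vector_space_tscale)
  have "tspace sA sB UNIV UNIV \<inter> {0} = {0}" by (auto intro: tspace_zero)
  then obtain q where "lin tscale tscale q" "range q \<subseteq> tspace sA sB UNIV UNIV"
    "\<And>t. t \<in> tspace sA sB UNIV UNIV \<Longrightarrow> q t = t"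
    using ex_projection[OF vector_space_tscale subspace_tspace T.subspace_single_0] by metis
  with that show ?thesis by blast
qed

lemmas lin_intros = lin_id lin_plus lin_sub lin_scaled lin_scalar lin_tens1 lin_tens2
  vector_space_tscale vector_space_mult

section \<open>Sweedler sums over the comultiplication and over a coaction\<close>

context coalgebra
begin

definition sw :: "('c \<Rightarrow> 'c \<Rightarrow> 'u::ab_group_add) \<Rightarrow> 'c \<Rightarrow> 'u"
  where "sw f c = tsum s s f (\<Delta> c)"

lemma lin_sw: "bilin s s sU f \<Longrightarrow> lin sV s g \<Longrightarrow> lin sV sU (\<lambda>x. sw f (g x))"
  unfolding sw_def by (rule lin_tsum[OF _ lin_comp[OF comult_linear]]) (auto intro: comult_mem)

lemma lin_sw_param:
  "(\<And>x. bilin s s sU (F x)) \<Longrightarrow> (\<And>a b. lin sV sU (\<lambda>x. F x a b)) \<Longrightarrow> lin sV sU (\<lambda>x. sw (F x) c)"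
  unfolding sw_def by (rule tsum_param) (auto intro: comult_mem)

lemmas swl = lin_sw lin_sw_param bilinI vector_space_axioms lin_comp[OF counit_linear]

lemma sw_comp: "bilin s s sU f \<Longrightarrow> lin sU sW h \<Longrightarrow> h (sw f c) = sw (\<lambda>x y. h (f x y)) c"
  unfolding sw_def by (rule tsum_comp) (auto intro: comult_mem)

lemma sw_tens: "sw (tens s s) c = \<Delta> c"
  unfolding sw_def by (rule tsum_id) (auto intro: comult_mem vector_space_axioms)

lemma sw_mem:
  "bilin s s sU f \<Longrightarrow> module.subspace s X \<Longrightarrow> \<Delta> c \<in> tspace s s X Y \<Longrightarrow> module.subspace sU Z \<Longrightarrow>
    (\<And>x y. x \<in> X \<Longrightarrow> y \<in> Y \<Longrightarrow> f x y \<in> Z) \<Longrightarrow> sw f c \<in> Z"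
  unfolding sw_def by (rule tsum_mem)

lemma sw_add: "bilin s s sU f \<Longrightarrow> sw f (c + d) = sw f c + sw f d"
  by (rule lin_add[OF lin_sw[OF _ lin_id]]) (auto intro: vector_space_axioms)

lemma sw_scale: "bilin s s sU f \<Longrightarrow> sw f (s a c) = sU a (sw f c)"
  by (rule lin_scale[OF lin_sw[OF _ lin_id]]) (auto intro: vector_space_axioms)

end

text \<open>Unlike in \<open>left_comodule\<close>, the coaction is linear and tensor-valued on the
  whole ambient space, while coassociativity and counit are asked on V only. Then \<open>cw\<close>
  is linear without side conditions; \<open>left_comodule_total\<close> provides such an extension
  for every comodule.\<close>

locale lcomod = C: coalgebra s \<Delta> \<epsilon> + V: vector_space sV
  for s :: "'k::field \<Rightarrow> 'c::ab_group_add \<Rightarrow> 'c" and \<Delta> \<epsilon>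
    and sV :: "'k \<Rightarrow> 'v::ab_group_add \<Rightarrow> 'v" +
  fixes V :: "'v set" and \<rho> :: "'v \<Rightarrow> ('c, 'v, 'k) tensor"
  assumes subspace_V: "V.subspace V"
    and coact_linear: "lin sV tscale \<rho>"
    and coact_UNIV: "\<rho> v \<in> tspace s sV UNIV UNIV"
    and coact_mem: "v \<in> V \<Longrightarrow> \<rho> v \<in> tspace s sV UNIV V"
    and coact_coassoc: "v \<in> V \<Longrightarrow>
      tsum s sV (\<lambda>h w. tsum s s (\<lambda>a b. tens tscale sV (tens s s a b) w) (\<Delta> h)) (\<rho> v) =
      tsum s sV (\<lambda>h w. tsum s sV (\<lambda>k u. tens tscale sV (tens s s h k) u) (\<rho> w)) (\<rho> v)"
    and coact_counit: "v \<in> V \<Longrightarrow> tsum s sV (\<lambda>h w. sV (\<epsilon> h) w) (\<rho> v) = v"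
begin

definition cw :: "('c \<Rightarrow> 'v \<Rightarrow> 'u::ab_group_add) \<Rightarrow> 'v \<Rightarrow> 'u"
  where "cw f v = tsum s sV f (\<rho> v)"

lemma lin_cw: "bilin s sV sU f \<Longrightarrow> lin sW sV g \<Longrightarrow> lin sW sU (\<lambda>x. cw f (g x))"
  unfolding cw_def by (rule lin_tsum[OF _ lin_comp[OF coact_linear]]) (auto intro: coact_UNIV)

lemma lin_cw_param:
  "(\<And>x. bilin s sV sU (F x)) \<Longrightarrow> (\<And>a b. lin sW sU (\<lambda>x. F x a b)) \<Longrightarrow> lin sW sU (\<lambda>x. cw (F x) c)"
  unfolding cw_def by (rule tsum_param) (auto intro: coact_UNIV)

lemmas cwl = lin_cw lin_cw_param V.vector_space_axioms

lemma cw_comp: "bilin s sV sU f \<Longrightarrow> lin sU sW h \<Longrightarrow> h (cw f c) = cw (\<lambda>x y. h (f x y)) c"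
  unfolding cw_def by (rule tsum_comp) (auto intro: coact_UNIV)

lemma cw_mem:
  "bilin s sV sU f \<Longrightarrow> C.subspace X \<Longrightarrow> \<rho> v \<in> tspace s sV X Y \<Longrightarrow> module.subspace sU Z \<Longrightarrow>
    (\<And>x y. x \<in> X \<Longrightarrow> y \<in> Y \<Longrightarrow> f x y \<in> Z) \<Longrightarrow> cw f v \<in> Z"
  unfolding cw_def by (rule tsum_mem)

text \<open>Coassociativity is an equation between triple tensors; applying to both sides the linear
  map induced by a trilinear \<open>F\<close> gives its Sweedler form.\<close>

lemma cw_coassoc:
  assumes v: "v \<in> V"
    and F: "\<And>a b. lin sV sU (F a b)" "\<And>a y. lin s sU (\<lambda>b. F a b y)" "\<And>b y. lin s sU (\<lambda>a. F a b y)"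
  shows "cw (\<lambda>h w. C.sw (\<lambda>a b. F a b w) h) v = cw (\<lambda>h w. cw (\<lambda>k u. F h k u) w) v"
proof -
  let ?T = "tens tscale sV"
  note vs = C.vector_space_axioms V.vector_space_axioms vector_space_tscale
  obtain q :: "('c, 'c, 'k) tensor \<Rightarrow> ('c, 'c, 'k) tensor" where q: "lin tscale tscale q" "\<And>t. q t \<in> tspace s s UNIV UNIV"
    "\<And>t. t \<in> tspace s s UNIV UNIV \<Longrightarrow> q t = t" by (rule ex_tensor_projection[of s s]) blast
  have bF: "bilin s s sU (\<lambda>a b. F a b y)" for y by (intro bilinI F)
  \<comment> \<open>\<open>G\<close> is \<open>F\<close> with its first two arguments merged into
    one tensor; \<open>q\<close> makes it linear also at functionals that are not tensors.\<close>
  define G where "G = (\<lambda>t y. tsum s s (\<lambda>a b. F a b y) (q t))"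
  have G: "bilin tscale sV sU G" unfolding G_def
    by (intro bilinI tsum_param[OF bF F(1) q(2)] lin_tsum[OF bF q(1,2)])
  have GF: "G (tens s s a b) y = F a b y" for a b y
    unfolding G_def by (simp add: q(3) tens_mem tsum_tens[OF bF])
  have b1: "bilin s s tscale (\<lambda>a b. ?T (tens s s a b) y)" for y
    by (intro bilinI lin_intros vs)
  have b2: "bilin s sV tscale (\<lambda>a b. ?T (tens s s x a) b)" for x
    by (intro bilinI lin_intros vs)
  have 1: "bilin s sV tscale (\<lambda>x y. C.sw (\<lambda>a b. ?T (tens s s a b) y) x)"
    by (intro lin_intros C.swl vs b1)
  have 2: "bilin s sV tscale (\<lambda>x y. cw (\<lambda>a b. ?T (tens s s x a) b) y)"
    by (intro bilinI lin_intros cwl vs b2)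
  have m1: "C.sw (\<lambda>a b. ?T (tens s s a b) y) x \<in> tspace tscale sV UNIV UNIV" for x y
    unfolding C.sw_def by (intro tsum_in_tspace[OF b1] C.comult_mem tens_mem) simp_all
  have m2: "cw (\<lambda>a b. ?T (tens s s x a) b) y \<in> tspace tscale sV UNIV UNIV" for x y
    unfolding cw_def by (intro tsum_in_tspace[OF b2] coact_UNIV tens_mem) simp_all
  have p1: "tsum tscale sV G (C.sw f c) = C.sw (\<lambda>x y. tsum tscale sV G (f x y)) c"
    if "bilin s s tscale f" "\<And>x y. f x y \<in> tspace tscale sV UNIV UNIV" for f and c :: 'c
    using that unfolding C.sw_def by (intro tsum_tsum[OF G] C.comult_mem)
  have p2: "tsum tscale sV G (cw f v) = cw (\<lambda>x y. tsum tscale sV G (f x y)) v"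
    if "bilin s sV tscale f" "\<And>x y. f x y \<in> tspace tscale sV UNIV UNIV" for f v
    using that unfolding cw_def by (intro tsum_tsum[OF G] coact_UNIV)
  have "cw (\<lambda>x y. C.sw (\<lambda>a b. ?T (tens s s a b) y) x) v = cw (\<lambda>x y. cw (\<lambda>a b. ?T (tens s s x a) b) y) v"
    unfolding C.sw_def cw_def by (rule coact_coassoc[OF v])
  then have "tsum tscale sV G (cw (\<lambda>x y. C.sw (\<lambda>a b. ?T (tens s s a b) y) x) v) =
    tsum tscale sV G (cw (\<lambda>x y. cw (\<lambda>a b. ?T (tens s s x a) b) y) v)" by simp
  then show ?thesis
    by (simp add: p2[OF 1 m1] p2[OF 2 m2] p1[OF b1] p2[OF b2] tens_mem
        tsum_tens[OF G] GF)
qed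

end

section \<open>Coassociativity and counit in Sweedler form\<close>

context coalgebra
begin

lemma lcomod_regular:
  assumes "subspace V" "\<And>v. v \<in> V \<Longrightarrow> \<Delta> v \<in> tspace s s UNIV V"
  shows "lcomod s \<Delta> \<epsilon> s V \<Delta>"
  by (intro lcomod.intro lcomod_axioms.intro coalgebra_axioms vector_space_axioms
      comult_linear comult_mem coassoc counit_left assms)

lemma sw_coassoc:
  assumes F: "\<And>a b. lin s sU (F a b)" "\<And>a y. lin s sU (\<lambda>b. F a b y)" "\<And>b y. lin s sU (\<lambda>a. F a b y)"
  shows "sw (\<lambda>x y. sw (\<lambda>a b. F a b y) x) c = sw (\<lambda>x y. sw (\<lambda>a b. F x a b) y) c"
proof -
  interpret A: lcomod s \<Delta> \<epsilon> s UNIV \<Delta> by (rule lcomod_regular) (auto intro: comult_mem)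
  show ?thesis using A.cw_coassoc[OF UNIV_I F] unfolding A.cw_def sw_def .
qed

lemma sw_counit_left:
  assumes f: "lin s sU f"
  shows "sw (\<lambda>x y. sU (\<epsilon> x) (f y)) c = f c"
proof -
  have "f (sw (\<lambda>x y. s (\<epsilon> x) y) c) = sw (\<lambda>x y. f (s (\<epsilon> x) y)) c"
    by (rule sw_comp[OF bilin_scale1[OF vector_space_axioms counit_linear] f])
  then show ?thesis using counit_left by (simp add: lin_scale[OF f] sw_def)
qed

lemma sw_counit_right:
  assumes f: "lin s sU f"
  shows "sw (\<lambda>x y. sU (\<epsilon> y) (f x)) c = f c"
proof -
  have "f (sw (\<lambda>x y. s (\<epsilon> y) x) c) = sw (\<lambda>x y. f (s (\<epsilon> y) x)) c"
    by (rule sw_comp[OF bilin_scale2[OF vector_space_axioms counit_linear] f])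
  then show ?thesis using counit_right by (simp add: lin_scale[OF f] sw_def)
qed

lemma comult_eq_zero: "\<Delta> c = 0 \<Longrightarrow> c = 0"
  using sw_counit_left[OF lin_id[OF vector_space_axioms], of c]
    tsum_zero[OF bilin_scale1[OF vector_space_axioms counit_linear]]
  by (simp add: sw_def)

section \<open>Subcoalgebras, their sums and intersections\<close>

lemma subcoalgebraI:
  assumes "subspace D" "\<And>d. d \<in> D \<Longrightarrow> \<Delta> d \<in> tspace s s D UNIV" "\<And>d. d \<in> D \<Longrightarrow> \<Delta> d \<in> tspace s s UNIV D"
  shows "subcoalgebra s \<Delta> D"
  unfolding subcoalgebra_def
  using assms tspace_Int[OF vector_space_axioms vector_space_axioms assms(1) assms(1)] by auto

lemma subcoalgebraD:
  assumes "subcoalgebra s \<Delta> D"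
  shows "subspace D" "d \<in> D \<Longrightarrow> \<Delta> d \<in> tspace s s D D"
    "d \<in> D \<Longrightarrow> \<Delta> d \<in> tspace s s D UNIV" "d \<in> D \<Longrightarrow> \<Delta> d \<in> tspace s s UNIV D"
proof -
  show "subspace D" using assms by (simp add: subcoalgebra_def)
  show *: "\<Delta> d \<in> tspace s s D D" if "d \<in> D" for d
    using assms that by (auto simp: subcoalgebra_def)
  show "d \<in> D \<Longrightarrow> \<Delta> d \<in> tspace s s D UNIV" "d \<in> D \<Longrightarrow> \<Delta> d \<in> tspace s s UNIV D"
    using * tspace_mono[of D D D UNIV s s] tspace_mono[of D UNIV D D s s] by auto
qed

lemma subcoalgebra_span:
  assumes "\<And>D. D \<in> \<D> \<Longrightarrow> subcoalgebra s \<Delta> D"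
  shows "subcoalgebra s \<Delta> (span (\<Union>\<D>))"
proof -
  let ?Z = "span (\<Union>\<D>)"
  have "span (\<Union>\<D>) \<subseteq> {c. \<Delta> c \<in> tspace s s ?Z ?Z}"
  proof (rule span_minimal)
    show "subspace {c. \<Delta> c \<in> tspace s s ?Z ?Z}"
      by (rule subspace_vimage[OF comult_linear subspace_tspace])
    show "\<Union>\<D> \<subseteq> {c. \<Delta> c \<in> tspace s s ?Z ?Z}"
    proof clarify
      fix d D assume D: "D \<in> \<D>" "d \<in> D"
      then have "\<Delta> d \<in> tspace s s D D" using assms subcoalgebraD(2) by blast
      moreover have "D \<subseteq> ?Z" using D span_superset by blast
      ultimately show "\<Delta> d \<in> tspace s s ?Z ?Z" using tspace_mono by blast
    qed
  qed
  then show ?thesis by (auto simp: subcoalgebra_def)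
qed

lemma subcoalgebra_coradical: "subcoalgebra s \<Delta> (coradical s \<Delta> A)"
  unfolding coradical_def
  by (rule subcoalgebra_span) (auto simp: simple_subcoalgebra_def)

text \<open>Contracting one leg of \<Delta> d with a functional gives an element of D and of E
  alike, so by the test with functionals each leg lies in the intersection.\<close>

lemma subcoalgebra_Int:
  assumes "subcoalgebra s \<Delta> D" "subcoalgebra s \<Delta> E"
  shows "subcoalgebra s \<Delta> (D \<inter> E)"
proof (rule subcoalgebraI)
  note D = subcoalgebraD[OF assms(1)] and E = subcoalgebraD[OF assms(2)]
  note vs = vector_space_axioms vector_space_axioms
  show "subspace (D \<inter> E)" using D E by (simp add: subspace_inter)
  fix d assume d: "d \<in> D \<inter> E"
  have 1: "sw (\<lambda>x y. s (\<beta> y) x) d \<in> X" if "lin s (*) \<beta>" "subspace X" "\<Delta> d \<in> tspace s s X UNIV" for \<beta> X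
    by (rule sw_mem[OF bilin_scale2[OF vs(1) that(1)] that(2,3,2)]) (use that in \<open>auto intro: subspace_scale\<close>)
  show "\<Delta> d \<in> tspace s s (D \<inter> E) UNIV"
    by (rule tspace_leftI[OF vs comult_mem])
      (use d 1[OF _ D(1) D(3), unfolded sw_def] 1[OF _ E(1) E(3), unfolded sw_def] in blast)
  have 2: "sw (\<lambda>x y. s (\<beta> x) y) d \<in> X" if "lin s (*) \<beta>" "subspace X" "\<Delta> d \<in> tspace s s UNIV X" for \<beta> X
    by (rule sw_mem[OF bilin_scale1[OF vs(1) that(1)] subspace_UNIV that(3,2)]) (use that in \<open>auto intro: subspace_scale\<close>)
  show "\<Delta> d \<in> tspace s s UNIV (D \<inter> E)"
    by (rule tspace_rightI[OF vs comult_mem])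
      (use d 2[OF _ D(1) D(4), unfolded sw_def] 2[OF _ E(1) E(4), unfolded sw_def] in blast)
qed

section \<open>Wedges: description as kernels, associativity, coideals\<close>

lemma wedge_kernel:
  assumes X: "subspace X" and p: "lin s s p" "\<And>x. p x = 0 \<longleftrightarrow> x \<in> X"
    and q: "lin s s q" "\<And>x. q x = 0 \<longleftrightarrow> x \<in> Y"
  shows "wedge s \<Delta> UNIV X Y = {c. sw (\<lambda>x y. tens s s (p x) (q y)) c = 0}"
proof -
  note b = bilin_tmap[OF p(1) q(1)]
  have z: "tens s s 0 y = 0" "tens s s x 0 = 0" for x y
    using bilin_tens[OF vector_space_axioms vector_space_axioms] by (auto simp: bilin_def dest: lin_zero)
  have "sw (\<lambda>x y. tens s s (p x) (q y)) c = 0" if "c \<in> wedge s \<Delta> UNIV X Y" for c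
    unfolding sw_def
    by (rule tsum_ssum_zero[OF b X, of _ Y]) (use that in \<open>auto simp: z p(2)[THEN iffD2] q(2)[THEN iffD2] wedge_def\<close>)
  moreover have "c \<in> wedge s \<Delta> UNIV X Y" if "sw (\<lambda>x y. tens s s (p x) (q y)) c = 0" for c
    using tensor_kernel[OF p(1) q(1) comult_mem] that unfolding sw_def wedge_def p(2) q(2) by auto
  ultimately show ?thesis by blast
qed

lemma subspace_wedge:
  assumes X: "subspace X" and Y: "subspace Y"
  shows "subspace (wedge s \<Delta> UNIV X Y)"
proof -
  have "wedge s \<Delta> UNIV X Y = {c. \<Delta> c \<in> ssum (tspace s s X UNIV) (tspace s s UNIV Y)}"
    by (simp add: wedge_def)
  then show ?thesis
    by (simp add: subspace_vimage[OF comult_linear] subspace_ssum vector_space_tscale subspace_tspace)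
qed

lemma wedge_mono: "X \<subseteq> X' \<Longrightarrow> Y \<subseteq> Y' \<Longrightarrow> wedge s \<Delta> UNIV X Y \<subseteq> wedge s \<Delta> UNIV X' Y'"
  unfolding wedge_def
  using ssum_mono[OF tspace_mono[of X X' UNIV UNIV s s] tspace_mono[of UNIV UNIV Y Y' s s]] by blast

text \<open>Choose maps \<open>p\<close>, \<open>q\<close>, \<open>r\<close> with kernels X, Y, Z.
  The left side is killed by p \<otimes> q \<otimes> r after twofold comultiplication. Bracketing
  this as (T \<otimes> r) \<Delta>, where T has kernel X \<and> Y, and applying the description of
  the kernel of a tensor product of maps gives the right side.\<close>

lemma wedge_assoc_subset:
  assumes X: "subspace X" and Y: "subspace Y" and Z: "subspace Z"
  shows "wedge s \<Delta> UNIV X (wedge s \<Delta> UNIV Y Z) \<subseteq> wedge s \<Delta> UNIV (wedge s \<Delta> UNIV X Y) Z"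
proof
  fix c assume c: "c \<in> wedge s \<Delta> UNIV X (wedge s \<Delta> UNIV Y Z)"
  note vs = vector_space_axioms
  obtain p where p: "lin s s p" "\<And>x. p x = 0 \<longleftrightarrow> x \<in> X" by (rule ex_subspace_kernel[OF vs X]) blast
  obtain q where q: "lin s s q" "\<And>x. q x = 0 \<longleftrightarrow> x \<in> Y" by (rule ex_subspace_kernel[OF vs Y]) blast
  obtain r where r: "lin s s r" "\<And>x. r x = 0 \<longleftrightarrow> x \<in> Z" by (rule ex_subspace_kernel[OF vs Z]) blast
  define T where "T = sw (\<lambda>x y. tens s s (p x) (q y))"
  note b = bilin_tmap[OF p(1) q(1)]
  have T: "lin s tscale T" unfolding T_def using lin_sw[OF b lin_id] vs by simp
  have W: "wedge s \<Delta> UNIV X Y = {c. T c = 0}" unfolding T_def by (rule wedge_kernel[OF X p q])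
  have z: "tens s s 0 y = 0" "tens s s x 0 = 0" "tens tscale s (0 :: ('c,'c,'k) tensor) y = 0"
    "tens tscale s v 0 = 0" for x y and v :: "('c, 'c, 'k) tensor"
    using lin_zero[OF lin_tens1[OF lin_id]] lin_zero[OF lin_tens2[OF lin_id]] vs vector_space_tscale by blast+
  note li = lin_intros swl vs lin_comp[OF p(1)] lin_comp[OF q(1)] lin_comp[OF r(1)]
  have h: "bilin s s tscale (\<lambda>x y. sw (\<lambda>a b. tens tscale s (tens s s (p x) (q a)) (r b)) y)"
    by (intro li)
  have "sw (\<lambda>x y. tens tscale s (T x) (r y)) c =
      sw (\<lambda>x y. sw (\<lambda>a b. tens tscale s (tens s s (p a) (q b)) (r y)) x) c"
    unfolding T_def by (subst sw_comp[OF b lin_tens1[OF lin_id[OF vector_space_tscale] vs]]) simp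
  also have "\<dots> = sw (\<lambda>x y. sw (\<lambda>a b. tens tscale s (tens s s (p x) (q a)) (r b)) y) c"
    by (rule sw_coassoc[where sU=tscale]) (intro li)+
  also have "\<dots> = 0"
    unfolding sw_def
  proof (rule tsum_ssum_zero[OF h[unfolded sw_def] X, of _ "wedge s \<Delta> UNIV Y Z"])
    show "\<Delta> c \<in> ssum (tspace s s X UNIV) (tspace s s UNIV (wedge s \<Delta> UNIV Y Z))"
      using c by (simp add: wedge_def)
    show "tsum s s (\<lambda>a b. tens tscale s (tens s s (p x) (q a)) (r b)) (\<Delta> y) = 0" if "x \<in> X" for x y
      by (rule tsum_eq_zero[where sU=tscale, OF _ subspace_UNIV comult_mem], intro li)
        (use that in \<open>auto simp: z p(2)[THEN iffD2]\<close>)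
    show "tsum s s (\<lambda>a b. tens tscale s (tens s s (p x) (q a)) (r b)) (\<Delta> y) = 0"
      if "y \<in> wedge s \<Delta> UNIV Y Z" for x y
      by (rule tsum_ssum_zero[where sU=tscale and Y=Z, OF _ Y], intro li)
        (use that in \<open>auto simp: z q(2)[THEN iffD2] r(2)[THEN iffD2] wedge_def\<close>)
  qed
  finally show "c \<in> wedge s \<Delta> UNIV (wedge s \<Delta> UNIV X Y) Z"
    using tensor_kernel[OF T r(1) comult_mem] by (simp add: sw_def wedge_def[of _ _ _ _ Z] W r(2))
qed

lemma wedge_assoc_superset:
  assumes X: "subspace X" and Y: "subspace Y" and Z: "subspace Z"
  shows "wedge s \<Delta> UNIV (wedge s \<Delta> UNIV X Y) Z \<subseteq> wedge s \<Delta> UNIV X (wedge s \<Delta> UNIV Y Z)"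
proof
  fix c assume c: "c \<in> wedge s \<Delta> UNIV (wedge s \<Delta> UNIV X Y) Z"
  note vs = vector_space_axioms
  obtain p where p: "lin s s p" "\<And>x. p x = 0 \<longleftrightarrow> x \<in> X" by (rule ex_subspace_kernel[OF vs X]) blast
  obtain q where q: "lin s s q" "\<And>x. q x = 0 \<longleftrightarrow> x \<in> Y" by (rule ex_subspace_kernel[OF vs Y]) blast
  obtain r where r: "lin s s r" "\<And>x. r x = 0 \<longleftrightarrow> x \<in> Z" by (rule ex_subspace_kernel[OF vs Z]) blast
  define T where "T = sw (\<lambda>x y. tens s s (q x) (r y))"
  note b = bilin_tmap[OF q(1) r(1)]
  have T: "lin s tscale T" unfolding T_def using lin_sw[OF b lin_id] vs by simp
  have W: "wedge s \<Delta> UNIV Y Z = {c. T c = 0}" unfolding T_def by (rule wedge_kernel[OF Y q r])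
  have z: "tens s s 0 y = 0" "tens s s x 0 = 0" "tens s tscale 0 (v :: ('c,'c,'k) tensor) = 0"
    "tens s tscale x (0 :: ('c, 'c, 'k) tensor) = 0" for x y v
    using lin_zero[OF lin_tens1[OF lin_id]] lin_zero[OF lin_tens2[OF lin_id]] vs vector_space_tscale by blast+
  note li = lin_intros swl vs lin_comp[OF p(1)] lin_comp[OF q(1)] lin_comp[OF r(1)]
  have h: "bilin s s tscale (\<lambda>x y. sw (\<lambda>a b. tens s tscale (p a) (tens s s (q b) (r y))) x)"
    by (intro li)
  have "sw (\<lambda>x y. tens s tscale (p x) (T y)) c =
      sw (\<lambda>x y. sw (\<lambda>a b. tens s tscale (p x) (tens s s (q a) (r b))) y) c"
    unfolding T_def by (subst sw_comp[OF b lin_tens2[OF lin_id[OF vector_space_tscale] vs]]) simp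
  also have "\<dots> = sw (\<lambda>x y. sw (\<lambda>a b. tens s tscale (p a) (tens s s (q b) (r y))) x) c"
    by (rule sw_coassoc[where sU=tscale, symmetric]) (intro li)+
  also have "\<dots> = 0"
    unfolding sw_def
  proof (rule tsum_ssum_zero[OF h[unfolded sw_def] subspace_wedge[OF X Y], of _ Z])
    show "\<Delta> c \<in> ssum (tspace s s (wedge s \<Delta> UNIV X Y) UNIV) (tspace s s UNIV Z)"
      using c by (simp add: wedge_def[of _ _ _ "wedge s \<Delta> UNIV X Y"])
    show "tsum s s (\<lambda>a b. tens s tscale (p a) (tens s s (q b) (r y))) (\<Delta> x) = 0"
      if "x \<in> wedge s \<Delta> UNIV X Y" for x y
      by (rule tsum_ssum_zero[where sU=tscale and Y=Y, OF _ X], intro li)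
        (use that in \<open>auto simp: z p(2)[THEN iffD2] q(2)[THEN iffD2] wedge_def\<close>)
    show "tsum s s (\<lambda>a b. tens s tscale (p a) (tens s s (q b) (r y))) (\<Delta> x) = 0" if "y \<in> Z" for x y
      by (rule tsum_eq_zero[where sU=tscale, OF _ subspace_UNIV comult_mem], intro li)
        (use that in \<open>auto simp: z r(2)[THEN iffD2]\<close>)
  qed
  finally show "c \<in> wedge s \<Delta> UNIV X (wedge s \<Delta> UNIV Y Z)"
    using tensor_kernel[OF p(1) T comult_mem] by (simp add: sw_def wedge_def[of _ _ _ X] W p(2))
qed

lemma left_coideal_subset_wedge:
  assumes "\<And>y. y \<in> Y \<Longrightarrow> \<Delta> y \<in> tspace s s UNIV Y"
  shows "Y \<subseteq> wedge s \<Delta> UNIV X Y"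
  using assms ssum_right[OF tspace_zero] unfolding wedge_def by blast

lemma right_coideal_subset_wedge:
  assumes "\<And>y. y \<in> X \<Longrightarrow> \<Delta> y \<in> tspace s s X UNIV"
  shows "X \<subseteq> wedge s \<Delta> UNIV X Y"
  using assms ssum_left[OF tspace_zero] unfolding wedge_def by blast

text \<open>A right coideal Y satisfies Y \<subseteq> Y \<and> 0, hence X \<and> Y \<subseteq> X
  \<and> (Y \<and> 0) \<subseteq> (X \<and> Y) \<and> 0, and membership in the last wedge says that
  the left leg of the comultiplication stays in X \<and> Y.\<close>

lemma wedge_right_coideal:
  assumes X: "subspace X" and Y: "subspace Y" "\<And>y. y \<in> Y \<Longrightarrow> \<Delta> y \<in> tspace s s Y UNIV"
    and c: "c \<in> wedge s \<Delta> UNIV X Y"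
  shows "\<Delta> c \<in> tspace s s (wedge s \<Delta> UNIV X Y) UNIV"
proof -
  have "Y \<subseteq> wedge s \<Delta> UNIV Y {0}" by (rule right_coideal_subset_wedge) (rule Y(2))
  then have "c \<in> wedge s \<Delta> UNIV (wedge s \<Delta> UNIV X Y) {0}"
    using c wedge_mono[OF order_refl] wedge_assoc_subset[OF X Y(1) subspace_single_0] by blast
  then obtain u v where "\<Delta> c = u + v" "u \<in> tspace s s (wedge s \<Delta> UNIV X Y) UNIV" "v \<in> tspace s s UNIV {0}"
    by (auto simp: wedge_def[of _ _ _ _ "{0}"] ssum_def)
  moreover from this(3) have "v = 0" by (rule tspace_zero_right[OF vector_space_axioms vector_space_axioms])
  ultimately show ?thesis by simp
qed

lemma wedge_left_coideal:
  assumes X: "subspace X" "\<And>x. x \<in> X \<Longrightarrow> \<Delta> x \<in> tspace s s UNIV X" and Y: "subspace Y"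
    and c: "c \<in> wedge s \<Delta> UNIV X Y"
  shows "\<Delta> c \<in> tspace s s UNIV (wedge s \<Delta> UNIV X Y)"
proof -
  have "X \<subseteq> wedge s \<Delta> UNIV {0} X" by (rule left_coideal_subset_wedge) (rule X(2))
  then have "c \<in> wedge s \<Delta> UNIV {0} (wedge s \<Delta> UNIV X Y)"
    using c wedge_mono[OF _ order_refl] wedge_assoc_superset[OF subspace_single_0 X(1) Y] by blast
  then obtain u v where "\<Delta> c = u + v" "u \<in> tspace s s {0} UNIV" "v \<in> tspace s s UNIV (wedge s \<Delta> UNIV X Y)"
    by (auto simp: wedge_def[of _ _ _ "{0}"] ssum_def)
  moreover from this(2) have "u = 0" by (rule tspace_zero_left[OF vector_space_axioms vector_space_axioms])
  ultimately show ?thesis by simp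
qed

lemma subcoalgebra_wedge:
  assumes "subcoalgebra s \<Delta> X" "subcoalgebra s \<Delta> Y"
  shows "subcoalgebra s \<Delta> (wedge s \<Delta> UNIV X Y)"
  by (rule subcoalgebraI)
    (use subcoalgebraD[OF assms(1)] subcoalgebraD[OF assms(2)] in
      \<open>auto intro: subspace_wedge wedge_right_coideal wedge_left_coideal\<close>)

section \<open>The coradical filtration as a chain of subcoalgebras\<close>

lemma subcoalgebra_corad_filt: "subcoalgebra s \<Delta> (corad_filt s \<Delta> UNIV n)"
  by (induction n) (simp_all add: subcoalgebra_coradical subcoalgebra_wedge)

lemmas subspace_corad_filt = subcoalgebraD(1)[OF subcoalgebra_corad_filt]

lemma corad_filt_Suc: "corad_filt s \<Delta> UNIV n \<subseteq> corad_filt s \<Delta> UNIV (Suc n)"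
  using left_coideal_subset_wedge[of "corad_filt s \<Delta> UNIV n" "coradical s \<Delta> UNIV"]
    subcoalgebraD(4)[OF subcoalgebra_corad_filt] by simp

lemma corad_filt_mono: "m \<le> n \<Longrightarrow> corad_filt s \<Delta> UNIV m \<subseteq> corad_filt s \<Delta> UNIV n"
  by (rule lift_Suc_mono_le[where f="corad_filt s \<Delta> UNIV"]) (rule corad_filt_Suc)

text \<open>The recursion puts the coradical on the left of the wedge; associativity lets it migrate
  to the right. Each of the two forms confines one leg of the comultiplication.\<close>

lemma corad_filt_wedge_right:
  "corad_filt s \<Delta> UNIV (Suc n) \<subseteq> wedge s \<Delta> UNIV (corad_filt s \<Delta> UNIV n) (coradical s \<Delta> UNIV)"
proof (induction n)
  case (Suc n)
  let ?C = "corad_filt s \<Delta> UNIV" and ?w = "wedge s \<Delta> UNIV"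
  have "?C (Suc (Suc n)) \<subseteq> ?w (?C 0) (?w (?C n) (?C 0))"
    using wedge_mono[OF _ Suc, of "?C 0" "?C 0"] by simp
  also have "\<dots> \<subseteq> ?w (?w (?C 0) (?C n)) (?C 0)"
    by (intro wedge_assoc_subset subspace_corad_filt)
  finally show ?case by simp
qed simp

end

section \<open>Comodules and coefficient coalgebras\<close>

lemma ex_functional:
  assumes s: "vector_space s" and E: "module.subspace s E" and x: "x \<notin> E"
  obtains a where "lin s (*) a" "\<And>y. y \<in> E \<Longrightarrow> a y = 0" "a x \<noteq> 0"
proof -
  obtain q where q: "lin s s q" "\<And>x. q x = 0 \<longleftrightarrow> x \<in> E" by (rule ex_subspace_kernel[OF s E]) blast
  obtain B \<beta> where B: "\<And>b. b \<in> B \<Longrightarrow> lin s (*) (\<beta> b)"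
    "\<And>x. x = (\<Sum>b\<in>{b \<in> B. \<beta> b x \<noteq> 0}. s (\<beta> b x) b)" by (rule ex_coordinates[OF s]) blast
  have "q x \<noteq> 0" using q x by simp
  then have "{b \<in> B. \<beta> b (q x) \<noteq> 0} \<noteq> {}" using B(2)[of "q x"] by (metis sum.empty)
  then obtain b where "b \<in> B" "\<beta> b (q x) \<noteq> 0" by blast
  then show ?thesis
    by (intro that[of "\<lambda>y. \<beta> b (q y)"] lin_comp[OF B(1) q(1)]) (auto simp: q(2)[THEN iffD2] lin_zero[OF B(1)])
qed

context lcomod
begin

text \<open>The matrix coefficients of the comodule: \<open>f\<close> contracts the second leg of
  the coaction. The companion \<open>dact\<close> contracts the first leg and is the action of the
  dual algebra on V.\<close>

definition coef where "coef f v = cw (\<lambda>h w. s (f w) h) v"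

definition dact where "dact a v = cw (\<lambda>h w. sV (a h) w) v"

lemma bilin_coef: "lin sV (*) f \<Longrightarrow> bilin s sV s (\<lambda>h w. s (f w) h)"
  by (rule bilin_scale2[OF C.vector_space_axioms])

lemma bilin_dact: "lin s (*) a \<Longrightarrow> bilin s sV sV (\<lambda>h w. sV (a h) w)"
  by (rule bilin_scale1[OF V.vector_space_axioms])

lemma lin_coef: "lin sV (*) f \<Longrightarrow> lin sW sV g \<Longrightarrow> lin sW s (\<lambda>x. coef f (g x))"
  unfolding coef_def by (rule lin_cw[OF bilin_coef])

lemma lin_dact: "lin s (*) a \<Longrightarrow> lin sW sV g \<Longrightarrow> lin sW sV (\<lambda>x. dact a (g x))"
  unfolding dact_def by (rule lin_cw[OF bilin_dact])

lemma dact_mem: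
  assumes a: "lin s (*) a" and W: "V.subspace W" and v: "\<rho> v \<in> tspace s sV UNIV W"
  shows "dact a v \<in> W"
  unfolding dact_def
  by (rule cw_mem[OF bilin_dact[OF a] C.subspace_UNIV v W]) (use W in \<open>auto intro: V.subspace_scale\<close>)

text \<open>Together with \<open>dact_mem\<close> this identifies subcomodules with subspaces stable
  under all functionals, the form in which subcomodules are produced later.\<close>

lemma dact_stable_coact:
  assumes "\<And>a. lin s (*) a \<Longrightarrow> dact a v \<in> W"
  shows "\<rho> v \<in> tspace s sV UNIV W"
  by (rule tspace_rightI[OF C.vector_space_axioms V.vector_space_axioms coact_UNIV])
    (use assms in \<open>auto simp: dact_def cw_def\<close>)

text \<open>Coassociativity makes \<open>dact\<close> an action of the convolution algebra of
  functionals. On a left comodule it is a right action, so the functional applied first stands on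
  the left of the product.\<close>

lemma dact_conv:
  assumes a: "lin s (*) a" and b: "lin s (*) b" and v: "v \<in> V"
  shows "dact b (dact a v) = dact (\<lambda>h. C.sw (\<lambda>x y. a x * b y) h) v"
proof -
  note li = lin_intros C.swl cwl lin_comp[OF a] lin_comp[OF b] lin_dact[OF b] bilinI
  have ab: "bilin s s (*) (\<lambda>x y. a x * b y)"
    by (intro bilinI lin_intros lin_comp[OF a] lin_comp[OF b] C.vector_space_axioms)
  have "dact b (dact a v) = cw (\<lambda>h w. dact b (sV (a h) w)) v"
    unfolding dact_def[of a] by (rule cw_comp[OF bilin_dact[OF a] lin_dact[OF b lin_id]]) (intro li)
  also have "\<dots> = cw (\<lambda>h w. sV (a h) (dact b w)) v"
    by (simp add: lin_scale[OF lin_dact[OF b lin_id[OF V.vector_space_axioms]]])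
  also have "\<dots> = cw (\<lambda>h w. cw (\<lambda>k u. sV (a h) (sV (b k) u)) w) v"
    unfolding dact_def
    by (subst cw_comp[OF bilin_dact[OF b] lin_scaled[OF lin_id[OF V.vector_space_axioms]]]) simp
  also have "\<dots> = cw (\<lambda>h w. C.sw (\<lambda>x y. sV (a x) (sV (b y) w)) h) v"
    by (rule cw_coassoc[OF v, where sU = sV, symmetric]) (intro li)+
  also have "\<dots> = cw (\<lambda>h w. C.sw (\<lambda>x y. sV (a x * b y) w) h) v"
    by simp
  also have "\<dots> = cw (\<lambda>h w. sV (C.sw (\<lambda>x y. a x * b y) h) w) v"
    by (subst C.sw_comp[OF ab lin_scalar[OF lin_id[OF vector_space_mult] V.vector_space_axioms]]) simp
  finally show ?thesis by (simp add: dact_def)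
qed

lemma dact_counit: "v \<in> V \<Longrightarrow> dact \<epsilon> v = v"
  unfolding dact_def cw_def by (rule coact_counit)

lemma dact_add:
  assumes "lin s (*) b" "lin s (*) c"
  shows "dact (\<lambda>x. b x + c x) w = dact b w + dact c w"
  using tsum_plus[OF bilin_dact[OF assms(1)] bilin_dact[OF assms(2)] coact_UNIV]
  by (simp add: dact_def cw_def V.scale_left_distrib)

lemma dact_sub:
  assumes "lin s (*) b" "lin s (*) c"
  shows "dact (\<lambda>x. b x - c x) w = dact b w - dact c w"
  using tsum_sub[OF bilin_dact[OF assms(1)] bilin_dact[OF assms(2)] coact_UNIV]
  by (simp add: dact_def cw_def V.scale_left_diff_distrib)

lemma dact_scale:
  assumes "lin s (*) b"
  shows "dact (\<lambda>x. k * b x) w = sV k (dact b w)"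
  using cw_comp[OF bilin_dact[OF assms] lin_scaled[OF lin_id[OF V.vector_space_axioms]]]
  by (simp add: dact_def)

lemma subspace_dact:
  assumes "\<And>b c. b \<in> I \<Longrightarrow> c \<in> I \<Longrightarrow> (\<lambda>x. b x + c x) \<in> I" "\<And>k b. b \<in> I \<Longrightarrow> (\<lambda>x. k * b x) \<in> I"
    "(\<lambda>x. 0) \<in> I" "\<And>b. b \<in> I \<Longrightarrow> lin s (*) b"
  shows "V.subspace ((\<lambda>b. dact b v) ` I)"
proof -
  have "dact (\<lambda>x. 0) v = 0"
    using dact_sub[OF assms(4)[OF assms(3)] assms(4)[OF assms(3)]] by simp
  moreover have "dact b v + dact c v = dact (\<lambda>x. b x + c x) v" if "b \<in> I" "c \<in> I" for b c
    using that by (simp add: dact_add assms(4))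
  moreover have "sV k (dact b v) = dact (\<lambda>x. k * b x) v" if "b \<in> I" for b k
    using that by (simp add: dact_scale assms(4))
  ultimately show ?thesis using assms(1-3)
    by (auto simp: V.subspace_def image_iff intro: bexI[of _ "\<lambda>x. 0"])
qed

lemma lin_const_zero: "lin s (*) (\<lambda>x. 0)"
  using C.vector_space_axioms vector_space_mult by (auto intro!: linI)

text \<open>The orbit of \<open>v\<close> under all functionals is stable by
  \<open>dact_conv\<close> and contains \<open>v\<close> because the counit acts as the identity. It
  is finite-dimensional: if \<rho> v is a finite sum of tensors with second factors b, then every
  \<open>dact a v\<close> is a combination of these b.\<close>

lemma ex_finite_subcomodule:
  assumes v: "v \<in> V"
  obtains W B where "V.subspace W" "v \<in> W" "W \<subseteq> V" "\<And>w. w \<in> W \<Longrightarrow> \<rho> w \<in> tspace s sV UNIV W"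
    "finite B" "W \<subseteq> V.span B"
proof -
  let ?I = "{a. lin s (*) a}"
  obtain F \<beta> where F: "finite F"
    and e: "\<rho> v = (\<Sum>b\<in>F. tens s sV (tsum s sV (\<lambda>x y. s (\<beta> b y) x) (\<rho> v)) b)"
    by (rule tensor_expand_right[OF C.vector_space_axioms V.vector_space_axioms coact_UNIV[of v]]) blast
  show ?thesis
  proof (rule that[of "(\<lambda>a. dact a v) ` ?I" F])
    show "V.subspace ((\<lambda>a. dact a v) ` ?I)"
      by (rule subspace_dact) (auto intro: lin_plus lin_scaled lin_const_zero)
    show "v \<in> (\<lambda>a. dact a v) ` ?I"
      using dact_counit[OF v] C.counit_linear by (metis imageI mem_Collect_eq)
    show "(\<lambda>a. dact a v) ` ?I \<subseteq> V"
      using dact_mem[OF _ subspace_V coact_mem[OF v]] by auto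
    show "finite F" by (rule F)
  next
    fix w assume "w \<in> (\<lambda>a. dact a v) ` ?I"
    then obtain a where a: "lin s (*) a" "w = dact a v" by auto
    show "\<rho> w \<in> tspace s sV UNIV ((\<lambda>a. dact a v) ` ?I)"
    proof (rule dact_stable_coact)
      fix b assume b: "lin s (*) b"
      have "bilin s s (*) (\<lambda>x y. a x * b y)"
        by (intro bilinI lin_intros lin_comp[OF a(1)] lin_comp[OF b] C.vector_space_axioms)
      from C.lin_sw[OF this lin_id[OF C.vector_space_axioms]]
      show "dact b w \<in> (\<lambda>a. dact a v) ` ?I"
        using dact_conv[OF a(1) b v] a(2) by auto
    qed
  next
    have "dact a (0 :: 'v) = 0" if "lin s (*) a" for a
      by (rule lin_zero[OF lin_dact[OF that lin_id[OF V.vector_space_axioms]]])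
    have "tsum s sV (\<lambda>h w. sV (a h) w) (\<Sum>b\<in>G. tens s sV (g b) b) \<in> V.span F \<and>
        (\<Sum>b\<in>G. tens s sV (g b) b) \<in> tspace s sV UNIV UNIV"
      if a: "lin s (*) a" and "G \<subseteq> F" for a G g
      using that(2)
      by (induction G rule: infinite_finite_induct)
        (auto simp: tsum_simps[OF bilin_dact[OF a]] tens_mem tspace_zero
          intro!: V.span_zero V.span_add V.span_scale tspace_add intro: V.span_base)
    note sp = this[OF _ order_refl, THEN conjunct1]
    have "dact a v \<in> V.span F" if "lin s (*) a" for a
      unfolding dact_def cw_def by (subst e) (rule sp[OF that])
    then show "(\<lambda>a. dact a v) ` ?I \<subseteq> V.span F" by auto
  qed
qed

text \<open>For fixed \<open>f\<close>, the map \<open>coef f\<close> is colinear from V to the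
  regular comodule; this is the reason why coefficients span a subcoalgebra.\<close>

lemma comult_coef:
  assumes f: "lin sV (*) f" and v: "v \<in> V"
  shows "\<Delta> (coef f v) = cw (\<lambda>h w. tens s s h (coef f w)) v"
proof -
  note li = lin_intros C.swl cwl lin_comp[OF f]
  have st: "lin s tscale (\<lambda>y. tens s s x y)" for x by (intro li)
  have "\<Delta> (coef f v) = cw (\<lambda>h w. \<Delta> (s (f w) h)) v"
    unfolding coef_def by (rule cw_comp[OF bilin_coef[OF f] C.comult_linear])
  also have "\<dots> = cw (\<lambda>h w. tscale (f w) (C.sw (tens s s) h)) v"
    by (simp add: lin_scale[OF C.comult_linear] C.sw_tens)
  also have "\<dots> = cw (\<lambda>h w. C.sw (\<lambda>a b. tscale (f w) (tens s s a b)) h) v"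
    by (subst C.sw_comp[OF bilin_tens lin_scaled[OF lin_id[OF vector_space_tscale]]])
      (simp_all add: C.vector_space_axioms)
  also have "\<dots> = cw (\<lambda>h w. cw (\<lambda>k u. tscale (f u) (tens s s h k)) w) v"
    by (rule cw_coassoc[OF v, where sU = tscale]) (intro li)+
  also have "\<dots> = cw (\<lambda>h w. tens s s h (coef f w)) v"
    unfolding coef_def by (subst cw_comp[OF bilin_coef[OF f] st]) (simp add: lin_scale[OF st])
  finally show ?thesis .
qed

lemma coef_dact:
  assumes f: "lin sV (*) f" and a: "lin s (*) a" and v: "v \<in> V"
  shows "coef f (dact a v) = C.sw (\<lambda>x y. s (a x) y) (coef f v)"
proof -
  note li = lin_intros C.swl cwl lin_comp[OF f] lin_comp[OF a] lin_coef[OF f]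
  have ba: "bilin s s s (\<lambda>x y. s (a x) y)" by (intro li)
  have "coef f (dact a v) = cw (\<lambda>h w. coef f (sV (a h) w)) v"
    unfolding dact_def[of a] by (rule cw_comp[OF bilin_dact[OF a] lin_coef[OF f lin_id]]) (intro li)
  also have "\<dots> = cw (\<lambda>h w. s (a h) (coef f w)) v"
    by (simp add: lin_scale[OF lin_coef[OF f lin_id[OF V.vector_space_axioms]]])
  also have "\<dots> = cw (\<lambda>h w. cw (\<lambda>k u. s (a h) (s (f u) k)) w) v"
    unfolding coef_def
    by (subst cw_comp[OF bilin_coef[OF f] lin_scaled[OF lin_id[OF C.vector_space_axioms]]]) simp
  also have "\<dots> = cw (\<lambda>h w. C.sw (\<lambda>x y. s (a x) (s (f w) y)) h) v"
    by (rule cw_coassoc[OF v, where sU = s, symmetric]) (intro li)+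
  also have "\<dots> = cw (\<lambda>h w. C.sw (\<lambda>x y. s (f w) (s (a x) y)) h) v"
    by (simp add: mult.commute)
  also have "\<dots> = cw (\<lambda>h w. s (f w) (C.sw (\<lambda>x y. s (a x) y) h)) v"
    by (subst C.sw_comp[OF ba lin_scaled[OF lin_id[OF C.vector_space_axioms]]]) simp
  also have "\<dots> = cw (\<lambda>h w. C.sw (\<lambda>x y. s (a x) y) (s (f w) h)) v"
    by (simp add: C.sw_scale[OF ba])
  also have "\<dots> = C.sw (\<lambda>x y. s (a x) y) (coef f v)"
    unfolding coef_def by (rule cw_comp[OF bilin_coef[OF f] C.lin_sw[OF ba lin_id], symmetric]) (intro li)
  finally show ?thesis .
qed

text \<open>Both sides contract \<rho> v with \<open>a\<close> and \<open>f\<close> at once. This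
  pairing converts annihilation of V by functionals into their vanishing on coefficients.\<close>

lemma functional_coef:
  assumes f: "lin sV (*) f" and a: "lin s (*) a"
  shows "a (coef f v) = f (dact a v)"
  unfolding coef_def dact_def cw_comp[OF bilin_coef[OF f] a] cw_comp[OF bilin_dact[OF a] f]
  by (simp add: lin_scale[OF a] lin_scale[OF f] mult.commute)

text \<open>The coefficient coalgebra. By \<open>coact_coef_space\<close> and
  \<open>coef_space_least\<close> it is the least subspace in which the first legs of the coaction
  on V can be taken.\<close>

definition coef_space where "coef_space = C.span {coef f v | f v. lin sV (*) f \<and> v \<in> V}"

lemma coact_coef_space:
  assumes "v \<in> V"
  shows "\<rho> v \<in> tspace s sV coef_space V"
proof (rule tspace_Int[OF C.vector_space_axioms V.vector_space_axioms _ subspace_V _ coact_mem[OF assms]])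
  show "C.subspace coef_space" by (simp add: coef_space_def)
  show "\<rho> v \<in> tspace s sV coef_space UNIV"
    by (rule tspace_leftI[OF C.vector_space_axioms V.vector_space_axioms coact_UNIV])
      (use assms in \<open>auto simp: coef_space_def coef_def cw_def intro!: C.span_base\<close>)
qed

lemma coef_space_least:
  assumes E: "C.subspace E" and "\<And>v. v \<in> V \<Longrightarrow> \<rho> v \<in> tspace s sV E UNIV"
  shows "coef_space \<subseteq> E"
  unfolding coef_space_def
proof (rule C.span_minimal[OF _ E], clarify)
  fix f v assume "lin sV (*) f" "v \<in> V"
  then show "coef f v \<in> E"
    unfolding coef_def
    by (intro cw_mem[OF bilin_coef E assms(2) E]) (auto intro: C.subspace_scale[OF E])
qed

lemma subcoalgebra_coef_space: "subcoalgebra s \<Delta> coef_space"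
proof -
  have sub: "C.subspace coef_space" by (simp add: coef_space_def)
  have "coef_space \<subseteq> {c. \<Delta> c \<in> tspace s s coef_space coef_space}"
    unfolding coef_space_def
  proof (rule C.span_minimal[OF _ subspace_vimage[OF C.comult_linear subspace_tspace]], clarify, fold coef_space_def)
    fix f v assume f: "lin sV (*) f" and v: "v \<in> V"
    show "\<Delta> (coef f v) \<in> tspace s s coef_space coef_space"
      unfolding comult_coef[OF f v]
    proof (rule cw_mem[OF _ sub coact_coef_space[OF v] subspace_tspace])
      show "bilin s sV tscale (\<lambda>h w. tens s s h (coef f w))"
        by (intro lin_intros cwl bilinI lin_coef[OF f] C.vector_space_axioms)
      show "tens s s x (coef f y) \<in> tspace s s coef_space coef_space" if "x \<in> coef_space" "y \<in> V" for x y
        using that f by (intro tens_mem) (auto simp: coef_space_def intro!: C.span_base)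
    qed
  qed
  then show ?thesis using sub by (auto simp: subcoalgebra_def)
qed

text \<open>Functionals vanishing on a subcoalgebra form a two-sided ideal of the convolution
  algebra: \<Delta> e lies in E \<otimes> E, and one factor of the product kills E.\<close>

lemma orthogonal_conv:
  assumes E: "subcoalgebra s \<Delta> E" and a: "lin s (*) a" and b: "lin s (*) b"
    and z: "(\<forall>e\<in>E. a e = 0) \<or> (\<forall>e\<in>E. b e = 0)"
  shows "lin s (*) (\<lambda>h. C.sw (\<lambda>x y. a x * b y) h)" "e \<in> E \<Longrightarrow> C.sw (\<lambda>x y. a x * b y) e = 0"
proof -
  have ab: "bilin s s (*) (\<lambda>x y. a x * b y)"
    by (intro bilinI lin_intros lin_comp[OF a] lin_comp[OF b] C.vector_space_axioms)
  show "lin s (*) (\<lambda>h. C.sw (\<lambda>x y. a x * b y) h)"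
    by (rule C.lin_sw[OF ab lin_id[OF C.vector_space_axioms]])
  show "C.sw (\<lambda>x y. a x * b y) e = 0" if "e \<in> E"
    unfolding C.sw_def
    by (rule tsum_eq_zero[OF ab C.subcoalgebraD(1)[OF E] C.subcoalgebraD(2)[OF E that]]) (use z in auto)
qed

text \<open>
  Take as few \<open>f\<close> as possible and write \<open>e\<close> as a sum with last term \<open>coef f v\<close>.  By minimality every
  functional annihilating \<open>v\<close> annihilates \<open>e\<close>.  If some \<open>a\<close> orthogonal to \<open>E\<close> satisfied \<open>a v = v\<close>, then
  \<open>\<epsilon> - a\<close> would annihilate \<open>v\<close>, and \<open>e = a e = 0\<close>.  Hence, by simplicity of \<open>V\<close>, the functionals
  orthogonal to \<open>E\<close> annihilate \<open>v\<close> and with it all of \<open>V\<close>.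
\<close>

lemma coef_meets_subcoalgebra:
  assumes simple: "\<And>W. V.subspace W \<Longrightarrow> W \<subseteq> V \<Longrightarrow> (\<And>w. w \<in> W \<Longrightarrow> \<rho> w \<in> tspace s sV UNIV W) \<Longrightarrow> W = {0} \<or> W = V"
    and E: "subcoalgebra s \<Delta> E"
    and F: "finite F" "\<And>f. f \<in> F \<Longrightarrow> lin sV (*) f"
    and e: "e \<in> E" "e \<noteq> 0" "e \<in> C.span (\<Union>f\<in>F. coef f ` V)"
    and u: "u \<in> V" and a: "lin s (*) a" "\<And>x. x \<in> E \<Longrightarrow> a x = 0"
  shows "dact a u = 0"
  using F e
proof (induction F arbitrary: e rule: finite_induct)
  case (insert f F)
  let ?S = "C.span (\<Union>f\<in>F. coef f ` V)"
  let ?r = "\<lambda>a. C.sw (\<lambda>x y. s (a x) y)"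
  note ED = C.subcoalgebraD[OF E]
  show ?case
  proof (cases "\<exists>e'\<in>E \<inter> ?S. e' \<noteq> 0")
    case True
    then show ?thesis using insert by blast
  next
    case False
    have f: "lin sV (*) f" and F: "\<And>g. g \<in> F \<Longrightarrow> lin sV (*) g" using insert.prems(1) by auto
    have cV: "C.subspace (coef f ` V)"
      by (rule subspace_image[OF lin_coef[OF f lin_id[OF V.vector_space_axioms]] subspace_V])
    have "e \<in> C.span (coef f ` V \<union> (\<Union>f\<in>F. coef f ` V))"
      using insert.prems(4) by simp
    then obtain v e' where v: "v \<in> V" and e': "e' \<in> ?S" and e: "e = coef f v + e'"
      unfolding C.span_Un C.span_eq_iff[THEN iffD2, OF cV] by blast
    have blr: "bilin s s s (\<lambda>x y. s (b x) y)" if "lin s (*) b" for b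
      using that by (intro bilin_scale1 C.vector_space_axioms)
    have rS: "?r b x \<in> ?S" if b: "lin s (*) b" and x: "x \<in> ?S" for b x
    proof -
      have "?S \<subseteq> {x. ?r b x \<in> ?S}"
      proof (rule C.span_minimal)
        show "C.subspace {x. ?r b x \<in> ?S}"
          by (rule subspace_vimage[OF C.lin_sw[OF blr[OF b] lin_id[OF C.vector_space_axioms]] C.subspace_span])
        show "(\<Union>f\<in>F. coef f ` V) \<subseteq> {x. ?r b x \<in> ?S}"
        proof clarify
          fix g w assume g: "g \<in> F" "w \<in> V"
          have "?r b (coef g w) = coef g (dact b w)"
            using coef_dact[OF F[OF g(1)] b g(2)] by simp
          moreover have "dact b w \<in> V" by (rule dact_mem[OF b subspace_V coact_mem[OF g(2)]])
          ultimately show "?r b (coef g w) \<in> ?S" using g(1) by (auto intro!: C.span_base)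
        qed
      qed
      with x show ?thesis by blast
    qed
    have rE: "?r b x \<in> E" if b: "lin s (*) b" and x: "x \<in> E" for b x
      by (rule C.sw_mem[OF blr[OF b] C.subspace_UNIV ED(4)[OF x] ED(1)]) (rule C.subspace_scale[OF ED(1)])
    have rE0: "?r b x = 0" if b: "lin s (*) b" "\<And>y. y \<in> E \<Longrightarrow> b y = 0" and x: "x \<in> E" for b x
      unfolding C.sw_def
      by (rule tsum_eq_zero[OF blr[OF b(1)] ED(1) ED(3)[OF x]]) (simp add: b(2))
    have key: "?r b e = 0" if b: "lin s (*) b" and bv: "dact b v = 0" for b
    proof -
      have "?r b e = coef f (dact b v) + ?r b e'"
        using coef_dact[OF f b v] by (simp add: e C.sw_add[OF blr[OF b]])
      also have "coef f (dact b v) = 0"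
        using bv lin_zero[OF lin_coef[OF f lin_id[OF V.vector_space_axioms]]] by simp
      finally have "?r b e \<in> ?S" using rS[OF b e'] by simp
      moreover have "?r b e \<in> E" using rE[OF b insert.prems(2)] .
      ultimately show ?thesis using False by blast
    qed
    have v0: "v \<noteq> 0"
    proof
      assume "v = 0"
      then have "coef f v = 0" using lin_zero[OF lin_coef[OF f lin_id[OF V.vector_space_axioms]]] by simp
      then show False using e e' False insert.prems(2,3) by auto
    qed
    define I where "I = {b. lin s (*) b \<and> (\<forall>x\<in>E. b x = 0)}"
    have Iadd: "(\<lambda>x. b x + c x) \<in> I" if "b \<in> I" "c \<in> I" for b c
      using that by (auto simp: I_def intro: lin_plus)
    have Isc: "(\<lambda>x. k * b x) \<in> I" if "b \<in> I" for b k
      using that by (auto simp: I_def intro: lin_scaled)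
    have I0: "(\<lambda>x. 0) \<in> I"
      using C.vector_space_axioms vector_space_mult by (auto simp: I_def intro!: linI)
    have d0: "dact b 0 = 0" if "lin s (*) b" for b
      by (rule lin_zero[OF lin_dact[OF that lin_id[OF V.vector_space_axioms]]])
    define N where "N = (\<lambda>b. dact b v) ` I"
    have N: "N = {0} \<or> N = V"
    proof (rule simple)
      show "V.subspace N" unfolding N_def
        by (rule subspace_dact[OF Iadd Isc I0]) (simp_all add: I_def)
      show "N \<subseteq> V" using dact_mem[OF _ subspace_V coact_mem[OF v]] by (auto simp: N_def I_def)
      fix w assume "w \<in> N"
      then obtain b where b: "b \<in> I" "w = dact b v" by (auto simp: N_def)
      show "\<rho> w \<in> tspace s sV UNIV N"
      proof (rule dact_stable_coact)
        fix c assume c: "lin s (*) c"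
        have "(\<lambda>h. C.sw (\<lambda>x y. b x * c y) h) \<in> I"
          using b c orthogonal_conv[OF E _ c, of b] by (auto simp: I_def)
        then show "dact c w \<in> N" using b c v by (auto simp: N_def I_def dact_conv)
      qed
    qed
    have "N \<noteq> V"
    proof
      assume "N = V"
      then obtain b where b: "b \<in> I" "dact b v = v" using v unfolding N_def by (metis imageE)
      have bl: "lin s (*) b" using b by (simp add: I_def)
      have "dact (\<lambda>x. \<epsilon> x - b x) v = 0"
        using dact_sub[OF C.counit_linear bl] dact_counit[OF v] b(2) by simp
      then have "?r (\<lambda>x. \<epsilon> x - b x) e = 0"
        by (intro key lin_sub C.counit_linear bl)
      moreover have "?r (\<lambda>x. \<epsilon> x - b x) e = ?r \<epsilon> e - ?r b e"
        unfolding C.sw_def C.scale_left_diff_distrib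
        by (rule tsum_sub[OF blr[OF C.counit_linear] blr[OF bl] C.comult_mem])
      moreover have "?r \<epsilon> e = e"
        by (rule C.sw_counit_left[OF lin_id[OF C.vector_space_axioms]])
      moreover have "?r b e = 0" using rE0 b insert.prems(2) by (auto simp: I_def)
      ultimately show False using insert.prems(3) by simp
    qed
    with N have N0: "N = {0}" by simp
    \<comment> \<open>W is the part of V annihilated by the ideal \<open>I\<close>. It is stable
      because the products c * b with b in \<open>I\<close> stay in \<open>I\<close>, just as
      \<open>N\<close> was stable because of the products b * c; simplicity of V is applied to
      both.\<close>
    define W where "W = {w \<in> V. \<forall>b\<in>I. dact b w = 0}"
    have "W = {0} \<or> W = V"
    proof (rule simple)
      show "V.subspace W"
        using subspace_V lin_add[OF lin_dact[OF _ lin_id[OF V.vector_space_axioms]]]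
          lin_scale[OF lin_dact[OF _ lin_id[OF V.vector_space_axioms]]]
        by (auto simp: W_def V.subspace_def I_def d0)
      show "W \<subseteq> V" by (auto simp: W_def)
      fix w assume w: "w \<in> W"
      show "\<rho> w \<in> tspace s sV UNIV W"
      proof (rule dact_stable_coact)
        fix c assume c: "lin s (*) c"
        have wV: "w \<in> V" using w by (simp add: W_def)
        have "dact b (dact c w) = 0" if b: "b \<in> I" for b
        proof -
          have bl: "lin s (*) b" using b by (simp add: I_def)
          have "(\<lambda>h. C.sw (\<lambda>x y. c x * b y) h) \<in> I"
            using b c orthogonal_conv[OF E c bl] by (auto simp: I_def)
          then show ?thesis using w dact_conv[OF c bl wV] by (simp add: W_def)
        qed
        moreover have "dact c w \<in> V" by (rule dact_mem[OF c subspace_V coact_mem[OF wV]])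
        ultimately show "dact c w \<in> W" by (simp add: W_def)
      qed
    qed
    moreover have "v \<in> W" using v N0 by (auto simp: W_def N_def)
    ultimately have "W = V" using v0 by auto
    then show ?thesis using u a by (auto simp: W_def I_def)
  qed
qed simp

text \<open>A nonzero element of a subcoalgebra E inside \<open>coef_space\<close> is a finite
  combination of coefficients, so every functional orthogonal to E annihilates V. By the pairing
  with coefficients it then vanishes on all of them, and separation by functionals gives
  \<open>coef_space\<close> \<subseteq> E.\<close>

lemma simple_coef_space:
  assumes V0: "V \<noteq> {0}"
    and simple: "\<And>W. V.subspace W \<Longrightarrow> W \<subseteq> V \<Longrightarrow> (\<And>w. w \<in> W \<Longrightarrow> \<rho> w \<in> tspace s sV UNIV W) \<Longrightarrow> W = {0} \<or> W = V"
  shows "simple_subcoalgebra s \<Delta> coef_space"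
  unfolding simple_subcoalgebra_def
proof (intro conjI allI impI subcoalgebra_coef_space)
  show "coef_space \<noteq> {0}"
  proof
    assume 0: "coef_space = {0}"
    obtain v where v: "v \<in> V" "v \<noteq> 0" using V0 subspace_V V.subspace_0 by blast
    have "\<rho> v = 0"
      using tspace_zero_left[OF C.vector_space_axioms V.vector_space_axioms] coact_coef_space[OF v(1)] 0 by simp
    then have "dact \<epsilon> v = 0"
      by (simp add: dact_def cw_def tsum_zero[OF bilin_dact[OF C.counit_linear]])
    then show False using v dact_counit by simp
  qed
  fix E assume E: "subcoalgebra s \<Delta> E \<and> E \<subseteq> coef_space"
  then have Es: "C.subspace E" using C.subcoalgebraD(1) by blast
  show "E = {0} \<or> E = coef_space"
  proof (cases "E = {0}")
    case False
    then obtain e where e: "e \<in> E" "e \<noteq> 0" using C.subspace_0[OF Es] by blast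
    have "e \<in> C.span {coef f v | f v. lin sV (*) f \<and> v \<in> V}" using e E by (auto simp: coef_space_def)
    then obtain T r where T: "finite T" "T \<subseteq> {coef f v | f v. lin sV (*) f \<and> v \<in> V}" "e = (\<Sum>x\<in>T. s (r x) x)"
      unfolding C.span_explicit by blast
    have "\<forall>x\<in>T. \<exists>f. lin sV (*) f \<and> x \<in> coef f ` V" using T(2) by blast
    then obtain g where g: "\<And>x. x \<in> T \<Longrightarrow> lin sV (*) (g x)" "\<And>x. x \<in> T \<Longrightarrow> x \<in> coef (g x) ` V" by metis
    have eF: "e \<in> C.span (\<Union>f\<in>g ` T. coef f ` V)"
      unfolding T(3) by (intro C.span_sum C.span_scale C.span_base) (use g(2) in blast)
    have *: "dact a u = 0" if "u \<in> V" "lin s (*) a" "\<And>x. x \<in> E \<Longrightarrow> a x = 0" for a u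
      by (rule coef_meets_subcoalgebra[OF simple _ _ _ e eF that]) (use E T(1) g in auto)
    have "coef_space \<subseteq> E"
    proof (rule coef_space_least[OF Es])
      fix v assume v: "v \<in> V"
      show "\<rho> v \<in> tspace s sV E UNIV"
      proof (rule tspace_leftI[OF C.vector_space_axioms V.vector_space_axioms coact_UNIV], rule ccontr)
        fix f assume f: "lin sV (*) f" and n: "tsum s sV (\<lambda>x y. s (f y) x) (\<rho> v) \<notin> E"
        obtain a where a: "lin s (*) a" "\<And>y. y \<in> E \<Longrightarrow> a y = 0" "a (tsum s sV (\<lambda>x y. s (f y) x) (\<rho> v)) \<noteq> 0"
          by (rule ex_functional[OF C.vector_space_axioms Es n]) blast
        have "a (coef f v) = f (dact a v)" by (rule functional_coef[OF f a(1)])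
        also have "\<dots> = 0" using *[OF v a(1,2)] lin_zero[OF f] by simp
        finally show False using a(3) by (simp add: coef_def cw_def)
      qed
    qed
    then show ?thesis using E by auto
  qed simp
qed

end

section \<open>Exhaustiveness of the coradical filtration\<close>

context vector_space
begin

text \<open>A member of least dimension works, since a proper subspace of a finite-dimensional space
  has smaller dimension. \<open>P\<close> is left open to serve both nonzero left coideals and left
  coideals not contained in the union of the filtration.\<close>

lemma ex_minimal_subspace:
  assumes P: "P W0" "W0 \<subseteq> span B0" "finite B0" and sub: "\<And>W. P W \<Longrightarrow> subspace W"
  obtains W where "P W" "W \<subseteq> W0" "\<And>W'. P W' \<Longrightarrow> W' \<subseteq> W \<Longrightarrow> W' = W"
proof -
  obtain W where W: "P W" "W \<subseteq> W0" and min: "\<And>W'. P W' \<Longrightarrow> W' \<subseteq> W0 \<Longrightarrow> dim W \<le> dim W'"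
    using ex_has_least_nat[of "\<lambda>W. P W \<and> W \<subseteq> W0" W0 dim] P by auto
  have "W' = W" if W': "P W'" "W' \<subseteq> W" for W'
  proof (rule ccontr)
    assume "W' \<noteq> W"
    then obtain w where w: "w \<in> W" "w \<notin> W'" using W' by auto
    obtain B where B: "B \<subseteq> W" "independent B" "W \<subseteq> span B" "card B = dim W" by (rule basis_exists)
    obtain B' where B': "B' \<subseteq> W'" "independent B'" "W' \<subseteq> span B'" "card B' = dim W'" by (rule basis_exists)
    have fB: "finite B"
      using independent_span_bound[OF P(3) B(2)] B(1) W(2) P(2) by blast
    have "span B' \<subseteq> W'" by (rule span_minimal[OF B'(1) sub[OF W'(1)]])
    then have "independent (insert w B')" using w B'(2) by (intro independent_insertI) auto
    moreover have "insert w B' \<subseteq> span B" using w B'(1) W'(2) B(3) by auto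
    ultimately have "finite (insert w B') \<and> card (insert w B') \<le> card B"
      by (rule independent_span_bound[OF fB])
    moreover have "w \<notin> B'" using w B'(1) by auto
    ultimately have "dim W' < dim W" using B(4) B'(4) by auto
    moreover have "dim W \<le> dim W'" using min W' W by auto
    ultimately show False by simp
  qed
  with W that show ?thesis by blast
qed

end

context coalgebra
begin

lemma subspace_corad_union: "subspace (\<Union>n. corad_filt s \<Delta> UNIV n)"
proof -
  let ?C = "corad_filt s \<Delta> UNIV"
  have "x + y \<in> (\<Union>n. ?C n)" if "x \<in> ?C m" "y \<in> ?C n" for x y m n
  proof -
    have "x \<in> ?C (max m n)" "y \<in> ?C (max m n)"
      using that corad_filt_mono[of m "max m n"] corad_filt_mono[of n "max m n"] by auto
    then have "x + y \<in> ?C (max m n)" by (rule subspace_add[OF subspace_corad_filt])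
    then show ?thesis by blast
  qed
  moreover have "0 \<in> ?C 0" by (rule subspace_0[OF subspace_corad_filt])
  moreover have "s a x \<in> ?C m" if "x \<in> ?C m" for a x m
    by (rule subspace_scale[OF subspace_corad_filt that])
  ultimately show ?thesis by (intro subspaceI) (simp_all only: UN_iff, blast+)
qed

text \<open>Let W be a minimal finite-dimensional left coideal not contained in the union. By
  minimality, W modulo its part M in the union is a simple comodule, so its coefficients lie in the
  coradical. As M lies in a single term C_n, this gives \<Delta> W \<subseteq> C_0 \<otimes> C + C
  \<otimes> C_n, so W lies in the next term, a contradiction.\<close>

theorem corad_filt_exhaustive: "\<exists>n. c \<in> corad_filt s \<Delta> UNIV n"
proof (rule ccontr)
  assume "\<nexists>n. c \<in> corad_filt s \<Delta> UNIV n"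
  let ?C = "corad_filt s \<Delta> UNIV"
  let ?U = "\<Union>n. ?C n"
  have cU: "c \<notin> ?U" using \<open>\<nexists>n. c \<in> ?C n\<close> by auto
  note vs = vector_space_axioms
  interpret A: lcomod s \<Delta> \<epsilon> s UNIV \<Delta> by (rule lcomod_regular) (auto intro: comult_mem)
  obtain W0 B0 where W0: "subspace W0" "c \<in> W0" "\<And>w. w \<in> W0 \<Longrightarrow> \<Delta> w \<in> tspace s s UNIV W0"
    "finite B0" "W0 \<subseteq> span B0" by (rule A.ex_finite_subcomodule[of c]) auto
  define P where "P = (\<lambda>W. subspace W \<and> (\<forall>w\<in>W. \<Delta> w \<in> tspace s s UNIV W) \<and> \<not> W \<subseteq> ?U)"
  have "P W0" using W0 cU by (auto simp: P_def)
  then obtain W where W: "P W" "W \<subseteq> W0" "\<And>W'. P W' \<Longrightarrow> W' \<subseteq> W \<Longrightarrow> W' = W"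
    by (rule ex_minimal_subspace[OF _ W0(5,4)]) (auto simp: P_def)
  have Ws: "subspace W" and Wc: "\<And>w. w \<in> W \<Longrightarrow> \<Delta> w \<in> tspace s s UNIV W" and WU: "\<not> W \<subseteq> ?U"
    using W(1) by (auto simp: P_def)
  define M where "M = W \<inter> ?U"
  have Ms: "subspace M" unfolding M_def by (intro subspace_inter Ws subspace_corad_union)
  have "\<exists>n. M \<subseteq> ?C n"
  proof -
    obtain B where B: "B \<subseteq> M" "independent B" "M \<subseteq> span B" by (rule basis_exists)
    have fB: "finite B"
      using independent_span_bound[OF W0(4) B(2)] B(1) W(2) W0(5) by (auto simp: M_def)
    have "\<forall>b\<in>B. \<exists>n. b \<in> ?C n" using B(1) by (auto simp: M_def)
    then obtain k where k: "\<And>b. b \<in> B \<Longrightarrow> b \<in> ?C (k b)" by metis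
    have "b \<in> ?C (Max (k ` B))" if "b \<in> B" for b
      using k[OF that] corad_filt_mono[of "k b" "Max (k ` B)"] fB that by auto
    then have "span B \<subseteq> ?C (Max (k ` B))" by (intro span_minimal subspace_corad_filt) auto
    with B(3) show ?thesis by blast
  qed
  then obtain n where n: "M \<subseteq> ?C n" by blast
  have Mn: "M = W \<inter> ?C n" using n by (auto simp: M_def)
  have Mc: "\<Delta> m \<in> tspace s s UNIV M" if "m \<in> M" for m
  proof (rule A.dact_stable_coact)
    fix a assume a: "lin s (*) a"
    have "A.dact a m \<in> W" by (rule A.dact_mem[OF a Ws Wc]) (use that Mn in auto)
    moreover have "A.dact a m \<in> ?C n"
      by (rule A.dact_mem[OF a subspace_corad_filt subcoalgebraD(4)[OF subcoalgebra_corad_filt]]) (use that Mn in auto)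
    ultimately show "A.dact a m \<in> M" by (simp add: Mn)
  qed
  have "M \<inter> {0} = {0}" using subspace_0[OF Ms] by auto
  then obtain e where e: "lin s s e" "range e \<subseteq> M" "\<And>x. x \<in> M \<Longrightarrow> e x = x"
    using ex_projection[OF vs Ms subspace_single_0] by metis
  have eM: "e x \<in> M" for x using e(2) by auto
  \<comment> \<open>\<open>q\<close> has kernel M, and its image of W serves as a model of the
    quotient W / M inside W.\<close>
  define q where "q = (\<lambda>x. x - e x)"
  have q: "lin s s q" unfolding q_def by (intro lin_sub lin_id vs e(1))
  have qM: "q x = 0" if "x \<in> M" for x using that e(3) by (simp add: q_def)
  have qq: "q (q x) = q x" for x using lin_diff[OF e(1)] e(3)[OF eM] by (simp add: q_def)
  have qW: "q w \<in> W" if "w \<in> W" for w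
    using that eM[of w] Mn subspace_diff[OF Ws] by (auto simp: q_def)
  define Q where "Q = q ` W"
  have Qs: "subspace Q" unfolding Q_def by (rule subspace_image[OF q Ws])
  have QW: "Q \<subseteq> W" using qW by (auto simp: Q_def)
  have qQ: "q x = x" if "x \<in> Q" for x using that qq by (auto simp: Q_def)
  \<comment> \<open>\<open>w\<close> may be replaced by its residue \<open>q w\<close>: the
    difference \<open>e w\<close> lies in M, so its comultiplication has second leg in M, where
    \<open>q\<close> vanishes.\<close>
  have mod_M: "sw (\<lambda>h u. f h (q u)) w = sw (\<lambda>h u. f h (q u)) (q w)" if f: "bilin s s sU f" for f w and sU :: "'k \<Rightarrow> 'u::ab_group_add \<Rightarrow> 'u"
  proof -
    have b: "bilin s s sU (\<lambda>h u. f h (q u))"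
      using f by (auto simp: bilin_def intro: lin_comp[OF _ q])
    have "sw (\<lambda>h u. f h (q u)) (e w) = 0"
      unfolding sw_def
      by (rule tsum_eq_zero[OF b subspace_UNIV Mc[OF eM]])
        (use f in \<open>auto simp: qM bilin_def dest: lin_zero\<close>)
    moreover have "sw (\<lambda>h u. f h (q u)) w = sw (\<lambda>h u. f h (q u)) (q w + e w)" by (simp add: q_def)
    ultimately show ?thesis by (simp add: sw_add[OF b])
  qed
  define \<rho> where "\<rho> = sw (\<lambda>h u. tens s s h (q u))"
  note bt = bilin_tmap[OF lin_id[OF vs] q]
  have \<rho>_UNIV: "\<rho> x \<in> tspace s s UNIV UNIV" for x
    unfolding \<rho>_def sw_def by (rule tsum_in_tspace[OF bt _ comult_mem]) (simp add: tens_mem)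
  have \<rho>_mem: "\<rho> x \<in> tspace s s UNIV Q" if "x \<in> W" for x
    unfolding \<rho>_def by (rule sw_mem[OF bt subspace_UNIV Wc[OF that] subspace_tspace]) (auto simp: Q_def tens_mem)
  have ts: "tsum s s f (\<rho> x) = sw (\<lambda>h u. f h (q u)) x" if f: "bilin s s sU f" for f x and sU :: "'k \<Rightarrow> 'u::ab_group_add \<Rightarrow> 'u"
    unfolding \<rho>_def sw_def
    by (subst tsum_tsum[OF f bt _ comult_mem]) (auto simp: tens_mem tsum_tens[OF f])
  interpret Q: lcomod s \<Delta> \<epsilon> s Q \<rho>
  proof (intro lcomod.intro lcomod_axioms.intro coalgebra_axioms vs)
    show "subspace Q" by (rule Qs)
    show "lin s tscale \<rho>" unfolding \<rho>_def by (rule lin_sw[OF bt lin_id[OF vs]])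
    show "\<rho> v \<in> tspace s s UNIV UNIV" for v by (rule \<rho>_UNIV)
    show "\<rho> v \<in> tspace s s UNIV Q" if "v \<in> Q" for v using that QW \<rho>_mem by auto
    show "tsum s s (\<lambda>h w. s (\<epsilon> h) w) (\<rho> v) = v" if "v \<in> Q" for v
      by (simp add: ts[OF bilin_scale1[OF vs counit_linear]] sw_counit_left[OF q] qQ[OF that])
  next
    fix v assume v: "v \<in> Q"
    let ?T = "tens tscale s"
    note li = lin_intros swl vs lin_comp[OF q]
    have b1: "bilin s s tscale (\<lambda>h w. sw (\<lambda>a b. ?T (tens s s a b) w) h)"
      and b2: "bilin s s tscale (\<lambda>k u. ?T (tens s s h k) u)"
      and b3: "bilin s s tscale (\<lambda>h w. sw (\<lambda>k u. ?T (tens s s h k) (q u)) w)"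
      and b4: "bilin s s tscale (\<lambda>h w. sw (\<lambda>k u. ?T (tens s s h k) (q u)) (q w))" for h
      by (intro li)+
    have "tsum s s (\<lambda>h w. tsum s s (\<lambda>a b. ?T (tens s s a b) w) (\<Delta> h)) (\<rho> v) =
        sw (\<lambda>h w. sw (\<lambda>a b. ?T (tens s s a b) (q w)) h) v"
      unfolding sw_def[symmetric] by (rule ts[OF b1])
    also have "\<dots> = sw (\<lambda>h w. sw (\<lambda>k u. ?T (tens s s h k) (q u)) w) v"
      by (rule sw_coassoc[where sU = tscale]) (intro li)+
    also have "\<dots> = sw (\<lambda>h w. sw (\<lambda>k u. ?T (tens s s h k) (q u)) (q w)) v"
      by (subst mod_M[OF b2]) simp
    also have "\<dots> = tsum s s (\<lambda>h w. tsum s s (\<lambda>k u. ?T (tens s s h k) u) (\<rho> w)) (\<rho> v)"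
      unfolding ts[OF b2] by (rule ts[OF b3, symmetric])
    finally show "tsum s s (\<lambda>h w. tsum s s (\<lambda>a b. ?T (tens s s a b) w) (\<Delta> h)) (\<rho> v) =
      tsum s s (\<lambda>h w. tsum s s (\<lambda>k u. ?T (tens s s h k) u) (\<rho> w)) (\<rho> v)" .
  qed
  have "simple_subcoalgebra s \<Delta> Q.coef_space"
  proof (rule Q.simple_coef_space)
    show "Q \<noteq> {0}"
    proof
      assume "Q = {0}"
      then have "q w = 0" if "w \<in> W" for w using that by (metis Q_def imageI singletonD)
      then have "w = e w" if "w \<in> W" for w using that by (simp add: q_def)
      then have "W \<subseteq> M" using eM by (metis subsetI)
      then show False using WU by (auto simp: M_def)
    qed
    fix X assume X: "subspace X" "X \<subseteq> Q" "\<And>x. x \<in> X \<Longrightarrow> \<rho> x \<in> tspace s s UNIV X"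
    \<comment> \<open>The preimage of X in W is again a left coideal, so by minimality of W it is
      all of W or lies in the union, hence in M.\<close>
    define W' where "W' = {w \<in> W. q w \<in> X}"
    have W's: "subspace W'"
    proof -
      have "W' = W \<inter> {w. q w \<in> X}" by (auto simp: W'_def)
      then show ?thesis by (simp add: subspace_inter Ws subspace_vimage[OF q X(1)])
    qed
    have W'c: "\<Delta> w \<in> tspace s s UNIV W'" if w: "w \<in> W'" for w
    proof (rule A.dact_stable_coact)
      fix a assume a: "lin s (*) a"
      note ba = bilin_scale1[OF vs a]
      have "A.dact a w \<in> W" by (rule A.dact_mem[OF a Ws Wc]) (use w in \<open>auto simp: W'_def\<close>)
      moreover have "q (A.dact a w) = Q.dact a (q w)"
      proof -
        have "q (A.dact a w) = sw (\<lambda>h u. s (a h) (q u)) w"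
          unfolding A.dact_def A.cw_def sw_def[symmetric] sw_comp[OF ba q] lin_scale[OF q] ..
        also have "\<dots> = sw (\<lambda>h u. s (a h) (q u)) (q w)" by (rule mod_M[OF ba])
        finally show ?thesis by (simp add: Q.dact_def Q.cw_def ts[OF ba])
      qed
      moreover have "Q.dact a (q w) \<in> X"
        by (rule Q.dact_mem[OF a X(1) X(3)]) (use w in \<open>simp add: W'_def\<close>)
      ultimately show "A.dact a w \<in> W'" by (simp add: W'_def)
    qed
    show "X = {0} \<or> X = Q"
    proof (cases "W' \<subseteq> ?U")
      case True
      have "x = 0" if "x \<in> X" for x
      proof -
        have "x \<in> W'" using that X(2) QW qQ by (auto simp: W'_def)
        then have "x \<in> M" using True by (auto simp: M_def W'_def)
        then show ?thesis using qM[of x] qQ[of x] that X(2) by auto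
      qed
      then show ?thesis using subspace_0[OF X(1)] by auto
    next
      case False
      then have "W' = W" using W's W'c by (intro W(3)) (auto simp: P_def W'_def)
      then have "Q \<subseteq> X" by (auto simp: Q_def W'_def)
      then show ?thesis using X(2) by auto
    qed
  qed
  then have D: "Q.coef_space \<subseteq> coradical s \<Delta> UNIV"
    unfolding coradical_def by (intro subset_trans[OF _ span_superset]) blast
  have "w \<in> ?C (Suc n)" if w: "w \<in> W" for w
  proof -
    \<comment> \<open>The second leg is split into its residue and its part in M: the former
      contributes coefficients of the simple quotient, the latter lies in C_n.\<close>
    have "\<Delta> w = sw (\<lambda>h u. tens s s h (q u) + tens s s h (e u)) w"
      using lin_add[OF lin_tens2[OF lin_id[OF vs] vs], symmetric]
      by (simp add: sw_tens q_def)
    also have "\<dots> = \<rho> w + sw (\<lambda>h u. tens s s h (e u)) w"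
      unfolding \<rho>_def sw_def by (rule tsum_plus[OF bt bilin_tmap[OF lin_id[OF vs] e(1)] comult_mem])
    also have "\<rho> w = \<rho> (q w)"
      unfolding \<rho>_def by (rule mod_M[OF bilin_tens[OF vs vs]])
    finally have eq: "\<Delta> w = \<rho> (q w) + sw (\<lambda>h u. tens s s h (e u)) w" .
    have "\<rho> (q w) \<in> tspace s s (coradical s \<Delta> UNIV) UNIV"
      using Q.coact_coef_space[of "q w"] w tspace_mono[OF D, of Q UNIV s s] by (auto simp: Q_def)
    moreover have "sw (\<lambda>h u. tens s s h (e u)) w \<in> tspace s s UNIV (?C n)"
      unfolding sw_def
      by (rule tsum_in_tspace[OF bilin_tmap[OF lin_id[OF vs] e(1)] _ comult_mem]) (use eM n in \<open>auto intro: tens_mem\<close>)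
    ultimately show ?thesis by (simp add: wedge_def eq ssumI)
  qed
  then show False using WU by blast
qed

end

section \<open>Simple subcoalgebras and simple comodules\<close>

context coalgebra
begin

text \<open>Precompose the coaction with a linear projection onto V; its values on V are unchanged,
  and the axioms stated with \<open>tlift\<close> over V become identities for
  \<open>tsum\<close>.\<close>

lemma left_comodule_total:
  assumes "left_comodule s \<Delta> \<epsilon> sV V \<rho>"
  obtains \<rho>' where "lcomod s \<Delta> \<epsilon> sV V \<rho>'" "\<And>v. v \<in> V \<Longrightarrow> \<rho>' v = \<rho> v"
proof -
  have V: "vector_space sV" "module.subspace sV V" and lin: "lin_on sV tscale V \<rho>"
    and mem: "\<And>v. v \<in> V \<Longrightarrow> \<rho> v \<in> tspace s sV UNIV V"
    and co: "\<And>v. v \<in> V \<Longrightarrow>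
      tlift s sV UNIV V (\<lambda>h w. tsum s s (\<lambda>a b. tens tscale sV (tens s s a b) w) (\<Delta> h)) (\<rho> v) =
      tlift s sV UNIV V (\<lambda>h w. tlift s sV UNIV V (\<lambda>k u. tens tscale sV (tens s s h k) u) (\<rho> w)) (\<rho> v)"
    and un: "\<And>v. v \<in> V \<Longrightarrow> tlift s sV UNIV V (\<lambda>h w. sV (\<epsilon> h) w) (\<rho> v) = v"
    using assms by (auto simp: left_comodule_def)
  interpret V: vector_space sV by fact
  have "V \<inter> {0} = {0}" using V.subspace_0[OF V(2)] by auto
  then obtain p where p: "lin sV sV p" "range p \<subseteq> V" "\<And>x. x \<in> V \<Longrightarrow> p x = x"
    using ex_projection[OF V V.subspace_single_0] by metis
  have pV: "p x \<in> V" for x using p(2) by auto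
  define \<rho>' where "\<rho>' v = \<rho> (p v)" for v
  have eq: "\<rho>' v = \<rho> v" if "v \<in> V" for v using p(3) that by (simp add: \<rho>'_def)
  have lin': "lin sV tscale \<rho>'"
    by (rule linI) (use V(1) vector_space_tscale lin pV in \<open>auto simp: \<rho>'_def lin_on_def lin_add[OF p(1)] lin_scale[OF p(1)]\<close>)
  have mem': "\<rho>' v \<in> tspace s sV UNIV V" for v
    unfolding \<rho>'_def by (rule mem[OF pV])
  note vs = vector_space_axioms V(1)
  have b1: "bilin s sV tscale (\<lambda>k u. tens tscale sV (tens s s h k) u)" for h
    by (intro bilinI lin_intros vs)
  have b2: "bilin s sV tscale (\<lambda>h w. sw (\<lambda>a b. tens tscale sV (tens s s a b) w) h)"
    by (intro lin_intros swl vs)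
  have b3: "bilin s sV tscale (\<lambda>h w. tsum s sV (\<lambda>k u. tens tscale sV (tens s s h k) u) (\<rho>' w))"
    by (intro bilinI lin_tsum tsum_param lin' b1 lin_intros vs tspace_UNIV[OF mem'])
  have "lcomod s \<Delta> \<epsilon> sV V \<rho>'"
  proof (intro lcomod.intro lcomod_axioms.intro coalgebra_axioms vs V(2) lin' mem' tspace_UNIV[OF mem'])
    fix v assume v: "v \<in> V"
    note t = tlift_eq_tsum[OF _ subspace_UNIV V(2) _ mem[OF v]]
    show "tsum s sV (\<lambda>h w. sV (\<epsilon> h) w) (\<rho>' v) = v"
      using un[OF v] t[OF bilin_scale1[OF vs(2) counit_linear] refl] eq[OF v] by simp
    have "tlift s sV UNIV V (\<lambda>h w. tsum s s (\<lambda>a b. tens tscale sV (tens s s a b) w) (\<Delta> h)) (\<rho> v) =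
        tsum s sV (\<lambda>h w. tsum s s (\<lambda>a b. tens tscale sV (tens s s a b) w) (\<Delta> h)) (\<rho>' v)"
      unfolding eq[OF v] by (rule t[OF b2[unfolded sw_def] refl])
    moreover have "tlift s sV UNIV V (\<lambda>h w. tlift s sV UNIV V (\<lambda>k u. tens tscale sV (tens s s h k) u) (\<rho> w)) (\<rho> v) =
        tsum s sV (\<lambda>h w. tsum s sV (\<lambda>k u. tens tscale sV (tens s s h k) u) (\<rho>' w)) (\<rho>' v)"
      unfolding eq[OF v]
    proof (rule t[OF b3])
      fix h w assume "w \<in> V"
      then show "tlift s sV UNIV V (\<lambda>k u. tens tscale sV (tens s s h k) u) (\<rho> w) =
          tsum s sV (\<lambda>k u. tens tscale sV (tens s s h k) u) (\<rho>' w)"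
        unfolding eq[OF \<open>w \<in> V\<close>] by (intro tlift_eq_tsum[OF b1 subspace_UNIV V(2) refl] mem)
    qed
    ultimately show "tsum s sV (\<lambda>h w. tsum s s (\<lambda>a b. tens tscale sV (tens s s a b) w) (\<Delta> h)) (\<rho>' v) =
      tsum s sV (\<lambda>h w. tsum s sV (\<lambda>k u. tens tscale sV (tens s s h k) u) (\<rho>' w)) (\<rho>' v)"
      using co[OF v] by simp
  qed
  with eq that show ?thesis by blast
qed

lemma left_comodule_coideal:
  assumes V: "subspace V" "\<And>v. v \<in> V \<Longrightarrow> \<Delta> v \<in> tspace s s UNIV V"
  shows "left_comodule s \<Delta> \<epsilon> s V \<Delta>"
  unfolding left_comodule_def
proof (intro conjI ballI)
  note vs = vector_space_axioms
  show "vector_space s" "subspace V" by fact+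
  show "lin_on s tscale V \<Delta>" by (rule lin_imp_lin_on[OF comult_linear])
  show "\<Delta> ` V \<subseteq> tspace s s UNIV V" using V(2) by auto
  have b1: "bilin s s tscale (\<lambda>k u. tens tscale s (tens s s h k) u)" for h
    by (intro bilinI lin_intros vs)
  have b2: "bilin s s tscale (\<lambda>h w. tsum s s (\<lambda>a b. tens tscale s (tens s s a b) w) (\<Delta> h))"
    "bilin s s tscale (\<lambda>h w. tsum s s (\<lambda>a b. tens tscale s (tens s s h a) b) (\<Delta> w))"
    unfolding sw_def[symmetric] by (intro lin_intros swl vs)+
  fix v assume v: "v \<in> V"
  note t = tlift_eq_tsum[OF _ subspace_UNIV V(1) _ V(2)]
  show "tlift s s UNIV V (\<lambda>h. s (\<epsilon> h)) (\<Delta> v) = v"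
    using counit_left t[OF bilin_scale1[OF vs counit_linear] refl v] by simp
  have "tlift s s UNIV V (\<lambda>h w. tsum s s (\<lambda>a b. tens tscale s (tens s s a b) w) (\<Delta> h)) (\<Delta> v) =
      tsum s s (\<lambda>h w. tsum s s (\<lambda>a b. tens tscale s (tens s s h a) b) (\<Delta> w)) (\<Delta> v)"
    unfolding coassoc[symmetric] by (rule t[OF b2(1) refl v])
  also have "\<dots> = tlift s s UNIV V (\<lambda>h w. tlift s s UNIV V (\<lambda>k u. tens tscale s (tens s s h k) u) (\<Delta> w)) (\<Delta> v)"
    by (rule t[OF b2(2) _ v, symmetric]) (rule t[OF b1 refl])
  finally show "tlift s s UNIV V (\<lambda>h w. tsum s s (\<lambda>a b. tens tscale s (tens s s a b) w) (\<Delta> h)) (\<Delta> v) =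
      tlift s s UNIV V (\<lambda>h w. tlift s s UNIV V (\<lambda>k u. tens tscale s (tens s s h k) u) (\<Delta> w)) (\<Delta> v)" .
qed

lemma simple_left_comodule_coef:
  assumes "simple_left_comodule s \<Delta> \<epsilon> sV V \<rho>"
  obtains D where "simple_subcoalgebra s \<Delta> D" "\<rho> ` V \<subseteq> tspace s sV D V"
    "\<And>E. subcoalgebra s \<Delta> E \<Longrightarrow> \<rho> ` V \<subseteq> tspace s sV E V \<Longrightarrow> D \<subseteq> E"
proof -
  have c: "left_comodule s \<Delta> \<epsilon> sV V \<rho>" and V0: "V \<noteq> {0}"
    and simple: "\<And>W. module.subspace sV W \<Longrightarrow> W \<subseteq> V \<Longrightarrow> \<rho> ` W \<subseteq> tspace s sV UNIV W \<Longrightarrow> W = {0} \<or> W = V"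
    using assms by (auto simp: simple_left_comodule_def)
  obtain \<rho>' where \<rho>': "lcomod s \<Delta> \<epsilon> sV V \<rho>'" "\<And>v. v \<in> V \<Longrightarrow> \<rho>' v = \<rho> v"
    using left_comodule_total[OF c] by blast
  interpret L: lcomod s \<Delta> \<epsilon> sV V \<rho>' by fact
  show ?thesis
  proof (rule that)
    show "simple_subcoalgebra s \<Delta> L.coef_space"
    proof (rule L.simple_coef_space[OF V0])
      fix W assume W: "L.V.subspace W" "W \<subseteq> V" "\<And>w. w \<in> W \<Longrightarrow> \<rho>' w \<in> tspace s sV UNIV W"
      then have "\<rho> ` W \<subseteq> tspace s sV UNIV W" using \<rho>'(2) by (metis image_subsetI subsetD)
      then show "W = {0} \<or> W = V" using simple W by blast
    qed
    show "\<rho> ` V \<subseteq> tspace s sV L.coef_space V"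
      using L.coact_coef_space \<rho>'(2) by (metis image_subsetI)
    fix E assume E: "subcoalgebra s \<Delta> E" "\<rho> ` V \<subseteq> tspace s sV E V"
    show "L.coef_space \<subseteq> E"
    proof (rule L.coef_space_least[OF subcoalgebraD(1)[OF E(1)]])
      fix v assume "v \<in> V"
      then have "\<rho>' v \<in> tspace s sV E V" using E(2) \<rho>'(2) by (metis image_subset_iff)
      then show "\<rho>' v \<in> tspace s sV E UNIV" using tspace_mono[of E E V UNIV s sV] by auto
    qed
  qed
qed

lemma simple_subcoalgebra_subset:
  "simple_subcoalgebra s \<Delta> D \<Longrightarrow> simple_subcoalgebra s \<Delta> E \<Longrightarrow> D \<subseteq> E \<Longrightarrow> D = E"
  by (auto simp: simple_subcoalgebra_def)

lemma colinear_image_coact: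
  assumes V: "vector_space sV" "module.subspace sV V" and W: "vector_space sW" "module.subspace sW W"
    and D: "subspace D" and f: "left_colinear s sV V \<rho> sW W \<sigma> f" and fV: "f ` V = W"
    and \<rho>: "\<rho> ` V \<subseteq> tspace s sV D V"
  shows "\<sigma> ` W \<subseteq> tspace s sW D W"
proof -
  note vs = vector_space_axioms
  have fl: "lin_on sV sW V f" and \<sigma>: "\<And>v. v \<in> V \<Longrightarrow> \<sigma> (f v) = tlift s sV UNIV V (\<lambda>h w. tens s sW h (f w)) (\<rho> v)"
    using f by (auto simp: left_colinear_def)
  have b: "bilin_on s sV tscale UNIV V (\<lambda>h w. tens s sW h (f w))"
    using bilin_on_tens[OF vs W(1)] fl by (auto simp: bilin_on_def lin_on_def)
  have "\<sigma> (f v) \<in> tspace s sW D W" if v: "v \<in> V" for v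
  proof -
    obtain l where l: "set l \<subseteq> D \<times> V" "\<rho> v = sum_list (map (\<lambda>(x, y). tens s sV x y) l)"
      using \<rho> v unfolding tspace_list[OF vs V(1) D] image_subset_iff by blast
    have "set l \<subseteq> UNIV \<times> V" using l(1) by auto
    then have "\<sigma> (f v) = sum_list (map (\<lambda>(x, y). tens s sW x (f y)) l)"
      unfolding \<sigma>[OF v] l(2) by (rule tlift_list[OF vs V(1) vector_space_tscale subspace_UNIV V(2) b])
    moreover have "sum_list (map (\<lambda>(x, y). tens s sW x (f y)) l) \<in> tspace s sW D W"
      using l(1) fV by (induction l) (auto intro!: tspace_zero tspace_add tens_mem)
    ultimately show ?thesis by simp
  qed
  then show ?thesis using fV by blast
qed

text \<open>Isomorphisms transport coefficients, so \<open>D\<close> serves the whole class.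
  Uniqueness: any other candidate contains the coefficient coalgebra of the representative, which is
  simple, and so equals it, as \<open>D\<close> does.\<close>

lemma class_coalg_eqI:
  assumes sc: "simple_left_comodule s \<Delta> \<epsilon> s V \<rho>" and D: "simple_subcoalgebra s \<Delta> D" "\<rho> ` V \<subseteq> tspace s s D V"
  shows "class_coalg s \<Delta> (comodule_iso_rel s \<Delta> \<epsilon> `` {(V, \<rho>)}) = D"
  unfolding class_coalg_def
proof (rule the_equality)
  note vs = vector_space_axioms
  have Vs: "subspace V" and mem: "\<rho> ` V \<subseteq> tspace s s UNIV V" using sc by (auto simp: simple_left_comodule_def left_comodule_def)
  show "simple_subcoalgebra s \<Delta> D \<and>
    (\<forall>(V, \<rho>)\<in>comodule_iso_rel s \<Delta> \<epsilon> `` {(V, \<rho>)}. \<rho> ` V \<subseteq> tspace s s D V)"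
  proof (intro conjI D(1) ballI, clarify)
    fix W \<sigma> w assume "((V, \<rho>), (W, \<sigma>)) \<in> comodule_iso_rel s \<Delta> \<epsilon>" and w: "w \<in> W"
    then obtain f where f: "left_colinear s s V \<rho> s W \<sigma> f" "f ` V = W"
      and W: "simple_left_comodule s \<Delta> \<epsilon> s W \<sigma>"
      by (auto simp: comodule_iso_rel_def simple_comodules_def bij_betw_def)
    have "\<sigma> ` W \<subseteq> tspace s s D W"
      by (rule colinear_image_coact[OF vs Vs vs _ _ f D(2)])
        (use W D(1) in \<open>auto simp: simple_left_comodule_def left_comodule_def simple_subcoalgebra_def subcoalgebra_def\<close>)
    then show "\<sigma> w \<in> tspace s s D W" using w by blast
  qed
  fix E assume E: "simple_subcoalgebra s \<Delta> E \<and>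
    (\<forall>(V, \<rho>)\<in>comodule_iso_rel s \<Delta> \<epsilon> `` {(V, \<rho>)}. \<rho> ` V \<subseteq> tspace s s E V)"
  \<comment> \<open>Reflexivity puts the representative itself into its class, so that the property
    of \<open>E\<close> applies to it.\<close>
  have "((V, \<rho>), (V, \<rho>)) \<in> comodule_iso_rel s \<Delta> \<epsilon>"
  proof -
    have "left_colinear s s V \<rho> s V \<rho> (\<lambda>x. x)"
      unfolding left_colinear_def
    proof (intro conjI ballI)
      fix v assume v: "v \<in> V"
      have "tlift s s UNIV V (\<lambda>h w. tens s s h w) (\<rho> v) = tsum s s (tens s s) (\<rho> v)"
        by (rule tlift_eq_tsum[OF bilin_tens[OF vs vs] subspace_UNIV Vs refl]) (use v mem in auto)
      also have "\<dots> = \<rho> v" by (rule tsum_id[OF vs vs tspace_UNIV]) (use v mem in auto)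
      finally show "\<rho> v = tlift s s UNIV V (\<lambda>h w. tens s s h w) (\<rho> v)" by simp
    qed (auto simp: lin_on_def)
    then show ?thesis using sc
      by (auto simp: comodule_iso_rel_def simple_comodules_def bij_betw_def intro!: exI[of _ "\<lambda>x. x"])
  qed
  then have "(V, \<rho>) \<in> comodule_iso_rel s \<Delta> \<epsilon> `` {(V, \<rho>)}" by blast
  then have E2: "simple_subcoalgebra s \<Delta> E" "\<rho> ` V \<subseteq> tspace s s E V" using E by fast+
  obtain D' where D': "simple_subcoalgebra s \<Delta> D'"
    "\<And>E. subcoalgebra s \<Delta> E \<Longrightarrow> \<rho> ` V \<subseteq> tspace s s E V \<Longrightarrow> D' \<subseteq> E"
    by (rule simple_left_comodule_coef[OF sc]) blast
  have "D' = D" "D' = E"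
    by (rule simple_subcoalgebra_subset, use D D' E2 in \<open>simp_all add: simple_subcoalgebra_def\<close>)+
  then show "E = D" by simp
qed

text \<open>A minimal nonzero left coideal V inside \<open>D\<close> is a simple comodule with
  coaction in D \<otimes> V; by uniqueness its class has coalgebra \<open>D\<close>. Finiteness of
  subcomodules guarantees that such a V exists.\<close>

lemma ex_class_coalg:
  assumes D: "simple_subcoalgebra s \<Delta> D"
  obtains \<tau> where "\<tau> \<in> comod_classes s \<Delta> \<epsilon>" "class_coalg s \<Delta> \<tau> = D"
proof -
  have Ds: "subcoalgebra s \<Delta> D" and D0: "D \<noteq> {0}" using D by (auto simp: simple_subcoalgebra_def)
  note DD = subcoalgebraD[OF Ds]
  obtain d where d: "d \<in> D" "d \<noteq> 0" using D0 subspace_0[OF DD(1)] by blast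
  interpret A: lcomod s \<Delta> \<epsilon> s D \<Delta> by (rule lcomod_regular[OF DD(1,4)])
  obtain W0 B0 where W0: "subspace W0" "d \<in> W0" "W0 \<subseteq> D" "\<And>w. w \<in> W0 \<Longrightarrow> \<Delta> w \<in> tspace s s UNIV W0"
    "finite B0" "W0 \<subseteq> span B0" by (rule A.ex_finite_subcomodule[OF d(1)]) auto
  define P where "P = (\<lambda>W. subspace W \<and> \<Delta> ` W \<subseteq> tspace s s UNIV W \<and> W \<noteq> {0})"
  have "P W0" using W0 d by (auto simp: P_def)
  then obtain V where V: "P V" "V \<subseteq> W0" "\<And>W'. P W' \<Longrightarrow> W' \<subseteq> V \<Longrightarrow> W' = V"
    by (rule ex_minimal_subspace[OF _ W0(6,5)]) (auto simp: P_def)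
  have sc: "simple_left_comodule s \<Delta> \<epsilon> s V \<Delta>"
    unfolding simple_left_comodule_def
    using V left_comodule_coideal[of V] by (auto simp: P_def)
  have "\<Delta> v \<in> tspace s s D V" if "v \<in> V" for v
    by (rule tspace_Int[OF vector_space_axioms vector_space_axioms DD(1)])
      (use that V W0(3) DD(3) in \<open>auto simp: P_def\<close>)
  then have "class_coalg s \<Delta> (comodule_iso_rel s \<Delta> \<epsilon> `` {(V, \<Delta>)}) = D"
    by (intro class_coalg_eqI[OF sc D]) auto
  moreover have "comodule_iso_rel s \<Delta> \<epsilon> `` {(V, \<Delta>)} \<in> comod_classes s \<Delta> \<epsilon>"
    unfolding comod_classes_def by (rule quotientI) (simp add: simple_comodules_def sc)
  ultimately show ?thesis using that by blast
qed

text \<open>Induction on the family. If d in D is x + y with x in the sum T of the smaller family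
  and y in the new member E, then \<Delta> d lies in D \<otimes> D and in T \<otimes> C + C
  \<otimes> E; as D meets T and E trivially, \<Delta> d = 0 and hence d = 0.\<close>

lemma simple_subcoalgebra_independent:
  assumes D: "simple_subcoalgebra s \<Delta> D" and F: "finite \<F>" "\<And>E. E \<in> \<F> \<Longrightarrow> simple_subcoalgebra s \<Delta> E" "D \<notin> \<F>"
  shows "D \<inter> span (\<Union>\<F>) = {0}"
  using F
proof (induction rule: finite_induct)
  case empty
  have "subspace D" using D by (auto simp: simple_subcoalgebra_def subcoalgebra_def)
  then show ?case using subspace_0 by auto
next
  case (insert E \<F>)
  have sc: "subcoalgebra s \<Delta> D" "subcoalgebra s \<Delta> E" using D insert.prems(1) by (auto simp: simple_subcoalgebra_def)
  note DD = subcoalgebraD[OF sc(1)] and EE = subcoalgebraD[OF sc(2)]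
  have scF: "subcoalgebra s \<Delta> (span (\<Union>\<F>))"
    by (rule subcoalgebra_span) (use insert.prems(1) in \<open>auto simp: simple_subcoalgebra_def\<close>)
  note FF = subcoalgebraD[OF scF]
  have IH: "D \<inter> span (\<Union>\<F>) = {0}" using insert by auto
  have DE: "D \<inter> E = {0}"
  proof (rule ccontr)
    assume "D \<inter> E \<noteq> {0}"
    moreover have "subcoalgebra s \<Delta> (D \<inter> E)" by (rule subcoalgebra_Int[OF sc])
    ultimately have "D \<inter> E = D" using D by (auto simp: simple_subcoalgebra_def)
    then have "D = E" using simple_subcoalgebra_subset[OF D] insert.prems(1) by auto
    then show False using insert.prems(2) by auto
  qed
  have "d = 0" if d: "d \<in> D" "d \<in> span (\<Union>(insert E \<F>))" for d
  proof -
    have "span (\<Union>(insert E \<F>)) = span (\<Union>\<F> \<union> E)" by (simp add: Un_commute)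
    then obtain x y where xy: "d = x + y" "x \<in> span (\<Union>\<F>)" "y \<in> E"
      using d(2) unfolding span_Un span_eq_iff[THEN iffD2, OF EE(1)] by auto
    have "\<Delta> d \<in> ssum (tspace s s (span (\<Union>\<F>)) UNIV) (tspace s s UNIV E)"
      unfolding xy(1) lin_add[OF comult_linear] by (intro ssumI FF(3) EE(4) xy)
    then have "\<Delta> d = 0"
      by (rule tensor_disjoint[OF vector_space_axioms DD(1) FF(1) IH EE(1) DE DD(2)[OF d(1)]])
    then show ?thesis by (rule comult_eq_zero)
  qed
  moreover have "0 \<in> D" "0 \<in> span (\<Union>(insert E \<F>))" using subspace_0[OF DD(1)] span_zero by auto
  ultimately show ?case by blast
qed

text \<open>The functional is the counit after a projection onto \<open>D\<close> that kills all
  other simple subcoalgebras. Such a projection exists since an element of their span involves only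
  finitely many of them, the case settled by independence.\<close>

lemma ex_isotypic_functional:
  assumes D: "simple_subcoalgebra s \<Delta> D"
  obtains e where "lin s (*) e" "\<And>x. x \<in> D \<Longrightarrow> e x = \<epsilon> x"
    "\<And>E x. simple_subcoalgebra s \<Delta> E \<Longrightarrow> E \<noteq> D \<Longrightarrow> x \<in> E \<Longrightarrow> e x = 0"
proof -
  let ?A = "{E. simple_subcoalgebra s \<Delta> E \<and> E \<noteq> D}"
  have Ds: "subspace D" using D by (auto simp: simple_subcoalgebra_def subcoalgebra_def)
  have "x = 0" if x: "x \<in> D" "x \<in> span (\<Union>?A)" for x
  proof -
    obtain T r where T: "finite T" "T \<subseteq> \<Union>?A" "x = (\<Sum>a\<in>T. s (r a) a)"
      using x(2) unfolding span_explicit by blast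
    have "\<forall>t\<in>T. \<exists>E. E \<in> ?A \<and> t \<in> E" using T(2) by blast
    then obtain g where g: "\<And>t. t \<in> T \<Longrightarrow> g t \<in> ?A" "\<And>t. t \<in> T \<Longrightarrow> t \<in> g t" by metis
    have "x \<in> span (\<Union>(g ` T))" unfolding T(3)
      by (intro span_sum span_scale span_base) (use g(2) in blast)
    moreover have "D \<inter> span (\<Union>(g ` T)) = {0}"
      by (rule simple_subcoalgebra_independent[OF D]) (use T(1) g(1) in auto)
    ultimately show ?thesis using x(1) by blast
  qed
  then have "D \<inter> span (\<Union>?A) = {0}" using subspace_0[OF Ds] span_zero by blast
  then obtain p where p: "lin s s p" "\<And>x. x \<in> D \<Longrightarrow> p x = x" "\<And>x. x \<in> span (\<Union>?A) \<Longrightarrow> p x = 0"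
    by (rule ex_projection[OF vector_space_axioms Ds subspace_span]) blast
  show ?thesis
  proof (rule that[of "\<lambda>x. \<epsilon> (p x)"])
    show "lin s (*) (\<lambda>x. \<epsilon> (p x))" by (rule lin_comp[OF counit_linear p(1)])
    show "\<epsilon> (p x) = \<epsilon> x" if "x \<in> D" for x using p(2) that by simp
    show "\<epsilon> (p x) = 0" if "simple_subcoalgebra s \<Delta> E" "E \<noteq> D" "x \<in> E" for E x
    proof -
      have "x \<in> span (\<Union>?A)" using that by (intro span_base) auto
      then show ?thesis using p(3) lin_zero[OF counit_linear] by simp
    qed
  qed
qed

end

section \<open>Sweedler calculus in Hopf algebras and module coalgebras\<close>

lemma tsum_swap:
  fixes sU :: "'k::field \<Rightarrow> 'u::ab_group_add \<Rightarrow> 'u"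
  assumes t: "t \<in> tspace sA sB UNIV UNIV" and u: "u \<in> tspace sC sD UNIV UNIV"
    and F1: "\<And>x y. bilin sC sD sU (F x y)" and F2: "\<And>g k. bilin sA sB sU (\<lambda>x y. F x y g k)"
  shows "tsum sA sB (\<lambda>x y. tsum sC sD (F x y) u) t = tsum sC sD (\<lambda>g k. tsum sA sB (\<lambda>x y. F x y g k) t) u"
proof -
  have b: "bilin sA sB sU (\<lambda>x y. tsum sC sD (F x y) u)"
    using F2 by (intro bilinI tsum_param[OF F1 _ u]) (auto simp: bilin_def)
  have b2: "bilin sC sD sU (\<lambda>g k. tsum sA sB (\<lambda>x y. F x y g k) t)" if "t \<in> tspace sA sB UNIV UNIV" for t
    using F1 that by (intro bilinI tsum_param[OF F2]) (auto simp: bilin_def)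
  interpret U: vector_space sU using F1 by (rule bilin_vs)
  have z: "tsum sC sD (\<lambda>g k. 0) u = (0 :: 'u)"
    by (rule tsum_eq_zero[OF _ subspace_univ u])
      (use bilin_vs[OF F1] in \<open>auto intro!: bilinI linI\<close>)
  from bilin_vs(1,2)[OF F2] t show ?thesis
  proof (induction rule: tspace_induct_UNIV)
    case zero
    then show ?case by (simp add: tsum_zero[OF b] tsum_zero[OF F2] z)
  next
    case (add x y v)
    have "tsum sC sD (\<lambda>g k. tsum sA sB (\<lambda>x y. F x y g k) (tens sA sB x y + v)) u =
        tsum sC sD (\<lambda>g k. F x y g k + tsum sA sB (\<lambda>x y. F x y g k) v) u"
      by (simp add: tsum_add[OF F2] tsum_tens[OF F2] tens_mem add.hyps)
    also have "\<dots> = tsum sC sD (F x y) u + tsum sC sD (\<lambda>g k. tsum sA sB (\<lambda>x y. F x y g k) v) u"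
      by (rule tsum_plus[OF F1 b2[OF add.hyps] u])
    finally show ?case by (simp add: tsum_add[OF b] tsum_tens[OF b] tens_mem add)
  qed
qed

lemma (in coalgebra) tsum_sw:
  "bilin sA sB sU f \<Longrightarrow> bilin s s tscale g \<Longrightarrow> (\<And>x y. g x y \<in> tspace sA sB UNIV UNIV) \<Longrightarrow>
    tsum sA sB f (sw g c) = sw (\<lambda>x y. tsum sA sB f (g x y)) c"
  unfolding sw_def by (rule tsum_tsum) (auto intro: comult_mem)

lemma (in coalgebra) sw_in_tspace:
  "bilin s s tscale g \<Longrightarrow> (\<And>x y. g x y \<in> tspace sA sB X Y) \<Longrightarrow> sw g c \<in> tspace sA sB X Y"
  unfolding sw_def by (rule tsum_in_tspace) (auto intro: comult_mem)

lemma coalgebra_map_sw: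
  assumes A: "coalgebra sA \<Delta>A \<epsilon>A" and B: "coalgebra sB \<Delta>B \<epsilon>B" and f: "coalgebra_map sA \<Delta>A \<epsilon>A sB \<Delta>B \<epsilon>B f"
    and F: "bilin sB sB sU F"
  shows "coalgebra.sw sB \<Delta>B F (f c) = coalgebra.sw sA \<Delta>A (\<lambda>x y. F (f x) (f y)) c"
proof -
  interpret A: coalgebra sA \<Delta>A \<epsilon>A by fact
  interpret B: coalgebra sB \<Delta>B \<epsilon>B by fact
  have fl: "lin sA sB f" using f by (simp add: coalgebra_map_def)
  note b = bilin_tmap[OF fl fl]
  have "B.sw F (f c) = tsum sB sB F (A.sw (\<lambda>x y. tens sB sB (f x) (f y)) c)"
    unfolding B.sw_def A.sw_def using f by (simp add: coalgebra_map_def)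
  also have "\<dots> = A.sw (\<lambda>x y. F (f x) (f y)) c"
    by (subst A.tsum_sw[OF F b]) (auto simp: tens_mem tsum_tens[OF F])
  finally show ?thesis .
qed

context hopf_algebra
begin

lemma lin_mult1: "lin sV s g \<Longrightarrow> lin sV s (\<lambda>x. g x * y)"
  by (rule linI) (auto simp: lin_add lin_scale scale_mult_left distrib_right vector_space_axioms dest: lin_vs1)

lemma lin_mult2: "lin sV s g \<Longrightarrow> lin sV s (\<lambda>x. y * g x)"
  by (rule linI) (auto simp: lin_add lin_scale scale_mult_right distrib_left vector_space_axioms dest: lin_vs1)

lemmas hli = lin_intros swl vector_space_axioms lin_mult1 lin_mult2 lin_comp[OF antipode_linear]

lemma sw_mult:
  assumes F: "bilin s s sU F"
  shows "sw F (x * y) = sw (\<lambda>a b. sw (\<lambda>c d. F (a * c) (b * d)) y) x"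
proof -
  have b1: "bilin s s tscale (\<lambda>c d. tens s s (a * c) (b * d))" for a b by (intro hli)
  have b2: "bilin s s tscale (\<lambda>a b. sw (\<lambda>c d. tens s s (a * c) (b * d)) y)" by (intro hli)
  have "sw F (x * y) = tsum s s F (sw (\<lambda>a b. sw (\<lambda>c d. tens s s (a * c) (b * d)) y) x)"
    by (simp add: sw_def comult_mult)
  also have "\<dots> = sw (\<lambda>a b. sw (\<lambda>c d. F (a * c) (b * d)) y) x"
    by (simp add: tsum_sw[OF F b2] tsum_sw[OF F b1] sw_in_tspace[OF b1] tens_mem tsum_tens[OF F])
  finally show ?thesis .
qed

lemma sw_one: "bilin s s sU F \<Longrightarrow> sw F 1 = F 1 1"
  by (simp add: sw_def comult_one tsum_tens)

lemma sw_antipode_left: "lin s sU f \<Longrightarrow> sw (\<lambda>a b. f (S a * b)) x = sU (\<epsilon> x) (f 1)"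
proof -
  assume f: "lin s sU f"
  have b: "bilin s s s (\<lambda>a b. S a * b)" by (intro hli)
  show ?thesis
    using sw_comp[OF b f, of x] antipode_left[of x] by (simp add: sw_def lin_scale[OF f])
qed

lemma sw_antipode_right: "lin s sU f \<Longrightarrow> sw (\<lambda>a b. f (a * S b)) x = sU (\<epsilon> x) (f 1)"
proof -
  assume f: "lin s sU f"
  have b: "bilin s s s (\<lambda>a b. a * S b)" by (intro hli)
  show ?thesis
    using sw_comp[OF b f, of x] antipode_right[of x] by (simp add: sw_def lin_scale[OF f])
qed

lemma antipode_one: "S 1 = 1"
  using sw_antipode_left[OF lin_id[OF vector_space_axioms], of 1]
    sw_one[of s "\<lambda>a b. S a * b"] counit_one
  by (simp add: bilinI hli)

lemma sw_swap:
  assumes "\<And>x y. bilin s s sU (F x y)" "\<And>g k. bilin s s sU (\<lambda>x y. F x y g k)"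
  shows "sw (\<lambda>x y. sw (F x y) d) c = sw (\<lambda>g k. sw (\<lambda>x y. F x y g k) c) d"
  unfolding sw_def by (rule tsum_swap[OF comult_mem comult_mem assms])

text \<open>
  Both \<open>\<Delta> \<circ> S\<close> and \<open>h \<mapsto> S h\<^sub>(\<^sub>2\<^sub>) \<otimes> S h\<^sub>(\<^sub>1\<^sub>)\<close> are convolution inverses of \<open>\<Delta>\<close>; the second inverse is
  inserted on the right of the first.
\<close>

lemma sw_antipode:
  assumes F: "bilin s s sU F"
  shows "sw F (S h) = sw (\<lambda>a b. F (S b) (S a)) h"
proof -
  \<comment> \<open>\<open>A z p q\<close> is \<open>F\<close> evaluated on the product of \<Delta>
    z with p \<otimes> q; in these terms \<open>Am\<close> expresses that \<Delta> is
    multiplicative.\<close>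
  define A where "A = (\<lambda>z p q. sw (\<lambda>x y. F (x * p) (y * q)) z)"
  note Fl = bilin_left[OF F] and Fr = bilin_right[OF F]
  have A1: "lin sV sU (\<lambda>v. A (g v) p q)" if "lin sV s g" for sV :: "'k \<Rightarrow> 'v::ab_group_add \<Rightarrow> 'v" and g p q
    unfolding A_def by (intro hli Fl Fr that)
  have A2: "lin sV sU (\<lambda>v. A z (g v) q)" if "lin sV s g" for sV :: "'k \<Rightarrow> 'v::ab_group_add \<Rightarrow> 'v" and g z q
    unfolding A_def by (intro hli Fl Fr that)
  have A3: "lin sV sU (\<lambda>v. A z p (g v))" if "lin sV s g" for sV :: "'k \<Rightarrow> 'v::ab_group_add \<Rightarrow> 'v" and g z p
    unfolding A_def by (intro hli Fl Fr that)
  note al = A1 A2 A3 hli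
  have U: "vector_space sU" by (rule bilin_vs(3)[OF F])
  have A11: "A z 1 1 = sw F z" for z by (simp add: A_def)
  have Am: "sw (\<lambda>a b. A z (a * p) (b * q)) w = A (z * w) p q" for z w p q
  proof -
    have "A (z * w) p q = sw (\<lambda>x y. sw (\<lambda>a b. F (x * a * p) (y * b * q)) w) z"
      unfolding A_def by (rule sw_mult[where sU = sU]) (intro hli Fl Fr)
    also have "\<dots> = sw (\<lambda>a b. sw (\<lambda>x y. F (x * a * p) (y * b * q)) z) w"
      by (rule sw_swap[where sU = sU]) (intro hli Fl Fr)+
    finally show ?thesis by (simp add: A_def mult.assoc)
  qed
  \<comment> \<open>The inverse property v_1 S(v_4) \<otimes> v_2 S(v_3) = \<epsilon>(v) 1 \<otimes>
    1, multiplied on the left by \<Delta> z: the inner pair cancels first, then the outer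
    one.\<close>
  have E: "sw (\<lambda>a r. sw (\<lambda>b r'. sw (\<lambda>c d. A z (a * S d) (b * S c)) r') r) v = sU (\<epsilon> v) (A z 1 1)" for z v
  proof -
    have "sw (\<lambda>b r'. sw (\<lambda>c d. A z (a * S d) (b * S c)) r') r = A z (a * S r) 1" for a r
    proof -
      have "sw (\<lambda>b r'. sw (\<lambda>c d. A z (a * S d) (b * S c)) r') r =
          sw (\<lambda>q d. sw (\<lambda>b c. A z (a * S d) (b * S c)) q) r"
        by (rule sw_coassoc[where sU = sU, symmetric]) (intro al)+
      also have "\<dots> = sw (\<lambda>q d. sU (\<epsilon> q) (A z (a * S d) 1)) r"
        by (subst sw_antipode_right[OF A3[OF lin_id[OF vector_space_axioms]]]) simp
      also have "\<dots> = A z (a * S r) 1"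
        by (rule sw_counit_left[where sU = sU]) (intro al)
      finally show ?thesis .
    qed
    then show ?thesis using sw_antipode_right[OF A2[OF lin_id[OF vector_space_axioms]]] by simp
  qed
  have "sw F (S h) = sw (\<lambda>u v. sU (\<epsilon> v) (A (S u) 1 1)) h"
    unfolding A11[symmetric] by (rule sw_counit_right[where sU = sU, symmetric]) (intro al)
  also have "\<dots> = sw (\<lambda>u v. sw (\<lambda>a r. sw (\<lambda>b r'. sw (\<lambda>c d. A (S u) (a * S d) (b * S c)) r') r) v) h"
    by (simp add: E)
  also have "\<dots> = sw (\<lambda>u v. sw (\<lambda>w r'. sw (\<lambda>a b. sw (\<lambda>c d. A (S u) (a * S d) (b * S c)) r') w) v) h"
    by (subst sw_coassoc[where sU = sU]) (intro al refl)+
  also have "\<dots> = sw (\<lambda>u v. sw (\<lambda>w r'. sw (\<lambda>c d. sw (\<lambda>a b. A (S u) (a * S d) (b * S c)) w) r') v) h"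
    by (subst sw_swap[where sU = sU]) (intro al refl)+
  also have "\<dots> = sw (\<lambda>u v. sw (\<lambda>w r'. sw (\<lambda>c d. A (S u * w) (S d) (S c)) r') v) h"
    by (simp add: Am)
  also have "\<dots> = sw (\<lambda>z r'. sw (\<lambda>u w. sw (\<lambda>c d. A (S u * w) (S d) (S c)) r') z) h"
    by (rule sw_coassoc[where sU = sU, symmetric]) (intro al)+
  also have "\<dots> = sw (\<lambda>z r'. sU (\<epsilon> z) (sw (\<lambda>c d. A 1 (S d) (S c)) r')) h"
  proof -
    have "lin s sU (\<lambda>y. sw (\<lambda>c d. A y (S d) (S c)) r')" for r' by (intro al)
    then show ?thesis by (subst sw_antipode_left) auto
  qed
  also have "\<dots> = sw (\<lambda>c d. A 1 (S d) (S c)) h"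
    by (rule sw_counit_left[where sU = sU]) (intro al)
  also have "\<dots> = sw (\<lambda>a b. F (S b) (S a)) h"
  proof -
    have "A 1 p q = F p q" for p q
      unfolding A_def by (subst sw_one[where sU = sU]) (intro hli Fl Fr, simp)
    then show ?thesis by simp
  qed
  finally show ?thesis .
qed

end

section \<open>Coinvariants\<close>

lemma tsum_ssum_mem:
  assumes f: "bilin sA sB sU f" and X: "module.subspace sA X"
    and t: "t \<in> ssum (tspace sA sB X UNIV) (tspace sA sB UNIV Y)"
    and Z: "module.subspace sU Z"
    and "\<And>x y. x \<in> X \<Longrightarrow> f x y \<in> Z" "\<And>x y. y \<in> Y \<Longrightarrow> f x y \<in> Z"
  shows "tsum sA sB f t \<in> Z"
proof -
  obtain u v where uv: "t = u + v" "u \<in> tspace sA sB X UNIV" "v \<in> tspace sA sB UNIV Y"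
    using t by (auto simp: ssum_def)
  interpret U: vector_space sU using f by (rule bilin_vs)
  have "tsum sA sB f u \<in> Z" by (rule tsum_mem[OF f X uv(2) Z]) (rule assms)
  moreover have "tsum sA sB f v \<in> Z"
    by (rule tsum_mem[OF f subspace_univ uv(3) Z]) (use assms bilin_vs(1)[OF f] in auto)
  ultimately show ?thesis using uv by (simp add: tsum_add[OF f] tspace_UNIV U.subspace_add[OF Z])
qed

locale hopf_splitting = right_module_coalgebra sH \<Delta>H \<epsilon>H S sC \<Delta>C \<epsilon>C act
  for sH :: "'k::field \<Rightarrow> 'h::ring_1 \<Rightarrow> 'h" and \<Delta>H \<epsilon>H S
    and sC :: "'k \<Rightarrow> 'c::ab_group_add \<Rightarrow> 'c" and \<Delta>C \<epsilon>C act +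
  fixes \<iota> :: "'h \<Rightarrow> 'c" and \<pi> :: "'c \<Rightarrow> 'h"
  assumes iota_map: "coalgebra_map sH \<Delta>H \<epsilon>H sC \<Delta>C \<epsilon>C \<iota>"
    and iota_mult: "\<iota> (g * h) = act (\<iota> g) h"
    and range_iota: "range \<iota> = coradical sC \<Delta>C UNIV"
    and pi_map: "coalgebra_map sC \<Delta>C \<epsilon>C sH \<Delta>H \<epsilon>H \<pi>"
    and pi_act: "\<pi> (act c h) = \<pi> c * h"
    and pi_iota: "\<pi> (\<iota> h) = h"
begin

abbreviation lcoact where "lcoact \<equiv> left_coact sH sC \<Delta>C \<pi>"
abbreviation rcoact where "rcoact \<equiv> right_coact sH sC \<Delta>C \<pi>"
abbreviation R where "R \<equiv> coinv sH sC \<Delta>C \<pi>"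
abbreviation \<delta> where "\<delta> \<equiv> coinv_comult S sC \<Delta>C act \<pi>"
abbreviation Cf where "Cf \<equiv> corad_filt sC \<Delta>C UNIV"

lemma iota_linear: "lin sH sC \<iota>" and pi_linear: "lin sC sH \<pi>"
  and counit_pi: "\<epsilon>H (\<pi> c) = \<epsilon>C c"
  using iota_map pi_map by (simp_all add: coalgebra_map_def)

lemma bilin_act: "bilin sC sH sC act"
  by (rule bilin_on_UNIV[OF C.vector_space_axioms H.vector_space_axioms C.vector_space_axioms act_bilinear])

lemmas lin_act1 = bilin_left[OF bilin_act]
lemmas lin_act2 = bilin_right[OF bilin_act]

lemmas act_scale1 = lin_scale[OF lin_act1[OF lin_id[OF C.vector_space_axioms]]]
lemmas act_scale2 = lin_scale[OF lin_act2[OF lin_id[OF H.vector_space_axioms]]]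

lemmas li = H.hli C.swl lin_act1 lin_act2 lin_comp[OF iota_linear] lin_comp[OF pi_linear]

lemma sw_act:
  assumes F: "bilin sC sC sU F"
  shows "C.sw F (act c h) = C.sw (\<lambda>a b. H.sw (\<lambda>g k. F (act a g) (act b k)) h) c"
proof -
  have b1: "bilin sH sH tscale (\<lambda>g k. tens sC sC (act a g) (act b k))" for a b by (intro li)
  have b2: "bilin sC sC tscale (\<lambda>a b. H.sw (\<lambda>g k. tens sC sC (act a g) (act b k)) h)" by (intro li)
  have "C.sw F (act c h) = tsum sC sC F (C.sw (\<lambda>a b. H.sw (\<lambda>g k. tens sC sC (act a g) (act b k)) h) c)"
    by (simp add: C.sw_def H.sw_def comult_act)
  also have "\<dots> = C.sw (\<lambda>a b. H.sw (\<lambda>g k. F (act a g) (act b k)) h) c"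
    by (simp add: C.tsum_sw[OF F b2] H.tsum_sw[OF F b1] H.sw_in_tspace[OF b1] tens_mem tsum_tens[OF F])
  finally show ?thesis .
qed

lemma sw_swap_CH:
  assumes "\<And>x y. bilin sH sH sU (F x y)" "\<And>g k. bilin sC sC sU (\<lambda>x y. F x y g k)"
  shows "C.sw (\<lambda>x y. H.sw (F x y) h) c = H.sw (\<lambda>g k. C.sw (\<lambda>x y. F x y g k) c) h"
  unfolding H.sw_def C.sw_def by (rule tsum_swap[OF C.comult_mem H.comult_mem assms])

lemma sw_pi: "bilin sH sH sU F \<Longrightarrow> H.sw F (\<pi> c) = C.sw (\<lambda>a b. F (\<pi> a) (\<pi> b)) c"
  by (rule coalgebra_map_sw[OF C.coalgebra_axioms H.coalgebra_axioms pi_map])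

lemma sw_iota: "bilin sC sC sU F \<Longrightarrow> C.sw F (\<iota> h) = H.sw (\<lambda>a b. F (\<iota> a) (\<iota> b)) h"
  by (rule coalgebra_map_sw[OF H.coalgebra_axioms C.coalgebra_axioms iota_map])

lemma lco_sw: "lcoact c = C.sw (\<lambda>x y. tens sH sC (\<pi> x) y) c"
  and rco_sw: "rcoact c = C.sw (\<lambda>x y. tens sC sH x (\<pi> y)) c"
  by (simp_all add: left_coact_def right_coact_def C.sw_def)

lemma tsum_lco: "bilin sH sC sU F \<Longrightarrow> tsum sH sC F (lcoact c) = C.sw (\<lambda>x y. F (\<pi> x) y) c"
proof -
  assume F: "bilin sH sC sU F"
  have b: "bilin sC sC tscale (\<lambda>x y. tens sH sC (\<pi> x) y)" by (intro li)
  show ?thesis unfolding lco_sw by (subst C.tsum_sw[OF F b]) (auto simp: tens_mem tsum_tens[OF F])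
qed

lemma tsum_rco: "bilin sC sH sU F \<Longrightarrow> tsum sC sH F (rcoact c) = C.sw (\<lambda>x y. F x (\<pi> y)) c"
proof -
  assume F: "bilin sC sH sU F"
  have b: "bilin sC sC tscale (\<lambda>x y. tens sC sH x (\<pi> y))" by (intro li)
  show ?thesis unfolding rco_sw by (subst C.tsum_sw[OF F b]) (auto simp: tens_mem tsum_tens[OF F])
qed

lemma lin_lco: "lin sV sC g \<Longrightarrow> lin sV tscale (\<lambda>x. lcoact (g x))"
  and lin_rco: "lin sV sC g \<Longrightarrow> lin sV tscale (\<lambda>x. rcoact (g x))"
  unfolding lco_sw rco_sw by (intro li; assumption)+

text \<open>Coinvariance in Sweedler form: a second leg of \<Delta> r that occurs only through
  \<open>\<pi>\<close> may be replaced by 1.\<close>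

lemma coinv_sw: "r \<in> R \<Longrightarrow> bilin sC sH sU F \<Longrightarrow> C.sw (\<lambda>x y. F x (\<pi> y)) r = F r 1"
  using tsum_rco[of sU F r] by (simp add: coinv_def tsum_tens)

lemma subspace_coinv: "C.subspace R"
proof -
  have "lin sC tscale (\<lambda>c. rcoact c - tens sC sH c 1)" by (intro li lin_rco)
  from subspace_kernel[OF this] show ?thesis by (simp add: coinv_def)
qed

definition proj :: "'c \<Rightarrow> 'c" where "proj c = C.sw (\<lambda>a b. act a (S (\<pi> b))) c"

lemma lin_proj: "lin sV sC g \<Longrightarrow> lin sV sC (\<lambda>x. proj (g x))"
  unfolding proj_def by (intro li; assumption)

lemmas pli = lin_proj li lin_lco lin_rco

text \<open>Because S reverses the comultiplication, the right coaction of c_1 S(\<pi> c_2) is c_1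
  S(\<pi> c_4) \<otimes> \<pi>(c_2) S(\<pi> c_3), and the second factor cancels to a counit.\<close>

lemma proj_coinv: "proj c \<in> R"
proof -
  let ?t = "tens sC sH"
  have bt: "bilin sC sC tscale (\<lambda>x y. ?t x (\<pi> y))" by (intro li)
  have "rcoact (proj c) = C.sw (\<lambda>a b. rcoact (act a (S (\<pi> b)))) c"
    unfolding proj_def by (rule C.sw_comp[where sU = sC and sW = tscale]) (intro pli)+
  also have "\<dots> = C.sw (\<lambda>a b. C.sw (\<lambda>a1 a2. H.sw (\<lambda>g k. ?t (act a1 g) (\<pi> a2 * k)) (S (\<pi> b))) a) c"
    unfolding rco_sw sw_act[OF bt] pi_act ..
  also have "\<dots> = C.sw (\<lambda>a b. C.sw (\<lambda>a1 a2. C.sw (\<lambda>b1 b2. ?t (act a1 (S (\<pi> b2))) (\<pi> a2 * S (\<pi> b1))) b) a) c"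
  proof -
    have b1: "bilin sH sH tscale (\<lambda>g k. ?t (act x g) (y * k))" for x y by (intro li)
    have b2: "bilin sH sH tscale (\<lambda>a b. ?t (act x (S b)) (y * S a))" for x y by (intro li)
    show ?thesis by (simp add: H.sw_antipode[OF b1] sw_pi[OF b2])
  qed
  also have "\<dots> = C.sw (\<lambda>a1 b'. C.sw (\<lambda>a2 b. C.sw (\<lambda>b1 b2. ?t (act a1 (S (\<pi> b2))) (\<pi> a2 * S (\<pi> b1))) b) b') c"
    by (rule C.sw_coassoc[where sU = tscale]) (intro li)+
  also have "\<dots> = C.sw (\<lambda>a1 b'. C.sw (\<lambda>b b2. C.sw (\<lambda>a2 b1. ?t (act a1 (S (\<pi> b2))) (\<pi> a2 * S (\<pi> b1))) b) b') c"
    by (subst C.sw_coassoc[where sU = tscale]) (intro li refl)+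
  also have "\<dots> = C.sw (\<lambda>a1 b'. C.sw (\<lambda>b b2. tscale (\<epsilon>C b) (?t (act a1 (S (\<pi> b2))) 1)) b') c"
  proof -
    have l: "lin sH tscale (\<lambda>z. ?t (act x y) z)" for x y by (intro li)
    have b: "bilin sH sH tscale (\<lambda>a b. ?t (act x y) (a * S b))" for x y by (intro li)
    show ?thesis by (simp add: sw_pi[OF b, symmetric] H.sw_antipode_right[OF l] counit_pi)
  qed
  also have "\<dots> = C.sw (\<lambda>a1 b'. ?t (act a1 (S (\<pi> b'))) 1) c"
    by (subst C.sw_counit_left[where sU = tscale]) (intro li refl)+
  also have "\<dots> = ?t (proj c) 1"
    unfolding proj_def by (rule C.sw_comp[where sU = sC and sW = tscale, symmetric]) (intro li)+
  finally show ?thesis by (simp add: coinv_def)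
qed

lemma proj_id: "r \<in> R \<Longrightarrow> proj r = r"
proof -
  assume r: "r \<in> R"
  have b: "bilin sC sH sC (\<lambda>a h. act a (S h))" by (intro li)
  show ?thesis unfolding proj_def coinv_sw[OF r b] by (simp add: H.antipode_one act_one)
qed

text \<open>Coinvariance reduces the left side to r h_1 S(h_2). In terms of the decomposition of
  \<open>C\<close> as R # H, \<open>proj\<close> is therefore the identity of R tensored with the
  counit of H.\<close>

lemma proj_act:
  assumes r: "r \<in> R"
  shows "proj (act r h) = sC (\<epsilon>H h) r"
proof -
  have "proj (act r h) = C.sw (\<lambda>a b. H.sw (\<lambda>g k. act a (g * S (\<pi> b * k))) h) r"
    unfolding proj_def by (subst sw_act[where sU = sC]) (intro li, simp add: pi_act act_act)
  also have "\<dots> = H.sw (\<lambda>g k. C.sw (\<lambda>a b. act a (g * S (\<pi> b * k))) r) h"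
    by (rule sw_swap_CH[where sU = sC]) (intro li)+
  also have "\<dots> = H.sw (\<lambda>g k. act r (g * S k)) h"
    by (subst coinv_sw[OF r, where sU = sC]) (intro li, simp)
  also have "\<dots> = sC (\<epsilon>H h) r"
    by (subst H.sw_antipode_right[where sU = sC]) (intro li, simp add: act_one)
  finally show ?thesis .
qed

text \<open>In c_1 S(\<pi> c_2) \<pi>(c_3) the last two factors cancel. This decomposition writes
  every element of \<open>C\<close> through products of coinvariants with elements of H.\<close>

lemma proj_split: "C.sw (\<lambda>a b. act (proj a) (\<pi> b)) c = c"
proof -
  have "C.sw (\<lambda>a b. act (proj a) (\<pi> b)) c = C.sw (\<lambda>a b. C.sw (\<lambda>a1 a2. act a1 (S (\<pi> a2) * \<pi> b)) a) c"
    unfolding proj_def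
    by (subst C.sw_comp[where sU = sC and sW = sC and h = "\<lambda>x. act x _"]) (intro li, intro li, simp add: act_act)
  also have "\<dots> = C.sw (\<lambda>a1 b'. C.sw (\<lambda>a2 b. act a1 (S (\<pi> a2) * \<pi> b)) b') c"
    by (rule C.sw_coassoc[where sU = sC]) (intro li)+
  also have "\<dots> = C.sw (\<lambda>a1 b'. sC (\<epsilon>C b') a1) c"
  proof -
    have l: "lin sH sC (\<lambda>z. act x z)" for x by (intro li)
    have b: "bilin sH sH sC (\<lambda>a b. act x (S a * b))" for x by (intro li)
    show ?thesis by (simp add: sw_pi[OF b, symmetric] H.sw_antipode_left[OF l] counit_pi act_one)
  qed
  also have "\<dots> = c" by (rule C.sw_counit_right[where sU = sC]) (intro li)
  finally show ?thesis .
qed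

lemma coinv_comult_sw: "\<delta> c = C.sw (\<lambda>x y. tens sC sC (proj x) y) c"
proof -
  have "\<delta> c = C.sw (\<lambda>x y. C.sw (\<lambda>a b. tens sC sC (act a (S (\<pi> b))) y) x) c"
    by (simp add: coinv_comult_def C.sw_def)
  also have "\<dots> = C.sw (\<lambda>x y. tens sC sC (proj x) y) c"
    unfolding proj_def
    by (subst C.sw_comp[where sU = sC and sW = tscale and h = "\<lambda>x. tens sC sC x _"]) (intro li, intro li, simp)
  finally show ?thesis .
qed

lemma bilin_delta: "bilin sC sC tscale (\<lambda>x y. tens sC sC (proj x) y)"
  by (intro pli)

lemma tsum_delta: "bilin sC sC sU F \<Longrightarrow> tsum sC sC F (\<delta> c) = C.sw (\<lambda>x y. F (proj x) y) c"
  unfolding coinv_comult_sw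
  by (subst C.tsum_sw[OF _ bilin_delta]) (auto simp: tens_mem tsum_tens)

lemma delta_UNIV: "\<delta> c \<in> tspace sC sC UNIV UNIV"
  unfolding coinv_comult_sw by (rule C.sw_in_tspace[OF bilin_delta]) (simp add: tens_mem)

text \<open>Coassociativity and coinvariance of \<open>r\<close> give (id \<otimes>
  \<open>rcoact\<close>) \<Delta> r = \<Delta> r \<otimes> 1, so the second leg of \<Delta> r lies
  in R, the kernel of \<open>rcoact\<close> minus c \<mapsto> c \<otimes> 1. The map
  \<open>G\<close> on the first leg is \<open>\<pi>\<close> for the left coaction and
  \<open>proj\<close> for \<open>\<delta>\<close>.\<close>

lemma sw_right_coinv:
  assumes r: "r \<in> R" and G: "lin sC sU G"
  shows "C.sw (\<lambda>x y. tens sU sC (G x) y) r \<in> tspace sU sC UNIV R"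
proof -
  let ?t = "tens sU tscale" and ?u = "tens sC sH"
  note gli = pli lin_comp[OF G] lin_vs2[OF G]
  have bG: "bilin sC sC tscale (\<lambda>x y. tens sU sC (G x) y)" by (intro gli)
  have mG: "C.sw (\<lambda>x y. tens sU sC (G x) y) r \<in> tspace sU sC UNIV UNIV"
    by (rule C.sw_in_tspace[OF bG]) (simp add: tens_mem)
  have lf: "lin sC tscale (\<lambda>c. rcoact c - ?u c 1)" by (intro pli)
  have tl: "lin tscale tscale (\<lambda>v. ?t x v)" for x and v :: "('c, 'h, 'k) tensor" by (intro gli)
  have b1: "bilin sU sC tscale (\<lambda>x y. ?t x (rcoact y - ?u y 1))" by (intro gli)
  have "tsum sU sC (\<lambda>x y. ?t x (rcoact y - ?u y 1)) (C.sw (\<lambda>x y. tens sU sC (G x) y) r) =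
      C.sw (\<lambda>x y. ?t (G x) (rcoact y) - ?t (G x) (?u y 1)) r"
    by (subst C.tsum_sw[OF b1 bG], simp add: tens_mem, simp only: tsum_tens[OF b1], simp add: lin_diff[OF tl])
  also have "\<dots> = C.sw (\<lambda>x y. ?t (G x) (rcoact y)) r - C.sw (\<lambda>x y. ?t (G x) (?u y 1)) r"
    unfolding C.sw_def by (rule tsum_sub[where sU = tscale]) (intro gli C.comult_mem)+
  also have "C.sw (\<lambda>x y. ?t (G x) (rcoact y)) r = C.sw (\<lambda>x y. C.sw (\<lambda>a b. ?t (G x) (?u a (\<pi> b))) y) r"
  proof -
    have b: "bilin sC sC tscale (\<lambda>a b. ?u a (\<pi> b))" by (intro li)
    show ?thesis unfolding rco_sw by (subst C.sw_comp[OF b tl]) simp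
  qed
  also have "\<dots> = C.sw (\<lambda>z b. C.sw (\<lambda>x a. ?t (G x) (?u a (\<pi> b))) z) r"
    by (rule C.sw_coassoc[where sU = tscale, symmetric]) (intro gli)+
  also have "\<dots> = C.sw (\<lambda>x a. ?t (G x) (?u a 1)) r"
    by (rule coinv_sw[OF r, where sU = tscale]) (intro gli)
  finally have "tsum sU sC (\<lambda>x y. ?t x (rcoact y - ?u y 1)) (C.sw (\<lambda>x y. tens sU sC (G x) y) r) = 0" by simp
  from tensor_kernel_right[OF lf lin_vs2[OF G] mG this]
  show ?thesis by (simp add: coinv_def)
qed

lemma lco_coinv: "r \<in> R \<Longrightarrow> lcoact r \<in> tspace sH sC UNIV R"
  unfolding lco_sw by (rule sw_right_coinv[OF _ pi_linear])

lemma delta_coinv: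
  assumes r: "r \<in> R"
  shows "\<delta> r \<in> tspace sC sC R R"
proof (rule tspace_Int[OF C.vector_space_axioms C.vector_space_axioms subspace_coinv subspace_coinv])
  show "\<delta> r \<in> tspace sC sC R UNIV"
    unfolding coinv_comult_sw by (rule C.sw_in_tspace[OF bilin_delta]) (simp add: tens_mem proj_coinv)
  show "\<delta> r \<in> tspace sC sC UNIV R"
    unfolding coinv_comult_sw by (rule sw_right_coinv[OF r lin_proj[OF lin_id[OF C.vector_space_axioms]]])
qed

text \<open>Applying x \<otimes> y \<mapsto> x \<pi>(y_1) \<otimes> y_2 to \<delta> c = proj(c_1)
  \<otimes> c_2 produces proj(c_1) \<pi>(c_2) \<otimes> c_3, which is \<Delta> c by
  \<open>proj_split\<close>.\<close>

lemma sw_delta: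
  assumes F: "bilin sC sC sU F"
  shows "C.sw F c = tsum sC sC (\<lambda>x y. C.sw (\<lambda>a b. F (act x (\<pi> a)) b) y) (\<delta> c)"
proof -
  note fl = bilin_left[OF F] bilin_right[OF F] pli
  have b1: "bilin sC sC sU (\<lambda>x y. C.sw (\<lambda>a b. F (act x (\<pi> a)) b) y)" by (intro fl)
  have b2: "bilin sC sC sC (\<lambda>x a. act (proj x) (\<pi> a))" by (intro fl)
  have l: "lin sC sU (\<lambda>z. F z b)" for b by (intro fl)
  have "tsum sC sC (\<lambda>x y. C.sw (\<lambda>a b. F (act x (\<pi> a)) b) y) (\<delta> c) =
      C.sw (\<lambda>x y. C.sw (\<lambda>a b. F (act (proj x) (\<pi> a)) b) y) c"
    by (rule tsum_delta[OF b1])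
  also have "\<dots> = C.sw (\<lambda>z b. C.sw (\<lambda>x a. F (act (proj x) (\<pi> a)) b) z) c"
    by (rule C.sw_coassoc[where sU = sU, symmetric]) (intro fl)+
  also have "\<dots> = C.sw F c"
    by (simp add: C.sw_comp[OF b2 l, symmetric] proj_split)
  finally show ?thesis ..
qed

section \<open>The coradical filtration of the coinvariants\<close>

lemma Cf_0: "Cf 0 = range \<iota>"
  by (simp add: range_iota)

lemmas subspace_Cf = C.subspace_corad_filt
lemmas Cf_left = C.subcoalgebraD(4)[OF C.subcoalgebra_corad_filt]
lemmas Cf_right = C.subcoalgebraD(3)[OF C.subcoalgebra_corad_filt]

text \<open>\<Delta> is compatible with the diagonal action, and C_0 is stable since
  \<open>\<iota>\<close> is right linear; the wedge recursion passes stability of C_0 and C_n on to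
  the next term.\<close>

lemma act_Cf: "c \<in> Cf n \<Longrightarrow> act c h \<in> Cf n"
proof (induction n arbitrary: c h)
  case 0
  then show ?case unfolding Cf_0 by (auto simp: iota_mult[symmetric])
next
  case (Suc n)
  have b: "bilin sC sC tscale (\<lambda>a b. H.sw (\<lambda>g k. tens sC sC (act a g) (act b k)) h)" by (intro li)
  have b2: "bilin sH sH tscale (\<lambda>g k. tens sC sC (act a g) (act b k))" for a b by (intro li)
  let ?Z = "ssum (tspace sC sC (Cf 0) UNIV) (tspace sC sC UNIV (Cf n))"
  have Z: "module.subspace tscale ?Z" by (intro subspace_ssum vector_space_tscale subspace_tspace)
  have l: "tspace sC sC (Cf 0) UNIV \<subseteq> ?Z" and r: "tspace sC sC UNIV (Cf n) \<subseteq> ?Z"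
    by (intro ssum_left ssum_right tspace_zero)+
  have "\<Delta>C (act c h) = C.sw (\<lambda>a b. H.sw (\<lambda>g k. tens sC sC (act a g) (act b k)) h) c"
    by (simp add: C.sw_def H.sw_def comult_act)
  also have "\<dots> \<in> ?Z"
    unfolding C.sw_def
  proof (rule tsum_ssum_mem[OF b subspace_Cf _ Z])
    show "\<Delta>C c \<in> ?Z" using Suc.prems by (simp add: wedge_def)
    show "H.sw (\<lambda>g k. tens sC sC (act x g) (act y k)) h \<in> ?Z" if "x \<in> Cf 0" for x y
    proof -
      have "act x g \<in> Cf 0" for g using that unfolding Cf_0 by (auto simp: iota_mult[symmetric])
      then show ?thesis by (intro subsetD[OF l] H.sw_in_tspace[OF b2] tens_mem) auto
    qed
    show "H.sw (\<lambda>g k. tens sC sC (act x g) (act y k)) h \<in> ?Z" if "y \<in> Cf n" for x y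
      by (intro subsetD[OF r] H.sw_in_tspace[OF b2] tens_mem Suc.IH that) auto
  qed
  finally show ?case by (simp add: wedge_def)
qed

lemma proj_Cf: "c \<in> Cf n \<Longrightarrow> proj c \<in> R \<inter> Cf n"
proof -
  assume c: "c \<in> Cf n"
  have b: "bilin sC sC sC (\<lambda>a b. act a (S (\<pi> b)))" by (intro li)
  have "proj c \<in> Cf n" unfolding proj_def
    by (rule C.sw_mem[OF b subspace_Cf Cf_right[OF c] subspace_Cf]) (rule act_Cf)
  then show ?thesis using proj_coinv by simp
qed

lemma delta_wedge:
  assumes r: "r \<in> R"
  shows "\<delta> r \<in> ssum (tspace sC sC (R \<inter> Cf 0) R) (tspace sC sC R (R \<inter> Cf n)) \<longleftrightarrow> r \<in> Cf (Suc n)"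
proof
  let ?Z = "ssum (tspace sC sC (R \<inter> Cf 0) R) (tspace sC sC R (R \<inter> Cf n))"
  have Z: "module.subspace tscale ?Z" by (intro subspace_ssum vector_space_tscale subspace_tspace)
  have l: "tspace sC sC (R \<inter> Cf 0) R \<subseteq> ?Z" and rr: "tspace sC sC R (R \<inter> Cf n) \<subseteq> ?Z"
    by (intro ssum_left ssum_right tspace_zero)+
  assume "r \<in> Cf (Suc n)"
  then have \<Delta>: "\<Delta>C r \<in> ssum (tspace sC sC (Cf 0) UNIV) (tspace sC sC UNIV (Cf n))" by (simp add: wedge_def)
  have b: "bilin sC sC tscale (\<lambda>x y. tens sC sC x (proj y))"
    and b2: "bilin sC sC tscale (\<lambda>x y. tens sC sC (proj x) (proj y))" by (intro pli)+
  note vs = C.vector_space_axioms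
  \<comment> \<open>Since \<delta> r lies in R \<otimes> R, \<open>proj\<close> may be applied to
    the second leg as well. Thus \<delta> r = (proj \<otimes> proj) \<Delta> r, and
    \<open>proj\<close> sends C_0 and C_n into R \<inter> C_0 and R \<inter> C_n.\<close>
  have "\<delta> r = tsum sC sC (tens sC sC) (\<delta> r)" using tsum_id[OF vs vs delta_UNIV] by simp
  also have "\<dots> = tsum sC sC (\<lambda>x y. tens sC sC x (proj y)) (\<delta> r)"
    by (rule tsum_cong_on[OF bilin_tens[OF vs vs] b subspace_coinv delta_coinv[OF r]]) (simp add: proj_id)
  also have "\<dots> = C.sw (\<lambda>x y. tens sC sC (proj x) (proj y)) r" by (rule tsum_delta[OF b])
  also have "\<dots> \<in> ?Z"
    unfolding C.sw_def
    by (rule tsum_ssum_mem[OF b2 subspace_Cf \<Delta> Z])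
      (intro subsetD[OF l] subsetD[OF rr] tens_mem proj_Cf proj_coinv; assumption)+
  finally show "\<delta> r \<in> ?Z" .
next
  let ?Z = "ssum (tspace sC sC (Cf 0) UNIV) (tspace sC sC UNIV (Cf n))"
  have Z: "module.subspace tscale ?Z" by (intro subspace_ssum vector_space_tscale subspace_tspace)
  have l: "tspace sC sC (Cf 0) UNIV \<subseteq> ?Z" and rr: "tspace sC sC UNIV (Cf n) \<subseteq> ?Z"
    by (intro ssum_left ssum_right tspace_zero)+
  assume "\<delta> r \<in> ssum (tspace sC sC (R \<inter> Cf 0) R) (tspace sC sC R (R \<inter> Cf n))"
  then have d: "\<delta> r \<in> ?Z"
    by (rule subsetD[OF ssum_mono[OF tspace_mono[OF Int_lower2 subset_UNIV] tspace_mono[OF subset_UNIV Int_lower2]]])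
  have b: "bilin sC sC tscale (\<lambda>x y. C.sw (\<lambda>a b. tens sC sC (act x (\<pi> a)) b) y)"
    and b2: "bilin sC sC tscale (\<lambda>a b. tens sC sC (act x (\<pi> a)) b)" for x by (intro pli)+
  have "\<Delta>C r = C.sw (tens sC sC) r" by (simp add: C.sw_tens)
  also have "\<dots> = tsum sC sC (\<lambda>x y. C.sw (\<lambda>a b. tens sC sC (act x (\<pi> a)) b) y) (\<delta> r)"
    by (rule sw_delta[OF bilin_tens]) (rule C.vector_space_axioms)+
  \<comment> \<open>C_0 is stable under H, and C_n is a left coideal, so the reconstruction of
    \<Delta> from \<delta> respects both summands.\<close>
  also have "\<dots> \<in> ?Z"
  proof (rule tsum_ssum_mem[OF b subspace_Cf d Z])
    show "C.sw (\<lambda>a b. tens sC sC (act x (\<pi> a)) b) y \<in> ?Z" if "x \<in> Cf 0" for x y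
      by (intro subsetD[OF l] C.sw_in_tspace[OF b2] tens_mem act_Cf that) simp
    show "C.sw (\<lambda>a b. tens sC sC (act x (\<pi> a)) b) y \<in> ?Z" if "y \<in> Cf n" for x y
      by (intro subsetD[OF rr] C.sw_mem[OF b2 C.subspace_UNIV Cf_left[OF that] subspace_tspace] tens_mem) auto
  qed
  finally show "r \<in> Cf (Suc n)" by (simp add: wedge_def)
qed

section \<open>The simple subcoalgebras of the coinvariants\<close>

lemma iota_one_coinv: "\<iota> 1 \<in> R"
proof -
  have b: "bilin sC sC tscale (\<lambda>x y. tens sC sH x (\<pi> y))" by (intro li)
  have b2: "bilin sH sH tscale (\<lambda>x y. tens sC sH (\<iota> x) y)" by (intro li)
  show ?thesis by (simp add: coinv_def rco_sw sw_iota[OF b] H.sw_one[OF b2] pi_iota)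
qed

lemma iota_one_nonzero: "\<iota> 1 \<noteq> 0"
  using pi_iota[of 1] lin_zero[OF pi_linear] by auto

abbreviation K1 where "K1 \<equiv> range (\<lambda>a. sC a (\<iota> 1))"

text \<open>A coinvariant \<open>\<iota> h\<close> is fixed by \<open>proj\<close>; being also
  \<open>\<iota> 1\<close> acted on by \<open>h\<close>, it is sent by \<open>proj\<close> to the
  multiple of \<open>\<iota> 1\<close> by the counit of \<open>h\<close>.\<close>

lemma coinv_Cf_0: "R \<inter> Cf 0 = K1"
proof
  show "K1 \<subseteq> R \<inter> Cf 0"
    using C.subspace_scale[OF subspace_coinv iota_one_coinv] C.subspace_scale[OF subspace_Cf[of 0]]
    unfolding Cf_0 by auto
  show "R \<inter> Cf 0 \<subseteq> K1"
  proof clarify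
    fix c assume c: "c \<in> R" "c \<in> Cf 0"
    then obtain h where h: "c = \<iota> h" unfolding Cf_0 by auto
    have "c = proj (act (\<iota> 1) h)" using proj_id[OF c(1)] h iota_mult[of 1 h] by simp
    also have "\<dots> = sC (\<epsilon>H h) (\<iota> 1)" by (rule proj_act[OF iota_one_coinv])
    finally show "c \<in> K1" by auto
  qed
qed

lemma delta_eq_zero: "\<delta> c = 0 \<Longrightarrow> c = 0"
proof -
  assume "\<delta> c = 0"
  note vs = C.vector_space_axioms
  have b: "bilin sC sC tscale (\<lambda>x y. C.sw (\<lambda>a b. tens sC sC (act x (\<pi> a)) b) y)" by (intro pli)
  have "\<Delta>C c = 0"
    using sw_delta[OF bilin_tens[OF vs vs], of c] \<open>\<delta> c = 0\<close> by (simp add: C.sw_tens tsum_zero[OF b])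
  then show ?thesis by (rule C.comult_eq_zero)
qed

lemma subspace_K1: "C.subspace K1"
  unfolding coinv_Cf_0[symmetric] by (intro C.subspace_inter subspace_coinv subspace_Cf)

text \<open>\<open>\<iota> 1\<close> is grouplike for \<open>\<delta>\<close>, and a line has no
  proper nonzero subspaces.\<close>

lemma simple_K1: "simple_subcoalgebra sC \<delta> K1"
  unfolding simple_subcoalgebra_def subcoalgebra_def
proof (intro conjI allI impI subspace_K1)
  have i: "\<iota> 1 \<in> K1" by (rule range_eqI[of _ _ 1]) simp
  show "K1 \<noteq> {0}" using i iota_one_nonzero by auto
  have "\<delta> (\<iota> 1) = tens sC sC (\<iota> 1) (\<iota> 1)"
  proof -
    have b: "bilin sH sH tscale (\<lambda>x y. tens sC sC (proj (\<iota> x)) (\<iota> y))" by (intro pli)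
    show ?thesis
      by (simp add: coinv_comult_sw sw_iota[OF bilin_delta] H.sw_one[OF b] proj_id[OF iota_one_coinv])
  qed
  moreover have "lin sC tscale \<delta>" unfolding coinv_comult_sw by (intro pli)
  ultimately have "\<delta> (sC a (\<iota> 1)) = tscale a (tens sC sC (\<iota> 1) (\<iota> 1))" for a by (simp add: lin_scale)
  then show "\<delta> ` K1 \<subseteq> tspace sC sC K1 K1" using tspace_scale[OF tens_mem[OF i i]] by auto
  fix E assume E: "(C.subspace E \<and> \<delta> ` E \<subseteq> tspace sC sC E E) \<and> E \<subseteq> K1"
  show "E = {0} \<or> E = K1"
  proof (cases "E = {0}")
    case False
    then obtain e where "e \<in> E" "e \<noteq> 0" using E C.subspace_0 by blast
    then obtain a where a: "e = sC a (\<iota> 1)" "a \<noteq> 0" using E by auto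
    have "sC b (\<iota> 1) = sC (b / a) e" for b using a by simp
    then have "K1 \<subseteq> E" using E \<open>e \<in> E\<close> by (auto intro: C.subspace_scale)
    then show ?thesis using E by auto
  qed simp
qed

text \<open>
  The spaces \<open>R \<inter> C\<^sub>n\<close> form a coalgebra filtration of \<open>R\<close>; as the filtration \<open>C\<^sub>n\<close> is exhaustive, every
  simple subcoalgebra of \<open>R\<close> meets its bottom term.
\<close>

lemma simple_coinv_unique:
  assumes D: "simple_subcoalgebra sC \<delta> D" and DR: "D \<subseteq> R"
  shows "D = K1"
proof -
  have Ds: "C.subspace D" and D0: "D \<noteq> {0}" and Dd: "\<And>d. d \<in> D \<Longrightarrow> \<delta> d \<in> tspace sC sC D D"
    and simple: "\<And>E. subcoalgebra sC \<delta> E \<Longrightarrow> E \<subseteq> D \<Longrightarrow> E = {0} \<or> E = D"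
    using D by (auto simp: simple_subcoalgebra_def subcoalgebra_def)
  obtain d where d: "d \<in> D" "d \<noteq> 0" using D0 C.subspace_0[OF Ds] by blast
  obtain n0 where "d \<in> Cf n0" using C.corad_filt_exhaustive by blast
  then have "\<exists>x\<in>D \<inter> Cf n0. x \<noteq> 0" using d by blast
  \<comment> \<open>\<open>n\<close> is the least index at which D meets the filtration. If n = Suc
    m, then R \<inter> C_0 and R \<inter> C_m meet D trivially, while \<delta> x lies both in D
    \<otimes> D and in (R \<inter> C_0) \<otimes> R + R \<otimes> (R \<inter> C_m); this forces
    \<delta> x = 0.\<close>
  define n where "n = (LEAST n. \<exists>x\<in>D \<inter> Cf n. x \<noteq> 0)"
  obtain x where x: "x \<in> D" "x \<in> Cf n" "x \<noteq> 0"
    using LeastI[of "\<lambda>n. \<exists>x\<in>D \<inter> Cf n. x \<noteq> 0", OF \<open>\<exists>x\<in>D \<inter> Cf n0. x \<noteq> 0\<close>] by (auto simp: n_def)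
  have below: "D \<inter> (R \<inter> Cf m) = {0}" if "m < n" for m
    using not_less_Least[of m "\<lambda>n. \<exists>x\<in>D \<inter> Cf n. x \<noteq> 0"] that
      C.subspace_0[OF Ds] C.subspace_0[OF subspace_Cf] C.subspace_0[OF subspace_coinv] by (auto simp: n_def)
  have "n = 0"
  proof (rule ccontr)
    assume "n \<noteq> 0"
    then obtain m where m: "n = Suc m" by (cases n) auto
    have "\<delta> x \<in> ssum (tspace sC sC (R \<inter> Cf 0) R) (tspace sC sC R (R \<inter> Cf m))"
      using delta_wedge[of x m] x DR m by auto
    then have "\<delta> x \<in> ssum (tspace sC sC (R \<inter> Cf 0) UNIV) (tspace sC sC UNIV (R \<inter> Cf m))"
      by (rule subsetD[OF ssum_mono[OF tspace_mono[OF order_refl subset_UNIV] tspace_mono[OF subset_UNIV order_refl]]])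
    note t = this
    have RC: "C.subspace (R \<inter> Cf k)" for k by (intro C.subspace_inter subspace_coinv subspace_Cf)
    have "\<delta> x = 0"
      by (rule tensor_disjoint[OF C.vector_space_axioms Ds RC below RC below Dd[OF x(1)] t]) (simp_all add: m)
    then show False using delta_eq_zero x(3) by blast
  qed
  then have "x \<in> K1" using x DR coinv_Cf_0 by auto
  then obtain a where a: "x = sC a (\<iota> 1)" by auto
  have "a \<noteq> 0" using a x(3) by auto
  then have "sC b (\<iota> 1) = sC (b / a) x" for b using a by simp
  then have "K1 \<subseteq> D" using x(1) Ds by (auto intro: C.subspace_scale)
  then show ?thesis using simple[of K1] simple_K1 by (auto simp: simple_subcoalgebra_def)
qed

lemma coradical_coinv: "coradical sC \<delta> R = R \<inter> Cf 0"
proof -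
  have "{D. simple_subcoalgebra sC \<delta> D \<and> D \<subseteq> R} = {K1}"
    using simple_coinv_unique simple_K1 coinv_Cf_0 by blast
  then show ?thesis
    using subspace_K1 unfolding coinv_Cf_0 coradical_def[of _ \<delta>] by simp
qed

lemma corad_filt_coinv: "corad_filt sC \<delta> R n = R \<inter> Cf n"
proof (induction n)
  case (Suc n)
  have "corad_filt sC \<delta> R (Suc n) = {r \<in> R. r \<in> Cf (Suc n)}"
    unfolding corad_filt.simps(2)[of sC \<delta>] wedge_def Suc coradical_coinv using delta_wedge by auto
  then show ?case by auto
qed (simp add: coradical_coinv)

end

section \<open>Bicomodules with a right action\<close>

text \<open>
  The structure of \<open>M\<close> is transported along \<open>g\<close> from a stable subspace of \<open>C\<close>, so that each axiom on \<open>M\<close>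
  is a Sweedler identity in \<open>C\<close>.  With \<open>g\<close> the identity this covers the objects \<open>C\<^sub>n\<close> as well.
\<close>

locale hopf_transport = hopf_splitting sH \<Delta>H \<epsilon>H S sC \<Delta>C \<epsilon>C act \<iota> \<pi>
  for sH :: "'k::field \<Rightarrow> 'h::ring_1 \<Rightarrow> 'h" and \<Delta>H \<epsilon>H S
    and sC :: "'k \<Rightarrow> 'c::ab_group_add \<Rightarrow> 'c" and \<Delta>C \<epsilon>C act \<iota> \<pi> +
  fixes U :: "'c set" and M :: "('k, 'h, 'm::ab_group_add) bicomod" and g :: "'c \<Rightarrow> 'm"
  assumes U_subspace: "C.subspace U"
    and U_left: "c \<in> U \<Longrightarrow> \<Delta>C c \<in> tspace sC sC UNIV U"
    and U_right: "c \<in> U \<Longrightarrow> \<Delta>C c \<in> tspace sC sC U UNIV"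
    and U_act: "c \<in> U \<Longrightarrow> act c h \<in> U"
    and g_linear: "lin sC (scl M) g"
    and g_inj: "inj_on g U"
    and carr_M: "carr M = g ` U"
    and ract_M: "c \<in> U \<Longrightarrow> ract M (g c) h = g (act c h)"
    and lco_M: "c \<in> U \<Longrightarrow> lco M (g c) = C.sw (\<lambda>x y. tens sH (scl M) (\<pi> x) (g y)) c"
    and rco_M: "c \<in> U \<Longrightarrow> rco M (g c) = C.sw (\<lambda>x y. tens (scl M) sH (g x) (\<pi> y)) c"
begin

abbreviation sM where "sM \<equiv> scl M"

lemma vs_M: "vector_space sM" by (rule lin_vs2[OF g_linear])

sublocale M: vector_space sM by (rule vs_M)

lemma subspace_carr: "M.subspace (carr M)"
  unfolding carr_M by (rule subspace_image[OF g_linear U_subspace])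

lemmas gli = lin_comp[OF g_linear] vs_M pli

lemma ex_retraction:
  obtains k where "lin sM sC k" "\<And>y. y \<in> U \<Longrightarrow> k (g y) = y"
proof -
  interpret P: vector_space_pair sC sM ..
  show ?thesis using P.linear_exists_left_inverse_on[OF g_linear U_subspace g_inj] that by blast
qed

text \<open>Through a linear retraction \<open>k\<close> of \<open>g\<close>, an integrand on M
  becomes one on \<open>C\<close>, and the coaction of M unfolds into the comultiplication on U.
  This rule and its mirror image reduce the comodule axioms for M to Sweedler identities in
  \<open>C\<close>.\<close>

lemma tlift_lco:
  assumes F': "bilin sH sC sU F'" and c: "c \<in> U" and F: "\<And>h y. y \<in> U \<Longrightarrow> F h (g y) = F' h y"
  shows "tlift sH sM UNIV (carr M) F (lco M (g c)) = C.sw (\<lambda>x y. F' (\<pi> x) y) c"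
proof -
  obtain k where k: "lin sM sC k" "\<And>y. y \<in> U \<Longrightarrow> k (g y) = y" by (rule ex_retraction) blast
  note fl = bilin_left[OF F'] bilin_right[OF F'] lin_comp[OF k(1)] gli
  have b: "bilin sH sM sU (\<lambda>h m. F' h (k m))" by (intro fl)
  have b2: "bilin sC sC tscale (\<lambda>x y. tens sH sM (\<pi> x) (g y))" by (intro fl)
  have b3: "bilin sC sC sU (\<lambda>x y. F' (\<pi> x) (k (g y)))" "bilin sC sC sU (\<lambda>x y. F' (\<pi> x) y)" by (intro fl)+
  have m: "lco M (g c) \<in> tspace sH sM UNIV (carr M)"
    unfolding lco_M[OF c]
    by (rule C.sw_mem[OF b2 C.subspace_UNIV U_left[OF c] subspace_tspace]) (auto simp: carr_M tens_mem)
  have "tlift sH sM UNIV (carr M) F (lco M (g c)) = tsum sH sM (\<lambda>h m. F' h (k m)) (lco M (g c))"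
    by (rule tlift_eq_tsum[OF b H.subspace_UNIV subspace_carr _ m]) (auto simp: carr_M F k(2))
  also have "\<dots> = C.sw (\<lambda>x y. F' (\<pi> x) (k (g y))) c"
    unfolding lco_M[OF c] by (subst C.tsum_sw[OF b b2]) (auto simp: tens_mem tsum_tens[OF b])
  also have "\<dots> = C.sw (\<lambda>x y. F' (\<pi> x) y) c"
    unfolding C.sw_def by (rule tsum_cong_on[OF b3 C.subspace_UNIV U_left[OF c]]) (simp add: k(2))
  finally show ?thesis .
qed

lemma tlift_rco:
  assumes F': "bilin sC sH sU F'" and c: "c \<in> U" and F: "\<And>h y. y \<in> U \<Longrightarrow> F (g y) h = F' y h"
  shows "tlift sM sH (carr M) UNIV F (rco M (g c)) = C.sw (\<lambda>x y. F' x (\<pi> y)) c"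
proof -
  obtain k where k: "lin sM sC k" "\<And>y. y \<in> U \<Longrightarrow> k (g y) = y" by (rule ex_retraction) blast
  note fl = bilin_left[OF F'] bilin_right[OF F'] lin_comp[OF k(1)] gli
  have b: "bilin sM sH sU (\<lambda>m h. F' (k m) h)" by (intro fl)
  have b2: "bilin sC sC tscale (\<lambda>x y. tens sM sH (g x) (\<pi> y))" by (intro fl)
  have b3: "bilin sC sC sU (\<lambda>x y. F' (k (g x)) (\<pi> y))" "bilin sC sC sU (\<lambda>x y. F' x (\<pi> y))" by (intro fl)+
  have m: "rco M (g c) \<in> tspace sM sH (carr M) UNIV"
    unfolding rco_M[OF c]
    by (rule C.sw_mem[OF b2 U_subspace U_right[OF c] subspace_tspace]) (auto simp: carr_M tens_mem)
  have "tlift sM sH (carr M) UNIV F (rco M (g c)) = tsum sM sH (\<lambda>m h. F' (k m) h) (rco M (g c))"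
    by (rule tlift_eq_tsum[OF b subspace_carr H.subspace_UNIV _ m]) (auto simp: carr_M F k(2))
  also have "\<dots> = C.sw (\<lambda>x y. F' (k (g x)) (\<pi> y)) c"
    unfolding rco_M[OF c] by (subst C.tsum_sw[OF b b2]) (auto simp: tens_mem tsum_tens[OF b])
  also have "\<dots> = C.sw (\<lambda>x y. F' x (\<pi> y)) c"
    unfolding C.sw_def by (rule tsum_cong_on[OF b3 U_subspace U_right[OF c]]) (simp add: k(2))
  finally show ?thesis .
qed

lemma lin_on_transport:
  assumes A: "lin sC sU A" and f: "\<And>c. c \<in> U \<Longrightarrow> f (g c) = A c"
  shows "lin_on sM sU (carr M) f"
  unfolding lin_on_def carr_M
proof (intro conjI allI ballI)
  fix x y assume "x \<in> g ` U" "y \<in> g ` U"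
  then obtain c d where cd: "c \<in> U" "d \<in> U" "x = g c" "y = g d" by auto
  then have "f (g (c + d)) = A (c + d)" using C.subspace_add[OF U_subspace] by (intro f) auto
  then show "f (x + y) = f x + f y" using cd by (simp add: lin_add[OF g_linear] lin_add[OF A] f)
next
  fix a x assume "x \<in> g ` U"
  then obtain c where c: "c \<in> U" "x = g c" by auto
  then have "f (g (sC a c)) = A (sC a c)" using C.subspace_scale[OF U_subspace] by (intro f) auto
  then show "f (sM a x) = sU a (f x)" using c by (simp add: lin_scale[OF g_linear] lin_scale[OF A] f)
qed

lemma left_comodule_M: "left_comodule sH \<Delta>H \<epsilon>H sM (carr M) (lco M)"
  unfolding left_comodule_def
proof (intro conjI ballI vs_M subspace_carr)
  have b2: "bilin sC sC tscale (\<lambda>x y. tens sH sM (\<pi> x) (g y))" by (intro gli)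
  show "lin_on sM tscale (carr M) (lco M)"
    by (rule lin_on_transport[OF C.lin_sw[OF b2 lin_id[OF C.vector_space_axioms]]]) (rule lco_M)
  show "lco M ` carr M \<subseteq> tspace sH sM UNIV (carr M)"
  proof (unfold carr_M, clarify)
    fix c assume c: "c \<in> U"
    show "lco M (g c) \<in> tspace sH sM UNIV (g ` U)" unfolding lco_M[OF c]
      by (rule C.sw_mem[OF b2 C.subspace_UNIV U_left[OF c] subspace_tspace]) (auto simp: tens_mem)
  qed
  fix v assume "v \<in> carr M"
  then obtain c where c: "c \<in> U" "v = g c" by (auto simp: carr_M)
  show "tlift sH sM UNIV (carr M) (\<lambda>h. sM (\<epsilon>H h)) (lco M v) = v"
    unfolding c(2)
    by (subst tlift_lco[where sU = sM and F' = "\<lambda>h y. sM (\<epsilon>H h) (g y)", OF _ c(1)])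
      (intro gli, simp, simp add: counit_pi C.sw_counit_left[OF g_linear])
  let ?T = "tens tscale sM" and ?t = "tens sH sH"
  have "tlift sH sM UNIV (carr M) (\<lambda>h w. tsum sH sH (\<lambda>a b. ?T (?t a b) w) (\<Delta>H h)) (lco M v) =
      C.sw (\<lambda>x y. H.sw (\<lambda>a b. ?T (?t a b) (g y)) (\<pi> x)) c"
    unfolding c(2) H.sw_def[symmetric]
    by (rule tlift_lco[where sU = tscale and F' = "\<lambda>h y. H.sw (\<lambda>a b. ?T (?t a b) (g y)) h", OF _ c(1)])
      (intro gli, simp)
  also have "\<dots> = C.sw (\<lambda>x y. C.sw (\<lambda>a b. ?T (?t (\<pi> a) (\<pi> b)) (g y)) x) c"
    by (subst sw_pi[where sU = tscale]) (intro gli refl)+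
  also have "\<dots> = C.sw (\<lambda>x y. C.sw (\<lambda>a b. ?T (?t (\<pi> x) (\<pi> a)) (g b)) y) c"
    by (rule C.sw_coassoc[where sU = tscale]) (intro gli)+
  also have "\<dots> = tlift sH sM UNIV (carr M) (\<lambda>h w. tlift sH sM UNIV (carr M) (\<lambda>k u. ?T (?t h k) u) (lco M w)) (lco M v)"
    unfolding c(2)
  proof (rule tlift_lco[where sU = tscale and F' = "\<lambda>h y. C.sw (\<lambda>a b. ?T (?t h (\<pi> a)) (g b)) y", OF _ c(1), symmetric])
    show "tlift sH sM UNIV (carr M) (\<lambda>k u. ?T (?t h k) u) (lco M (g y)) = C.sw (\<lambda>a b. ?T (?t h (\<pi> a)) (g b)) y"
      if "y \<in> U" for h y
      by (rule tlift_lco[where sU = tscale and F' = "\<lambda>k u. ?T (?t h k) (g u)", OF _ that]) (intro gli, simp)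
  qed (intro gli)
  finally show "tlift sH sM UNIV (carr M) (\<lambda>h w. tsum sH sH (\<lambda>a b. ?T (?t a b) w) (\<Delta>H h)) (lco M v) =
    tlift sH sM UNIV (carr M) (\<lambda>h w. tlift sH sM UNIV (carr M) (\<lambda>k u. ?T (?t h k) u) (lco M w)) (lco M v)" .
qed

lemma right_comodule_M: "right_comodule sH \<Delta>H \<epsilon>H sM (carr M) (rco M)"
  unfolding right_comodule_def
proof (intro conjI ballI vs_M subspace_carr)
  have b2: "bilin sC sC tscale (\<lambda>x y. tens sM sH (g x) (\<pi> y))" by (intro gli)
  show "lin_on sM tscale (carr M) (rco M)"
    by (rule lin_on_transport[OF C.lin_sw[OF b2 lin_id[OF C.vector_space_axioms]]]) (rule rco_M)
  show "rco M ` carr M \<subseteq> tspace sM sH (carr M) UNIV"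
  proof (unfold carr_M, clarify)
    fix c assume c: "c \<in> U"
    show "rco M (g c) \<in> tspace sM sH (g ` U) UNIV" unfolding rco_M[OF c]
      by (rule C.sw_mem[OF b2 U_subspace U_right[OF c] subspace_tspace]) (auto simp: tens_mem)
  qed
  fix v assume "v \<in> carr M"
  then obtain c where c: "c \<in> U" "v = g c" by (auto simp: carr_M)
  show "tlift sM sH (carr M) UNIV (\<lambda>w h. sM (\<epsilon>H h) w) (rco M v) = v"
    unfolding c(2)
    by (subst tlift_rco[where sU = sM and F' = "\<lambda>y h. sM (\<epsilon>H h) (g y)", OF _ c(1)])
      (intro gli, simp, simp add: counit_pi C.sw_counit_right[OF g_linear])
  let ?T = "tens tscale sH" and ?t = "tens sM sH"
  have "tlift sM sH (carr M) UNIV (\<lambda>w h. tlift sM sH (carr M) UNIV (\<lambda>u k. ?T (?t u k) h) (rco M w)) (rco M v) =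
      C.sw (\<lambda>x y. C.sw (\<lambda>a b. ?T (?t (g a) (\<pi> b)) (\<pi> y)) x) c"
    unfolding c(2)
  proof (rule tlift_rco[where sU = tscale and F' = "\<lambda>y h. C.sw (\<lambda>a b. ?T (?t (g a) (\<pi> b)) h) y", OF _ c(1)])
    show "tlift sM sH (carr M) UNIV (\<lambda>u k. ?T (?t u k) h) (rco M (g y)) = C.sw (\<lambda>a b. ?T (?t (g a) (\<pi> b)) h) y"
      if "y \<in> U" for h y
      by (rule tlift_rco[where sU = tscale and F' = "\<lambda>u k. ?T (?t (g u) k) h", OF _ that]) (intro gli, simp)
  qed (intro gli)
  also have "\<dots> = C.sw (\<lambda>x y. C.sw (\<lambda>a b. ?T (?t (g x) (\<pi> a)) (\<pi> b)) y) c"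
    by (rule C.sw_coassoc[where sU = tscale]) (intro gli)+
  also have "\<dots> = C.sw (\<lambda>x y. H.sw (\<lambda>a b. ?T (?t (g x) a) b) (\<pi> y)) c"
    by (subst sw_pi[where sU = tscale]) (intro gli refl)+
  also have "\<dots> = tlift sM sH (carr M) UNIV (\<lambda>w h. tsum sH sH (\<lambda>a b. ?T (?t w a) b) (\<Delta>H h)) (rco M v)"
    unfolding c(2) H.sw_def[symmetric]
    by (rule tlift_rco[where sU = tscale and F' = "\<lambda>y h. H.sw (\<lambda>a b. ?T (?t (g y) a) b) h", OF _ c(1), symmetric])
      (intro gli, simp)
  finally show "tlift sM sH (carr M) UNIV (\<lambda>w h. tlift sM sH (carr M) UNIV (\<lambda>u k. ?T (?t u k) h) (rco M w)) (rco M v) =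
      tlift sM sH (carr M) UNIV (\<lambda>w h. tsum sH sH (\<lambda>a b. ?T (?t w a) b) (\<Delta>H h)) (rco M v)" .
qed

lemma bicomodule_M:
  assumes "m \<in> carr M"
  shows "tlift sH sM UNIV (carr M) (\<lambda>h v. tlift sM sH (carr M) UNIV
        (\<lambda>w k. tens tscale sH (tens sH sM h w) k) (rco M v)) (lco M m) =
      tlift sM sH (carr M) UNIV (\<lambda>v k. tlift sH sM UNIV (carr M)
        (\<lambda>h w. tens tscale sH (tens sH sM h w) k) (lco M v)) (rco M m)"
proof -
  obtain c where c: "c \<in> U" "m = g c" using assms by (auto simp: carr_M)
  let ?T = "tens tscale sH" and ?t = "tens sH sM"
  have "tlift sH sM UNIV (carr M) (\<lambda>h v. tlift sM sH (carr M) UNIV (\<lambda>w k. ?T (?t h w) k) (rco M v)) (lco M m) =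
      C.sw (\<lambda>x y. C.sw (\<lambda>a b. ?T (?t (\<pi> x) (g a)) (\<pi> b)) y) c"
    unfolding c(2)
  proof (rule tlift_lco[where sU = tscale and F' = "\<lambda>h y. C.sw (\<lambda>a b. ?T (?t h (g a)) (\<pi> b)) y", OF _ c(1)])
    show "tlift sM sH (carr M) UNIV (\<lambda>w k. ?T (?t h w) k) (rco M (g y)) = C.sw (\<lambda>a b. ?T (?t h (g a)) (\<pi> b)) y"
      if "y \<in> U" for h y
      by (rule tlift_rco[where sU = tscale and F' = "\<lambda>w k. ?T (?t h (g w)) k", OF _ that]) (intro gli, simp)
  qed (intro gli)
  also have "\<dots> = C.sw (\<lambda>x y. C.sw (\<lambda>a b. ?T (?t (\<pi> a) (g b)) (\<pi> y)) x) c"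
    by (rule C.sw_coassoc[where sU = tscale, symmetric]) (intro gli)+
  also have "\<dots> = tlift sM sH (carr M) UNIV (\<lambda>v k. tlift sH sM UNIV (carr M) (\<lambda>h w. ?T (?t h w) k) (lco M v)) (rco M m)"
    unfolding c(2)
  proof (rule tlift_rco[where sU = tscale and F' = "\<lambda>y k. C.sw (\<lambda>a b. ?T (?t (\<pi> a) (g b)) k) y", OF _ c(1), symmetric])
    show "tlift sH sM UNIV (carr M) (\<lambda>h w. ?T (?t h w) k) (lco M (g y)) = C.sw (\<lambda>a b. ?T (?t (\<pi> a) (g b)) k) y"
      if "y \<in> U" for k y
      by (rule tlift_lco[where sU = tscale and F' = "\<lambda>h w. ?T (?t h (g w)) k", OF _ that]) (intro gli, simp)
  qed (intro gli)
  finally show ?thesis .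
qed

lemma lco_ract:
  assumes "m \<in> carr M"
  shows "lco M (ract M m h) = tlift sH sM UNIV (carr M) (\<lambda>a v. tsum sH sH
        (\<lambda>g k. tens sH sM (a * g) (ract M v k)) (\<Delta>H h)) (lco M m)"
proof -
  obtain c where c: "c \<in> U" "m = g c" using assms by (auto simp: carr_M)
  have "lco M (ract M m h) = C.sw (\<lambda>x y. tens sH sM (\<pi> x) (g y)) (act c h)"
    unfolding c(2) ract_M[OF c(1)] by (rule lco_M[OF U_act[OF c(1)]])
  also have "\<dots> = C.sw (\<lambda>x y. H.sw (\<lambda>p q. tens sH sM (\<pi> x * p) (g (act y q))) h) c"
    by (subst sw_act[where sU = tscale]) (intro gli, simp add: pi_act)
  also have "\<dots> = tlift sH sM UNIV (carr M) (\<lambda>a v. H.sw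
        (\<lambda>g k. tens sH sM (a * g) (ract M v k)) h) (lco M m)"
    unfolding c(2)
    by (rule tlift_lco[where sU = tscale and F' = "\<lambda>a y. H.sw (\<lambda>p q. tens sH sM (a * p) (g (act y q))) h", OF _ c(1), symmetric])
      (intro gli, simp add: ract_M)
  finally show ?thesis by (simp add: H.sw_def)
qed

lemma rco_ract:
  assumes "m \<in> carr M"
  shows "rco M (ract M m h) = tlift sM sH (carr M) UNIV (\<lambda>v a. tsum sH sH
        (\<lambda>g k. tens sM sH (ract M v g) (a * k)) (\<Delta>H h)) (rco M m)"
proof -
  obtain c where c: "c \<in> U" "m = g c" using assms by (auto simp: carr_M)
  have "rco M (ract M m h) = C.sw (\<lambda>x y. tens sM sH (g x) (\<pi> y)) (act c h)"
    unfolding c(2) ract_M[OF c(1)] by (rule rco_M[OF U_act[OF c(1)]])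
  also have "\<dots> = C.sw (\<lambda>x y. H.sw (\<lambda>p q. tens sM sH (g (act x p)) (\<pi> y * q)) h) c"
    by (subst sw_act[where sU = tscale]) (intro gli, simp add: pi_act)
  also have "\<dots> = tlift sM sH (carr M) UNIV (\<lambda>v a. H.sw
        (\<lambda>g k. tens sM sH (ract M v g) (a * k)) h) (rco M m)"
    unfolding c(2)
    by (rule tlift_rco[where sU = tscale and F' = "\<lambda>y a. H.sw (\<lambda>p q. tens sM sH (g (act y p)) (a * q)) h", OF _ c(1), symmetric])
      (intro gli, simp add: ract_M)
  finally show ?thesis by (simp add: H.sw_def)
qed

lemma bilin_on_ract: "bilin_on sM sH sM (carr M) UNIV (ract M)"
  unfolding bilin_on_def
proof (intro conjI ballI)
  fix x assume "x \<in> carr M"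
  then obtain c where c: "c \<in> U" "x = g c" by (auto simp: carr_M)
  have "lin sH sM (\<lambda>h. g (act c h))" by (intro gli)
  then show "lin_on sH sM UNIV (ract M x)"
    unfolding c(2) lin_on_def ract_M[OF c(1)] using lin_imp_lin_on[of sH sM _ UNIV] by (simp add: lin_on_def)
next
  fix h
  have "lin sC sM (\<lambda>c. g (act c h))" by (intro gli)
  then show "lin_on sM sM (carr M) (\<lambda>x. ract M x h)"
    by (rule lin_on_transport) (rule ract_M)
qed

theorem HMHH_object_M: "HMHH_object sH \<Delta>H \<epsilon>H M"
  unfolding HMHH_object_def
  by (intro conjI left_comodule_M right_comodule_M ballI bicomodule_M bilin_on_ract allI lco_ract rco_ract)
    (auto simp: carr_M ract_M U_act act_one act_act)

end

lemma HMHH_morphism_transport: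
  assumes "hopf_transport sH \<Delta>H \<epsilon>H S sC \<Delta>C \<epsilon>C act \<iota> \<pi> U M g" "hopf_transport sH \<Delta>H \<epsilon>H S sC \<Delta>C \<epsilon>C act \<iota> \<pi> U N g'"
    and f: "\<And>c. c \<in> U \<Longrightarrow> f (g c) = g' c"
  shows "HMHH_morphism sH M N f"
proof -
  interpret M: hopf_transport sH \<Delta>H \<epsilon>H S sC \<Delta>C \<epsilon>C act \<iota> \<pi> U M g by fact
  interpret N: hopf_transport sH \<Delta>H \<epsilon>H S sC \<Delta>C \<epsilon>C act \<iota> \<pi> U N g' by fact
  show ?thesis
    unfolding HMHH_morphism_def left_colinear_def
  proof (intro conjI ballI allI)
    show "lin_on (scl M) (scl N) (carr M) f" by (rule M.lin_on_transport[OF N.g_linear f])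
    show "f ` carr M \<subseteq> carr N" by (auto simp: M.carr_M N.carr_M f)
    fix m assume "m \<in> carr M"
    then obtain c where c: "c \<in> U" "m = g c" by (auto simp: M.carr_M)
    show "f (ract M m h) = ract N (f m) h" for h
      by (simp add: c f M.ract_M N.ract_M M.U_act)
    show "lco N (f m) = tlift sH (scl M) UNIV (carr M) (\<lambda>h w. tens sH (scl N) h (f w)) (lco M m)"
      unfolding c(2) f[OF c(1)] N.lco_M[OF c(1)]
      by (rule M.tlift_lco[where sU = tscale and F' = "\<lambda>h y. tens sH (scl N) h (g' y)", OF _ c(1), symmetric])
        (intro N.gli, simp add: f)
    show "rco N (f m) = tlift (scl M) sH (carr M) UNIV (\<lambda>w h. tens (scl N) sH (f w) h) (rco M m)"
      unfolding c(2) f[OF c(1)] N.rco_M[OF c(1)]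
      by (rule M.tlift_rco[where sU = tscale and F' = "\<lambda>y h. tens (scl N) sH (g' y) h", OF _ c(1), symmetric])
        (intro N.gli, simp add: f)
  qed
qed

text \<open>Both objects are copies of the same U, so going back along one transport and forth along
  the other gives mutually inverse maps, each intertwining the two structures.\<close>

lemma HMHH_isomorphic_transport:
  assumes M: "hopf_transport sH \<Delta>H \<epsilon>H S sC \<Delta>C \<epsilon>C act \<iota> \<pi> U M g"
    and N: "hopf_transport sH \<Delta>H \<epsilon>H S sC \<Delta>C \<epsilon>C act \<iota> \<pi> U N g'"
  shows "HMHH_isomorphic sH \<Delta>H \<epsilon>H M N"
proof -
  interpret M: hopf_transport sH \<Delta>H \<epsilon>H S sC \<Delta>C \<epsilon>C act \<iota> \<pi> U M g by fact
  interpret N: hopf_transport sH \<Delta>H \<epsilon>H S sC \<Delta>C \<epsilon>C act \<iota> \<pi> U N g' by fact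
  obtain k where k: "\<And>c. c \<in> U \<Longrightarrow> k (g c) = c" by (rule M.ex_retraction) blast
  obtain k' where k': "\<And>c. c \<in> U \<Longrightarrow> k' (g' c) = c" by (rule N.ex_retraction) blast
  have "HMHH_morphism sH M N (\<lambda>m. g' (k m))" "HMHH_morphism sH N M (\<lambda>n. g (k' n))"
    by (rule HMHH_morphism_transport[OF M N] HMHH_morphism_transport[OF N M], simp add: k k')+
  moreover have "\<forall>m\<in>carr M. g (k' (g' (k m))) = m" "\<forall>n\<in>carr N. g' (k (g (k' n))) = n"
    by (auto simp: M.carr_M N.carr_M k k')
  ultimately show ?thesis
    unfolding HMHH_isomorphic_def using M.HMHH_object_M N.HMHH_object_M by blast
qed

section \<open>The filtration of \<open>C\<close> as a smash coproduct\<close>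

context hopf_splitting
begin

lemma Cf_transport:
  assumes g: "lin sC (scl M) g" "inj_on g (Cf n)" "carr M = g ` Cf n"
    and ract: "\<And>c h. c \<in> Cf n \<Longrightarrow> ract M (g c) h = g (act c h)"
    and lco: "\<And>c. c \<in> Cf n \<Longrightarrow> lco M (g c) = C.sw (\<lambda>x y. tens sH (scl M) (\<pi> x) (g y)) c"
    and rco: "\<And>c. c \<in> Cf n \<Longrightarrow> rco M (g c) = C.sw (\<lambda>x y. tens (scl M) sH (g x) (\<pi> y)) c"
  shows "hopf_transport sH \<Delta>H \<epsilon>H S sC \<Delta>C \<epsilon>C act \<iota> \<pi> (Cf n) M g"
  by (intro hopf_transport.intro hopf_transport_axioms.intro hopf_splitting_axioms subspace_Cf
      Cf_left Cf_right act_Cf assms)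

lemma sub_bicomod_transport:
  "hopf_transport sH \<Delta>H \<epsilon>H S sC \<Delta>C \<epsilon>C act \<iota> \<pi> (Cf n) (sub_bicomod sH sC \<Delta>C act \<pi> (Cf n)) (\<lambda>c. c)"
  by (rule Cf_transport)
    (simp_all add: sub_bicomod_def lin_id C.vector_space_axioms lco_sw rco_sw inj_on_def)

definition smash :: "'c \<Rightarrow> ('c, 'h, 'k) tensor"
  where "smash c = C.sw (\<lambda>a b. tens sC sH (proj a) (\<pi> b)) c"

lemma lin_smash: "lin sV sC g \<Longrightarrow> lin sV tscale (\<lambda>x. smash (g x))"
  unfolding smash_def by (intro pli; assumption)

lemmas sli = lin_smash pli

text \<open>Coinvariance removes \<pi>(r_2) and leaves proj(r h_1) \<otimes> h_2, which is r
  \<otimes> h by \<open>proj_act\<close> and the counit. With \<open>tsum_act_smash\<close> this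
  makes \<open>smash\<close> and the action inverse to each other.\<close>

lemma smash_act:
  assumes r: "r \<in> R"
  shows "smash (act r h) = tens sC sH r h"
proof -
  let ?t = "tens sC sH"
  have "smash (act r h) = C.sw (\<lambda>a b. H.sw (\<lambda>g k. ?t (proj (act a g)) (\<pi> b * k)) h) r"
    unfolding smash_def by (subst sw_act[where sU = tscale]) (intro pli, simp add: pi_act)
  also have "\<dots> = H.sw (\<lambda>g k. C.sw (\<lambda>a b. ?t (proj (act a g)) (\<pi> b * k)) r) h"
    by (rule sw_swap_CH[where sU = tscale]) (intro pli)+
  also have "\<dots> = H.sw (\<lambda>g k. ?t (proj (act r g)) k) h"
    by (subst coinv_sw[OF r, where sU = tscale]) (intro pli, simp)
  also have "\<dots> = H.sw (\<lambda>g k. tscale (\<epsilon>H g) (?t r k)) h"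
  proof -
    have l: "lin sC tscale (\<lambda>x. ?t x k)" for k by (intro pli)
    show ?thesis by (simp add: proj_act[OF r] lin_scale[OF l])
  qed
  also have "\<dots> = ?t r h"
    by (rule H.sw_counit_left[where sU = tscale]) (intro pli)
  finally show ?thesis .
qed

lemma tsum_act_smash: "tsum sC sH act (smash c) = c"
proof -
  have b: "bilin sC sC tscale (\<lambda>a b. tens sC sH (proj a) (\<pi> b))" by (intro pli)
  show ?thesis unfolding smash_def
    by (subst C.tsum_sw[OF bilin_act b]) (simp_all add: tens_mem tsum_tens[OF bilin_act] proj_split)
qed

lemma smash_Cf: "c \<in> Cf n \<Longrightarrow> smash c \<in> tspace sC sH (R \<inter> Cf n) UNIV"
proof -
  assume c: "c \<in> Cf n"
  have b: "bilin sC sC tscale (\<lambda>a b. tens sC sH (proj a) (\<pi> b))" by (intro pli)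
  show ?thesis unfolding smash_def
    by (rule C.sw_mem[OF b subspace_Cf Cf_right[OF c] subspace_tspace]) (use proj_Cf in \<open>auto intro: tens_mem\<close>)
qed

lemma smash_image: "smash ` Cf n = tspace sC sH (R \<inter> Cf n) UNIV"
proof
  show "smash ` Cf n \<subseteq> tspace sC sH (R \<inter> Cf n) UNIV" using smash_Cf by auto
  show "tspace sC sH (R \<inter> Cf n) UNIV \<subseteq> smash ` Cf n"
  proof
    fix t assume t: "t \<in> tspace sC sH (R \<inter> Cf n) UNIV"
    have "smash (tsum sC sH act t) = t \<and> tsum sC sH act t \<in> Cf n"
      using C.vector_space_axioms H.vector_space_axioms C.subspace_inter[OF subspace_coinv subspace_Cf] t
    proof (induction rule: tspace_induct)
      case zero
      show ?case
        using lin_zero[OF lin_smash[OF lin_id[OF C.vector_space_axioms]]] C.subspace_0[OF subspace_Cf]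
        by (simp add: tsum_zero[OF bilin_act])
    next
      case (add x y u)
      then show ?case
        using lin_add[OF lin_smash[OF lin_id[OF C.vector_space_axioms]]]
        by (simp add: tsum_add[OF bilin_act] tsum_tens[OF bilin_act] tens_mem tspace_UNIV smash_act
            C.subspace_add[OF subspace_Cf] act_Cf)
    qed
    then show "t \<in> smash ` Cf n" by (metis imageI)
  qed
qed

text \<open>Since \<Delta> c lies in C_n \<otimes> C and \<open>proj\<close> preserves C_n,
  \<open>proj_split\<close> expresses \<open>c\<close> through products of elements of R \<inter>
  C_n with elements of H. Identities on C_n need only be checked on such products, where
  \<open>smash\<close> is explicit.\<close>

lemma eq_on_Cf:
  assumes A: "lin sC sU A" and B: "lin sC sU B" and c: "c \<in> Cf n"
    and eq: "\<And>r h. r \<in> R \<Longrightarrow> r \<in> Cf n \<Longrightarrow> A (act r h) = B (act r h)"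
  shows "A c = B c"
proof -
  have bs: "bilin sC sC sC (\<lambda>a b. act (proj a) (\<pi> b))" by (intro pli)
  have bA: "bilin sC sC sU (\<lambda>a b. A (act (proj a) (\<pi> b)))" by (intro lin_comp[OF A] pli)
  have bB: "bilin sC sC sU (\<lambda>a b. B (act (proj a) (\<pi> b)))" by (intro lin_comp[OF B] pli)
  have "A c = C.sw (\<lambda>a b. A (act (proj a) (\<pi> b))) c"
    using C.sw_comp[OF bs A, of c] by (simp add: proj_split)
  also have "\<dots> = C.sw (\<lambda>a b. B (act (proj a) (\<pi> b))) c"
    unfolding C.sw_def by (rule tsum_cong_on[OF bA bB subspace_Cf Cf_right[OF c]]) (use proj_Cf eq in auto)
  also have "\<dots> = B c"
    using C.sw_comp[OF bs B, of c] by (simp add: proj_split)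
  finally show ?thesis .
qed

lemma smash_UNIV: "smash c \<in> tspace sC sH UNIV UNIV"
proof -
  have b: "bilin sC sC tscale (\<lambda>a b. tens sC sH (proj a) (\<pi> b))" by (intro pli)
  show ?thesis unfolding smash_def by (rule C.sw_in_tspace[OF b]) (simp add: tens_mem)
qed

lemma lin_tsum_smash: "bilin sC sH sU f \<Longrightarrow> lin sC sU (\<lambda>c. tsum sC sH f (smash c))"
  by (rule lin_tsum[OF _ lin_smash[OF lin_id] smash_UNIV]) (auto intro: C.vector_space_axioms)

lemma smash_bicomod_transport:
  "hopf_transport sH \<Delta>H \<epsilon>H S sC \<Delta>C \<epsilon>C act \<iota> \<pi> (Cf n)
    (smash_bicomod sH \<Delta>H sC \<Delta>C \<pi> (corad_filt sC \<delta> R n)) smash" (is "hopf_transport _ _ _ _ _ _ _ _ _ _ _ ?M _")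
proof (rule Cf_transport)
  have lco: "lco ?M t = tsum sC sH (\<lambda>r h. tsum sH sC (\<lambda>a c. H.sw (\<lambda>g k. tens sH tscale (a * g) (tens sC sH c k)) h) (lcoact r)) t"
    and rco: "rco ?M t = tsum sC sH (\<lambda>r h. H.sw (\<lambda>g k. tens tscale sH (tens sC sH r g) k) h) t"
    and ract: "ract ?M t k = tsum sC sH (\<lambda>r h. tens sC sH r (h * k)) t"
    and scl: "scl ?M = tscale" and carr: "carr ?M = tspace sC sH (R \<inter> Cf n) UNIV" for t k
    by (simp_all add: smash_bicomod_def H.sw_def corad_filt_coinv)
  have ls: "lin sC tscale smash" by (rule lin_smash[OF lin_id[OF C.vector_space_axioms]])
  show "lin sC (scl ?M) smash" unfolding scl by (rule ls)
  show "inj_on smash (Cf n)" by (rule inj_on_inverseI) (rule tsum_act_smash)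
  show "carr ?M = smash ` Cf n" by (simp add: carr smash_image)
  fix c assume c: "c \<in> Cf n"
  show "ract ?M (smash c) k = smash (act c k)" for k
  proof -
    have b: "bilin sC sH tscale (\<lambda>r h. tens sC sH r (h * k))" by (intro sli)
    show ?thesis
      unfolding ract
    proof (rule eq_on_Cf[OF lin_tsum_smash[OF b] _ c])
      show "lin sC tscale (\<lambda>c. smash (act c k))" by (intro sli)
      show "tsum sC sH (\<lambda>r h. tens sC sH r (h * k)) (smash (act r h)) = smash (act (act r h) k)" if "r \<in> R" for r h
        by (simp add: smash_act[OF that] act_act tsum_tens[OF b])
    qed
  qed
  show "rco ?M (smash c) = C.sw (\<lambda>x y. tens (scl ?M) sH (smash x) (\<pi> y)) c"
  proof -
    let ?T = "tens tscale sH"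
    have b: "bilin sC sH tscale (\<lambda>r h. H.sw (\<lambda>g k. ?T (tens sC sH r g) k) h)" by (intro sli)
    show ?thesis
      unfolding rco scl
    proof (rule eq_on_Cf[OF lin_tsum_smash[OF b] _ c])
      show "lin sC tscale (\<lambda>c. C.sw (\<lambda>x y. ?T (smash x) (\<pi> y)) c)" by (intro sli)
      fix r h assume r: "r \<in> R"
      have "C.sw (\<lambda>x y. ?T (smash x) (\<pi> y)) (act r h) = C.sw (\<lambda>x y. H.sw (\<lambda>g k. ?T (smash (act x g)) (\<pi> y * k)) h) r"
        by (subst sw_act[where sU = tscale]) (intro sli, simp add: pi_act)
      also have "\<dots> = H.sw (\<lambda>g k. C.sw (\<lambda>x y. ?T (smash (act x g)) (\<pi> y * k)) r) h"
        by (rule sw_swap_CH[where sU = tscale]) (intro sli)+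
      also have "\<dots> = H.sw (\<lambda>g k. ?T (smash (act r g)) k) h"
        by (subst coinv_sw[OF r, where sU = tscale]) (intro sli, simp)
      finally show "tsum sC sH (\<lambda>r h. H.sw (\<lambda>g k. ?T (tens sC sH r g) k) h) (smash (act r h)) =
          C.sw (\<lambda>x y. ?T (smash x) (\<pi> y)) (act r h)"
        by (simp add: smash_act[OF r] tsum_tens[OF b])
    qed
  qed
  show "lco ?M (smash c) = C.sw (\<lambda>x y. tens sH (scl ?M) (\<pi> x) (smash y)) c"
  proof -
    let ?T = "tens sH tscale"
    have b0: "bilin sH sC tscale (\<lambda>a c. H.sw (\<lambda>g k. ?T (a * g) (tens sC sH c k)) h)" for h by (intro sli)
    have b1: "bilin sH sC tscale (\<lambda>a c. H.sw (\<lambda>g k. ?T (a * g) (smash (act c k))) h)" for h by (intro sli)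
    have b: "bilin sC sH tscale (\<lambda>r h. tsum sH sC (\<lambda>a c. H.sw (\<lambda>g k. ?T (a * g) (tens sC sH c k)) h) (lcoact r))"
      unfolding tsum_lco[OF b0] by (intro sli)
    show ?thesis
      unfolding lco scl
    proof (rule eq_on_Cf[OF lin_tsum_smash[OF b] _ c])
      show "lin sC tscale (\<lambda>c. C.sw (\<lambda>x y. ?T (\<pi> x) (smash y)) c)" by (intro sli)
      fix r h assume r: "r \<in> R"
      have "C.sw (\<lambda>x y. ?T (\<pi> x) (smash y)) (act r h) = C.sw (\<lambda>x y. H.sw (\<lambda>g k. ?T (\<pi> x * g) (smash (act y k))) h) r"
        by (subst sw_act[where sU = tscale]) (intro sli, simp add: pi_act)
      also have "\<dots> = tsum sH sC (\<lambda>a c. H.sw (\<lambda>g k. ?T (a * g) (smash (act c k))) h) (lcoact r)"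
        by (rule tsum_lco[OF b1, symmetric])
      \<comment> \<open>The left coaction of a coinvariant stays in H \<otimes> R, so
        \<open>smash_act\<close> applies to its second leg.\<close>
      also have "\<dots> = tsum sH sC (\<lambda>a c. H.sw (\<lambda>g k. ?T (a * g) (tens sC sH c k)) h) (lcoact r)"
        by (rule tsum_cong_on[OF b1 b0 H.subspace_UNIV lco_coinv[OF r]]) (simp add: smash_act)
      finally show "tsum sC sH (\<lambda>r h. tsum sH sC (\<lambda>a c. H.sw (\<lambda>g k. ?T (a * g) (tens sC sH c k)) h) (lcoact r)) (smash (act r h)) =
          C.sw (\<lambda>x y. ?T (\<pi> x) (smash y)) (act r h)"
        by (simp add: smash_act[OF r] tsum_tens[OF b])
    qed
  qed
qed

theorem Cf_isomorphic_smash: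
  "HMHH_isomorphic sH \<Delta>H \<epsilon>H (sub_bicomod sH sC \<Delta>C act \<pi> (Cf n))
    (smash_bicomod sH \<Delta>H sC \<Delta>C \<pi> (corad_filt sC \<delta> R n))"
  by (rule HMHH_isomorphic_transport[OF sub_bicomod_transport smash_bicomod_transport])

section \<open>Free generators\<close>

lemma act_zero_right: "act c 0 = 0"
  by (rule lin_zero[OF lin_act2[OF lin_id[OF H.vector_space_axioms]]])

lemma act_sum_restrict:
  assumes "finite F"
  shows "(\<Sum>b\<in>F. act b (f b)) = (\<Sum>b | (if b \<in> F then f b else 0) \<noteq> 0. act b (if b \<in> F then f b else 0))"
proof -
  have "(\<Sum>b | (if b \<in> F then f b else 0) \<noteq> 0. act b (if b \<in> F then f b else 0)) =
      (\<Sum>b\<in>F. act b (if b \<in> F then f b else 0))"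
    by (rule sum.mono_neutral_left) (use assms in \<open>auto simp: act_zero_right split: if_splits\<close>)
  also have "\<dots> = (\<Sum>b\<in>F. act b (f b))" by (rule sum.cong) auto
  finally show ?thesis ..
qed

text \<open>Expand the first factors of \<open>smash c\<close> in \<open>B\<close> and apply the
  action; scalars pass to the coefficients in H. Sums over different finite sets are merged by
  setting coefficients to 0 outside their own set.\<close>

lemma Cf_expand:
  assumes B: "B \<subseteq> R \<inter> Cf n" "R \<inter> Cf n \<subseteq> C.span B" and c: "c \<in> Cf n"
  obtains F f where "finite F" "F \<subseteq> B" "c = (\<Sum>b\<in>F. act b (f b))"
proof -
  define P where "P c \<longleftrightarrow> (\<exists>F f. finite F \<and> F \<subseteq> B \<and> c = (\<Sum>b\<in>F. act b (f b)))" for c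
  have P0: "P 0" unfolding P_def by (intro exI[of _ "{}"]) auto
  have Padd: "P (c + d)" if "P c" "P d" for c d
  proof -
    obtain F f where F: "finite F" "F \<subseteq> B" "c = (\<Sum>b\<in>F. act b (f b))"
      using \<open>P c\<close> by (auto simp: P_def)
    obtain G g where G: "finite G" "G \<subseteq> B" "d = (\<Sum>b\<in>G. act b (g b))"
      using \<open>P d\<close> by (auto simp: P_def)
    have ext: "(\<Sum>b\<in>E. act b (e b)) = (\<Sum>b\<in>F \<union> G. act b (if b \<in> E then e b else 0))" if "E \<subseteq> F \<union> G" for E e
    proof -
      have "(\<Sum>b\<in>E. act b (e b)) = (\<Sum>b\<in>E. act b (if b \<in> E then e b else 0))" by (rule sum.cong) auto
      also have "\<dots> = (\<Sum>b\<in>F \<union> G. act b (if b \<in> E then e b else 0))"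
        by (rule sum.mono_neutral_left) (use F(1) G(1) that in \<open>auto simp: act_zero_right\<close>)
      finally show ?thesis .
    qed
    have "c + d = (\<Sum>b\<in>F \<union> G. act b (if b \<in> F then f b else 0) + act b (if b \<in> G then g b else 0))"
      unfolding F(3) G(3) sum.distrib by (simp only: ext[of F f] ext[of G g] Un_upper1 Un_upper2)
    also have "\<dots> = (\<Sum>b\<in>F \<union> G. act b ((if b \<in> F then f b else 0) + (if b \<in> G then g b else 0)))"
      by (simp only: lin_add[OF lin_act2[OF lin_id[OF H.vector_space_axioms]]])
    finally show ?thesis unfolding P_def
      by (intro exI[of _ "F \<union> G"] exI[of _ "\<lambda>b. (if b \<in> F then f b else 0) + (if b \<in> G then g b else 0)"])
        (use F G in auto)
  qed
  have Pact: "P (act r h)" if r: "r \<in> R \<inter> Cf n" for r h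
  proof -
    obtain T u where T: "finite T" "T \<subseteq> B" "r = (\<Sum>b\<in>T. sC (u b) b)"
      using r B(2) unfolding C.span_explicit by blast
    have "act r h = (\<Sum>b\<in>T. act b (sH (u b) h))"
      unfolding T(3) lin_sum[OF lin_act1[OF lin_id[OF C.vector_space_axioms]]] act_scale1 act_scale2 ..
    then show ?thesis unfolding P_def
      by (intro exI[of _ T] exI[of _ "\<lambda>b. sH (u b) h"]) (simp add: T(1,2))
  qed
  have "P (tsum sC sH act t)" if "t \<in> tspace sC sH (R \<inter> Cf n) UNIV" for t
    using C.vector_space_axioms H.vector_space_axioms C.subspace_inter[OF subspace_coinv subspace_Cf] that
    by (induction rule: tspace_induct)
      (auto simp: tsum_zero[OF bilin_act] tsum_add[OF bilin_act] tsum_tens[OF bilin_act] tens_mem tspace_UNIV P0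
        intro!: Padd Pact)
  from this[OF smash_Cf[OF c]] have "P c" by (simp add: tsum_act_smash)
  then show ?thesis using that by (auto simp: P_def)
qed

text \<open>\<open>smash\<close> turns the relation into a vanishing sum of tensors b \<otimes> f b,
  from which the coordinate functional dual to \<open>b\<close> extracts one coefficient.
  Independence over the field thus becomes independence over H.\<close>

lemma coinv_coefficients_zero:
  assumes B: "B \<subseteq> R" "C.independent B" and F: "finite F" "F \<subseteq> B" and z: "(\<Sum>b\<in>F. act b (f b)) = 0"
    and b: "b \<in> F"
  shows "f b = 0"
proof -
  interpret P: vector_space_pair sC "(*) :: 'k \<Rightarrow> 'k \<Rightarrow> 'k"
    by (rule vector_space_pair.intro) (rule C.vector_space_axioms vector_space_mult)+
  obtain \<phi> where \<phi>: "lin sC (*) \<phi>" "\<forall>x\<in>B. \<phi> x = (if x = b then 1 else 0)"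
    using P.linear_independent_extend[OF B(2), of "\<lambda>x. if x = b then 1 else 0"] by blast
  have bf: "bilin sC sH sH (\<lambda>x h. sH (\<phi> x) h)" by (rule bilin_scale1[OF H.vector_space_axioms \<phi>(1)])
  have ls: "lin sC tscale smash" by (rule lin_smash[OF lin_id[OF C.vector_space_axioms]])
  have "0 = tsum sC sH (\<lambda>x h. sH (\<phi> x) h) (smash (\<Sum>b\<in>F. act b (f b)))"
    by (simp add: z lin_zero[OF ls] tsum_zero[OF bf])
  also have "\<dots> = (\<Sum>x\<in>F. sH (\<phi> x) (f x))"
    unfolding lin_sum[OF lin_tsum_smash[OF bf]]
    by (rule sum.cong) (use F B(1) in \<open>auto simp: smash_act tsum_tens[OF bf] subset_iff\<close>)
  also have "\<dots> = (\<Sum>x\<in>F. if x = b then f x else 0)"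
    by (rule sum.cong) (use F \<phi>(2) in auto)
  also have "\<dots> = f b" using F b by simp
  finally show ?thesis by simp
qed

lemma free_right_basis_coinv:
  assumes B: "B \<subseteq> R \<inter> Cf n" "C.independent B" "R \<inter> Cf n \<subseteq> C.span B"
  shows "free_right_basis act (Cf n) B"
  unfolding free_right_basis_def
proof (intro conjI ballI allI)
  show "B \<subseteq> Cf n" using B by auto
  show "act m h \<in> Cf n" if "m \<in> Cf n" for m h by (rule act_Cf[OF that])
  fix m assume m: "m \<in> Cf n"
  obtain F f where F: "finite F" "F \<subseteq> B" "m = (\<Sum>b\<in>F. act b (f b))" by (rule Cf_expand[OF B(1,3) m])
  show "\<exists>!f. finite {b. f b \<noteq> 0} \<and> {b. f b \<noteq> 0} \<subseteq> B \<and> m = (\<Sum>b | f b \<noteq> 0. act b (f b))"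
  proof (rule ex1I)
    \<comment> \<open>Uniqueness is asked among functions on the whole type with support in B, so
      the coefficients are set to 0 off F.\<close>
    let ?f = "\<lambda>b. if b \<in> F then f b else 0"
    have "{b. ?f b \<noteq> 0} \<subseteq> F" by auto
    then show "finite {b. ?f b \<noteq> 0} \<and> {b. ?f b \<noteq> 0} \<subseteq> B \<and> m = (\<Sum>b | ?f b \<noteq> 0. act b (?f b))"
      using F finite_subset act_sum_restrict[OF F(1), of f] by blast
    fix f' assume f': "finite {b. f' b \<noteq> 0} \<and> {b. f' b \<noteq> 0} \<subseteq> B \<and> m = (\<Sum>b | f' b \<noteq> 0. act b (f' b))"
    define G where "G = F \<union> {b. f' b \<noteq> 0}"
    have G: "finite G" "G \<subseteq> B" using F f' by (auto simp: G_def)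
    have "m = (\<Sum>b\<in>G. act b (f' b))"
      using f' G by (auto simp: G_def act_zero_right intro!: sum.mono_neutral_left)
    moreover have "m = (\<Sum>b\<in>G. act b (?f b))"
      unfolding F(3) using F G by (intro sum.mono_neutral_cong_left) (auto simp: G_def act_zero_right)
    ultimately have "(\<Sum>b\<in>G. act b (f' b - ?f b)) = 0"
      by (simp add: lin_diff[OF lin_act2[OF lin_id[OF H.vector_space_axioms]]] sum_subtractf)
    then have "f' b - ?f b = 0" if "b \<in> G" for b
      using coinv_coefficients_zero[OF _ B(2) G, of "\<lambda>b. f' b - ?f b"] B(1) that by auto
    then show "f' = ?f" by (force simp: G_def fun_eq_iff)
  qed
qed

section \<open>Shape of the comultiplication on the terms of the filtration\<close>

lemma iota_Cf: "\<iota> h \<in> Cf n"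
proof -
  have "\<iota> h \<in> Cf 0" unfolding Cf_0 by simp
  then show ?thesis using C.corad_filt_mono[of 0 n] by blast
qed

text \<open>The two wedge forms of the filtration put the defect in C \<otimes> C_n and in C_n
  \<otimes> C; intersecting gives the first claim. The index is shifted: \<open>n = 0\<close>
  concerns C_1, where \<Delta> c lies in C_0 \<otimes> C + C \<otimes> C_0. The last equation
  expands (id - p) \<otimes> (id - p) for p = \<iota> \<pi>.\<close>

lemma comult_defect:
  assumes c: "c \<in> Cf (Suc n)"
  shows "C.sw (\<lambda>x y. tens sC sC (x - \<iota> (\<pi> x)) (y - \<iota> (\<pi> y))) c \<in> tspace sC sC (Cf n) (Cf n)"
    "n = 0 \<Longrightarrow> C.sw (\<lambda>x y. tens sC sC (x - \<iota> (\<pi> x)) (y - \<iota> (\<pi> y))) c = 0"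
    "\<Delta>C c = C.sw (\<lambda>x y. tens sC sC (\<iota> (\<pi> x)) y) c + C.sw (\<lambda>x y. tens sC sC x (\<iota> (\<pi> y))) c
      + (C.sw (\<lambda>x y. tens sC sC (x - \<iota> (\<pi> x)) (y - \<iota> (\<pi> y))) c - C.sw (\<lambda>x y. tens sC sC (\<iota> (\<pi> x)) (\<iota> (\<pi> y))) c)"
proof -
  let ?t = "tens sC sC"
  note vs = C.vector_space_axioms
  have b: "bilin sC sC tscale (\<lambda>x y. ?t (x - \<iota> (\<pi> x)) (y - \<iota> (\<pi> y)))" by (intro li)
  have k0: "x - \<iota> (\<pi> x) = 0" if "x \<in> Cf 0" for x using that unfolding Cf_0 by (auto simp: pi_iota)
  have kn: "x - \<iota> (\<pi> x) \<in> Cf m" if "x \<in> Cf m" for x m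
    using that by (intro C.subspace_diff subspace_Cf iota_Cf)
  have z: "?t 0 y = 0" "?t x 0 = 0" for x y
    using lin_zero[OF lin_tens1[OF lin_id[OF vs] vs]] lin_zero[OF lin_tens2[OF lin_id[OF vs] vs]] by auto
  have c1: "\<Delta>C c \<in> ssum (tspace sC sC (Cf 0) UNIV) (tspace sC sC UNIV (Cf n))"
    using c by (simp add: wedge_def)
  have c2: "\<Delta>C c \<in> ssum (tspace sC sC (Cf n) UNIV) (tspace sC sC UNIV (Cf 0))"
    using subsetD[OF C.corad_filt_wedge_right c] by (simp add: wedge_def)
  have e1: "C.sw (\<lambda>x y. ?t (x - \<iota> (\<pi> x)) (y - \<iota> (\<pi> y))) c \<in> tspace sC sC UNIV (Cf n)"
    unfolding C.sw_def
    by (rule tsum_ssum_mem[OF b subspace_Cf c1 subspace_tspace]) (simp_all add: k0 z tspace_zero tens_mem kn)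
  have e2: "C.sw (\<lambda>x y. ?t (x - \<iota> (\<pi> x)) (y - \<iota> (\<pi> y))) c \<in> tspace sC sC (Cf n) UNIV"
    unfolding C.sw_def
    by (rule tsum_ssum_mem[OF b subspace_Cf c2 subspace_tspace]) (simp_all add: k0 z tspace_zero tens_mem kn)
  show "C.sw (\<lambda>x y. ?t (x - \<iota> (\<pi> x)) (y - \<iota> (\<pi> y))) c \<in> tspace sC sC (Cf n) (Cf n)"
    by (rule tspace_Int[OF vs vs subspace_Cf subspace_Cf e2 e1])
  show "C.sw (\<lambda>x y. ?t (x - \<iota> (\<pi> x)) (y - \<iota> (\<pi> y))) c = 0" if "n = 0"
    unfolding C.sw_def
    by (rule tsum_ssum_zero[OF b subspace_Cf c1]) (simp_all add: k0 z that)
  have bi: "bilin sC sC tscale (\<lambda>x y. ?t (\<iota> (\<pi> x)) y)" "bilin sC sC tscale (\<lambda>x y. ?t x (\<iota> (\<pi> y)))"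
    "bilin sC sC tscale (\<lambda>x y. ?t (\<iota> (\<pi> x)) (\<iota> (\<pi> y)))" by (intro li)+
  have d1: "?t (x - y) u = ?t x u - ?t y u" and d2: "?t u (x - y) = ?t u x - ?t u y" for x y u
    using lin_diff[OF lin_tens1[OF lin_id[OF vs] vs]] lin_diff[OF lin_tens2[OF lin_id[OF vs] vs]] by auto
  have "C.sw (\<lambda>x y. ?t (x - \<iota> (\<pi> x)) (y - \<iota> (\<pi> y))) c =
      C.sw (\<lambda>x y. (?t x y - ?t x (\<iota> (\<pi> y))) - (?t (\<iota> (\<pi> x)) y - ?t (\<iota> (\<pi> x)) (\<iota> (\<pi> y)))) c"
    by (simp add: d1 d2 algebra_simps)
  also have "\<dots> = (C.sw ?t c - C.sw (\<lambda>x y. ?t x (\<iota> (\<pi> y))) c) -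
      (C.sw (\<lambda>x y. ?t (\<iota> (\<pi> x)) y) c - C.sw (\<lambda>x y. ?t (\<iota> (\<pi> x)) (\<iota> (\<pi> y))) c)"
    unfolding C.sw_def
    by (simp only: tsum_sub[OF bilin_sub[OF bilin_tens[OF vs vs] bi(2)] bilin_sub[OF bi(1,3)] C.comult_mem]
        tsum_sub[OF bilin_tens[OF vs vs] bi(2) C.comult_mem] tsum_sub[OF bi(1,3) C.comult_mem])
  finally show "\<Delta>C c = C.sw (\<lambda>x y. tens sC sC (\<iota> (\<pi> x)) y) c + C.sw (\<lambda>x y. tens sC sC x (\<iota> (\<pi> y))) c
      + (C.sw (\<lambda>x y. tens sC sC (x - \<iota> (\<pi> x)) (y - \<iota> (\<pi> y))) c - C.sw (\<lambda>x y. tens sC sC (\<iota> (\<pi> x)) (\<iota> (\<pi> y))) c)"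
    by (simp add: C.sw_tens)
qed

text \<open>For coinvariant \<open>r\<close>, the part x \<otimes> \<iota>(\<pi> y) of the expansion
  collapses to r \<otimes> \<iota>(1), while \<iota>(\<pi> x) \<otimes> \<iota>(\<pi> y) lies in C_0
  \<otimes> C_0 and is absorbed, together with the defect, into \<open>t\<close>.\<close>

lemma comult_coinv_Cf:
  assumes r: "r \<in> R" "r \<in> Cf (Suc n)"
  shows "\<exists>t\<in>tspace sC sC (Cf n) (Cf n). \<Delta>C r =
    tsum sH sC (\<lambda>h c. tens sC sC (\<iota> h) c) (lcoact r) + tens sC sC r (\<iota> 1) + t"
proof -
  let ?t = "tens sC sC"
  have b1: "bilin sH sC tscale (\<lambda>h c. ?t (\<iota> h) c)" by (intro li)
  have b2: "bilin sC sH tscale (\<lambda>x h. ?t x (\<iota> h))" by (intro li)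
  have b3: "bilin sC sC tscale (\<lambda>x y. ?t (\<iota> (\<pi> x)) (\<iota> (\<pi> y)))" by (intro li)
  have "C.sw (\<lambda>x y. ?t (\<iota> (\<pi> x)) (\<iota> (\<pi> y))) r \<in> tspace sC sC (Cf n) (Cf n)"
    by (rule C.sw_in_tspace[OF b3]) (intro tens_mem iota_Cf)
  then show ?thesis
    using comult_defect(1)[OF r(2)] comult_defect(3)[OF r(2)] coinv_sw[OF r(1) b2]
    by (intro bexI[of _ "C.sw (\<lambda>x y. ?t (x - \<iota> (\<pi> x)) (y - \<iota> (\<pi> y))) r -
        C.sw (\<lambda>x y. ?t (\<iota> (\<pi> x)) (\<iota> (\<pi> y))) r"] tspace_diff) (simp_all add: tsum_lco[OF b1])
qed

theorem Cf_free:
  assumes n: "n \<ge> 1"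
  shows "\<exists>B. free_right_basis act (Cf n) B \<and>
    (\<forall>r\<in>B. \<exists>t\<in>tspace sC sC (Cf (n - 1)) (Cf (n - 1)). \<Delta>C r =
      tsum sH sC (\<lambda>h c. tens sC sC (\<iota> h) c) (lcoact r) + tens sC sC r (\<iota> 1) + t)"
proof -
  obtain B where B: "B \<subseteq> R \<inter> Cf n" "C.independent B" "R \<inter> Cf n \<subseteq> C.span B"
    by (rule C.basis_exists[of "R \<inter> Cf n"])
  have "\<exists>t\<in>tspace sC sC (Cf (n - 1)) (Cf (n - 1)). \<Delta>C r =
      tsum sH sC (\<lambda>h c. tens sC sC (\<iota> h) c) (lcoact r) + tens sC sC r (\<iota> 1) + t" if "r \<in> B" for r
    by (rule comult_coinv_Cf) (use that B(1) n in auto)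
  with free_right_basis_coinv[OF B] show ?thesis by blast
qed

end

section \<open>The first term of the filtration\<close>

context hopf_splitting
begin

text \<open>The action of a functional on the left H-comodule \<open>C\<close>. For the functional
  attached to a simple subcoalgebra D of the cosemisimple H, it is the projection onto the
  D-isotypic component.\<close>

definition iso_comp :: "('h \<Rightarrow> 'k) \<Rightarrow> 'c \<Rightarrow> 'c"
  where "iso_comp e c = tsum sH sC (\<lambda>h y. sC (e h) y) (lcoact c)"

lemma iso_comp_sw: "lin sH (*) e \<Longrightarrow> iso_comp e c = C.sw (\<lambda>x y. sC (e (\<pi> x)) y) c"
  unfolding iso_comp_def by (rule tsum_lco[OF bilin_scale1[OF C.vector_space_axioms]])

lemma iso_comp_mem:
  assumes e: "lin sH (*) e" and c: "c \<in> R" "c \<in> Cf n"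
  shows "iso_comp e c \<in> R" "iso_comp e c \<in> Cf n"
proof -
  note b = bilin_scale1[OF C.vector_space_axioms e]
  have b2: "bilin sC sC sC (\<lambda>x y. sC (e (\<pi> x)) y)" by (intro lin_comp[OF e] li)
  show "iso_comp e c \<in> R" unfolding iso_comp_def
    by (rule tsum_mem[OF b H.subspace_UNIV lco_coinv[OF c(1)] subspace_coinv])
      (rule C.subspace_scale[OF subspace_coinv])
  show "iso_comp e c \<in> Cf n" unfolding iso_comp_sw[OF e]
    by (rule C.sw_mem[OF b2 C.subspace_UNIV Cf_left[OF c(2)] subspace_Cf])
      (rule C.subspace_scale[OF subspace_Cf])
qed

text \<open>By coassociativity the first leg of the coaction is (e \<otimes> id) \<Delta> applied to
  \<pi>(c_1). This operator maps H into D: by cosemisimplicity it suffices to test simple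
  subcoalgebras E, and it vanishes on E unless E = D.\<close>

lemma lco_iso_comp:
  assumes cs: "cosemisimple sH \<Delta>H" and D: "simple_subcoalgebra sH \<Delta>H D"
    and e: "lin sH (*) e" "\<And>E x. simple_subcoalgebra sH \<Delta>H E \<Longrightarrow> E \<noteq> D \<Longrightarrow> x \<in> E \<Longrightarrow> e x = 0"
  shows "lcoact (iso_comp e c) \<in> tspace sH sC D UNIV"
proof -
  let ?t = "tens sH sC" and ?p = "H.sw (\<lambda>x a. sH (e x) a)"
  note el = lin_comp[OF e(1)] pli
  have Ds: "H.subspace D" using D by (simp add: simple_subcoalgebra_def subcoalgebra_def)
  have be: "bilin sH sH sH (\<lambda>x a. sH (e x) a)" by (intro el)
  have pD: "?p h \<in> D" for h
  proof -
    have "UNIV \<subseteq> {h. ?p h \<in> D}"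
      using cs unfolding cosemisimple_def coradical_def
    proof (elim ssubst[OF sym], intro H.span_minimal)
      show "H.subspace {h. ?p h \<in> D}"
        by (rule subspace_vimage[OF H.lin_sw[OF be lin_id[OF H.vector_space_axioms]] Ds])
      show "\<Union> {E. simple_subcoalgebra sH \<Delta>H E \<and> E \<subseteq> UNIV} \<subseteq> {h. ?p h \<in> D}"
      proof clarify
        fix h E assume E: "simple_subcoalgebra sH \<Delta>H E" and h: "h \<in> E"
        have sE: "subcoalgebra sH \<Delta>H E" using E by (simp add: simple_subcoalgebra_def)
        show "?p h \<in> D"
          by (rule H.sw_mem[OF be H.subcoalgebraD(1,2)[OF sE] Ds])
            (use h e(2)[OF E] H.subspace_0[OF Ds] H.subspace_scale[OF Ds] in \<open>cases "E = D"; auto\<close>)+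
      qed
    qed
    then show ?thesis by auto
  qed
  have tl: "lin sH tscale (\<lambda>x. ?t x b)" for b by (intro el)
  have "lcoact (iso_comp e c) = C.sw (\<lambda>x y. lcoact (sC (e (\<pi> x)) y)) c"
    unfolding iso_comp_sw[OF e(1)] by (rule C.sw_comp[where sU = sC and sW = tscale]) (intro el)+
  also have "\<dots> = C.sw (\<lambda>x y. tscale (e (\<pi> x)) (C.sw (\<lambda>a b. ?t (\<pi> a) b) y)) c"
    by (simp only: lin_scale[OF lin_lco[OF lin_id[OF C.vector_space_axioms]]], simp only: lco_sw)
  also have "\<dots> = C.sw (\<lambda>x y. C.sw (\<lambda>a b. tscale (e (\<pi> x)) (?t (\<pi> a) b)) y) c"
  proof -
    have b: "bilin sC sC tscale (\<lambda>a b. ?t (\<pi> a) b)" by (intro el)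
    show ?thesis by (simp add: C.sw_comp[OF b lin_scaled[OF lin_id[OF vector_space_tscale]]])
  qed
  also have "\<dots> = C.sw (\<lambda>z b. C.sw (\<lambda>x a. tscale (e (\<pi> x)) (?t (\<pi> a) b)) z) c"
    by (rule C.sw_coassoc[where sU = tscale, symmetric]) (intro el)+
  also have "\<dots> = C.sw (\<lambda>z b. ?t (?p (\<pi> z)) b) c"
  proof -
    have b: "bilin sC sC sH (\<lambda>x a. sH (e (\<pi> x)) (\<pi> a))" by (intro el)
    show ?thesis by (simp add: sw_pi[OF be] C.sw_comp[OF b tl] lin_scale[OF tl])
  qed
  also have "\<dots> \<in> tspace sH sC D UNIV"
    by (rule C.sw_in_tspace) (intro el be, simp add: tens_mem pD)
  finally show ?thesis .
qed

lemma iso_comp_wedge: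
  assumes cs: "cosemisimple sH \<Delta>H" and D: "simple_subcoalgebra sH \<Delta>H D"
    and e: "lin sH (*) e" "\<And>E x. simple_subcoalgebra sH \<Delta>H E \<Longrightarrow> E \<noteq> D \<Longrightarrow> x \<in> E \<Longrightarrow> e x = 0"
    and c: "c \<in> R" "c \<in> Cf (Suc 0)"
  shows "iso_comp e c \<in> wedge sC \<Delta>C UNIV (\<iota> ` D) K1"
proof -
  let ?r = "iso_comp e c" and ?t = "tens sC sC"
  have r: "?r \<in> R" "?r \<in> Cf (Suc 0)" by (rule iso_comp_mem[OF e(1) c])+
  have Ds: "H.subspace D" using D by (simp add: simple_subcoalgebra_def subcoalgebra_def)
  have i: "\<iota> 1 \<in> K1" by (rule range_eqI[of _ _ 1]) simp
  have b1: "bilin sH sC tscale (\<lambda>h c. ?t (\<iota> h) c)"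
    and b2: "bilin sC sH tscale (\<lambda>x h. ?t x (\<iota> h))"
    and b3: "bilin sC sH tscale (\<lambda>x h. ?t (\<iota> (\<pi> x)) (\<iota> h))" by (intro li)+
  \<comment> \<open>In C_1 the defect is zero, and coinvariance turns both terms with \<iota>(\<pi>
    y) into tensors ending in \<iota>(1). What remains is the left coaction, whose first leg lies in
    D.\<close>
  have "\<Delta>C ?r = tsum sH sC (\<lambda>h c. ?t (\<iota> h) c) (lcoact ?r) + (?t ?r (\<iota> 1) - ?t (\<iota> (\<pi> ?r)) (\<iota> 1))"
    using comult_defect(3)[OF r(2)] comult_defect(2)[OF r(2) refl]
      coinv_sw[OF r(1) b2] coinv_sw[OF r(1) b3]
    by (simp add: tsum_lco[OF b1] algebra_simps)
  moreover have "tsum sH sC (\<lambda>h c. ?t (\<iota> h) c) (lcoact ?r) \<in> tspace sC sC (\<iota> ` D) UNIV"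
    by (rule tsum_mem[OF b1 Ds lco_iso_comp[OF cs D e] subspace_tspace]) (auto intro: tens_mem)
  moreover have "?t ?r (\<iota> 1) - ?t (\<iota> (\<pi> ?r)) (\<iota> 1) \<in> tspace sC sC UNIV K1"
    by (intro tspace_diff tens_mem i UNIV_I)
  ultimately show ?thesis by (simp add: wedge_def ssumI)
qed

text \<open>The counit is the locally finite sum of the isotypic functionals \<open>e D\<close>, and
  it acts as the identity, so \<open>c\<close> is a finite sum of its isotypic components, each of
  which lies in its wedge.\<close>

lemma coinv_decompose:
  assumes cs: "cosemisimple sH \<Delta>H" and c: "c \<in> R" "c \<in> Cf (Suc 0)"
  shows "c \<in> C.span (\<Union>D\<in>{D. simple_subcoalgebra sH \<Delta>H D}. wedge sC \<Delta>C UNIV (\<iota> ` D) K1)"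
proof -
  let ?A = "{D. simple_subcoalgebra sH \<Delta>H D}"
  have "\<forall>D\<in>?A. \<exists>e. lin sH (*) e \<and> (\<forall>x\<in>D. e x = \<epsilon>H x) \<and> (\<forall>E\<in>?A. \<forall>x\<in>E. E \<noteq> D \<longrightarrow> e x = 0)"
  proof
    fix D assume "D \<in> ?A"
    then have D: "simple_subcoalgebra sH \<Delta>H D" by simp
    obtain e where e: "lin sH (*) e" "\<And>x. x \<in> D \<Longrightarrow> e x = \<epsilon>H x"
      "\<And>E x. simple_subcoalgebra sH \<Delta>H E \<Longrightarrow> E \<noteq> D \<Longrightarrow> x \<in> E \<Longrightarrow> e x = 0"
      by (rule H.ex_isotypic_functional[OF D]) blast
    show "\<exists>e. lin sH (*) e \<and> (\<forall>x\<in>D. e x = \<epsilon>H x) \<and> (\<forall>E\<in>?A. \<forall>x\<in>E. E \<noteq> D \<longrightarrow> e x = 0)"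
      by (intro exI[of _ e]) (simp add: e)
  qed
  from bchoice[OF this] obtain e where
    "\<forall>D\<in>?A. lin sH (*) (e D) \<and> (\<forall>x\<in>D. e D x = \<epsilon>H x) \<and> (\<forall>E\<in>?A. \<forall>x\<in>E. E \<noteq> D \<longrightarrow> e D x = 0)" ..
  then have e: "\<And>D. D \<in> ?A \<Longrightarrow> lin sH (*) (e D)" "\<And>D x. D \<in> ?A \<Longrightarrow> x \<in> D \<Longrightarrow> e D x = \<epsilon>H x"
    "\<And>D E x. D \<in> ?A \<Longrightarrow> E \<in> ?A \<Longrightarrow> x \<in> E \<Longrightarrow> E \<noteq> D \<Longrightarrow> e D x = 0"
    by simp_all
  \<comment> \<open>\<open>h\<close> is a finite sum of elements of simple subcoalgebras, so the
    equation holds for every finite family containing these. The bound depends on \<open>h\<close>;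
    quantifying over all larger families lets the statement pass to tensors, where several
    \<open>h\<close> occur together.\<close>
  have fin: "\<exists>F0. finite F0 \<and> F0 \<subseteq> ?A \<and> (\<forall>F. finite F \<and> F0 \<subseteq> F \<and> F \<subseteq> ?A \<longrightarrow> \<epsilon>H h = (\<Sum>D\<in>F. e D h))" for h
  proof -
    have "h \<in> H.span (\<Union>{D. simple_subcoalgebra sH \<Delta>H D \<and> D \<subseteq> UNIV})"
      using cs unfolding cosemisimple_def coradical_def by auto
    then obtain T u where T: "finite T" "T \<subseteq> \<Union>{D. simple_subcoalgebra sH \<Delta>H D \<and> D \<subseteq> UNIV}" "h = (\<Sum>a\<in>T. sH (u a) a)"
      unfolding H.span_explicit by blast
    then have "\<forall>a\<in>T. \<exists>D. D \<in> ?A \<and> a \<in> D" by blast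
    then obtain g where g: "\<And>a. a \<in> T \<Longrightarrow> g a \<in> ?A" "\<And>a. a \<in> T \<Longrightarrow> a \<in> g a" by metis
    show ?thesis
    proof (intro exI[of _ "g ` T"] conjI allI impI)
      show "finite (g ` T)" using T(1) by simp
      show "g ` T \<subseteq> ?A" using g(1) by blast
      fix F assume F: "finite F \<and> g ` T \<subseteq> F \<and> F \<subseteq> ?A"
      have one: "(\<Sum>D\<in>F. e D a) = \<epsilon>H a" if a: "a \<in> T" for a
      proof -
        have "e D a = 0" if "D \<in> F - {g a}" for D
          by (rule e(3)[of D "g a"]) (use that F a g in blast)+
        then have "(\<Sum>D\<in>F. e D a) = (\<Sum>D\<in>{g a}. e D a)"
          by (intro sum.mono_neutral_right) (use F a in auto)
        then show ?thesis using e(2)[OF g(1)[OF a] g(2)[OF a]] by simp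
      qed
      have eT: "e D h = (\<Sum>a\<in>T. u a * e D a)" if "D \<in> F" for D
        using that F e(1)[of D] unfolding T(3) by (auto simp: lin_sum lin_scale subset_iff)
      have "(\<Sum>D\<in>F. e D h) = (\<Sum>D\<in>F. \<Sum>a\<in>T. u a * e D a)" by (rule sum.cong) (auto simp: eT)
      also have "\<dots> = (\<Sum>a\<in>T. \<Sum>D\<in>F. u a * e D a)" by (rule sum.swap)
      also have "\<dots> = (\<Sum>a\<in>T. u a * \<epsilon>H a)" by (simp add: sum_distrib_left[symmetric] one)
      also have "\<dots> = \<epsilon>H h" unfolding T(3) by (simp add: lin_sum[OF H.counit_linear] lin_scale[OF H.counit_linear])
      finally show "\<epsilon>H h = (\<Sum>D\<in>F. e D h)" ..
    qed
  qed
  let ?f = "\<lambda>a t. tsum sH sC (\<lambda>h y. sC (a h) y) t"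
  note bs = bilin_scale1[OF C.vector_space_axioms]
  have "\<exists>F0. finite F0 \<and> F0 \<subseteq> ?A \<and> (\<forall>F. finite F \<and> F0 \<subseteq> F \<and> F \<subseteq> ?A \<longrightarrow> ?f \<epsilon>H t = (\<Sum>D\<in>F. ?f (e D) t))"
    if "t \<in> tspace sH sC UNIV UNIV" for t
    using H.vector_space_axioms C.vector_space_axioms that
  proof (induction rule: tspace_induct_UNIV)
    case zero
    show ?case
      by (intro exI[of _ "{}"]) (auto simp: tsum_zero[OF bs[OF H.counit_linear]] tsum_zero[OF bs[OF e(1)]] subset_iff
          intro!: sum.neutral[symmetric])
  next
    case (add h y t)
    from add.IH obtain F0 where "finite F0 \<and> F0 \<subseteq> ?A \<and>
      (\<forall>F. finite F \<and> F0 \<subseteq> F \<and> F \<subseteq> ?A \<longrightarrow> ?f \<epsilon>H t = (\<Sum>D\<in>F. ?f (e D) t))" ..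
    then have F0: "finite F0" "F0 \<subseteq> ?A"
      "\<And>F. finite F \<Longrightarrow> F0 \<subseteq> F \<Longrightarrow> F \<subseteq> ?A \<Longrightarrow> ?f \<epsilon>H t = (\<Sum>D\<in>F. ?f (e D) t)"
      by simp_all
    from fin[of h] obtain F1 where "finite F1 \<and> F1 \<subseteq> ?A \<and>
      (\<forall>F. finite F \<and> F1 \<subseteq> F \<and> F \<subseteq> ?A \<longrightarrow> \<epsilon>H h = (\<Sum>D\<in>F. e D h))" ..
    then have F1: "finite F1" "F1 \<subseteq> ?A"
      "\<And>F. finite F \<Longrightarrow> F1 \<subseteq> F \<Longrightarrow> F \<subseteq> ?A \<Longrightarrow> \<epsilon>H h = (\<Sum>D\<in>F. e D h)"
      by simp_all
    show ?case
    proof (intro exI[of _ "F0 \<union> F1"] conjI allI impI)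
      show "finite (F0 \<union> F1)" "F0 \<union> F1 \<subseteq> ?A" using F0 F1 by auto
      fix F assume F: "finite F \<and> F0 \<union> F1 \<subseteq> F \<and> F \<subseteq> ?A"
      have s: "?f a (tens sH sC h y + t) = sC (a h) y + ?f a t" if "lin sH (*) a" for a
        using add.hyps by (simp add: tsum_simps[OF bs[OF that]] tens_mem)
      have "?f \<epsilon>H (tens sH sC h y + t) = sC (\<Sum>D\<in>F. e D h) y + (\<Sum>D\<in>F. ?f (e D) t)"
        unfolding s[OF H.counit_linear] using F0(3)[of F] F1(3)[of F] F by simp
      also have "\<dots> = (\<Sum>D\<in>F. sC (e D h) y + ?f (e D) t)"
        by (simp add: C.scale_sum_left sum.distrib)
      also have "\<dots> = (\<Sum>D\<in>F. ?f (e D) (tens sH sC h y + t))"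
        by (rule sum.cong) (use F s e(1) in \<open>auto simp: subset_iff\<close>)
      finally show "?f \<epsilon>H (tens sH sC h y + t) = (\<Sum>D\<in>F. ?f (e D) (tens sH sC h y + t))" .
    qed
  qed
  from this[OF tspace_UNIV[OF lco_coinv[OF c(1)]]]
  obtain F where F: "finite F" "F \<subseteq> ?A" "iso_comp \<epsilon>H c = (\<Sum>D\<in>F. iso_comp (e D) c)"
    unfolding iso_comp_def by blast
  have "iso_comp \<epsilon>H c = c"
    unfolding iso_comp_sw[OF H.counit_linear] counit_pi
    by (rule C.sw_counit_left[OF lin_id[OF C.vector_space_axioms]])
  then have "c = (\<Sum>D\<in>F. iso_comp (e D) c)" using F(3) by simp
  also have "\<dots> \<in> C.span (\<Union>D\<in>?A. wedge sC \<Delta>C UNIV (\<iota> ` D) K1)"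
  proof (rule C.span_sum)
    fix D assume "D \<in> F"
    then have D: "D \<in> ?A" using F(2) by blast
    have "iso_comp (e D) c \<in> wedge sC \<Delta>C UNIV (\<iota> ` D) K1"
      by (rule iso_comp_wedge[OF cs _ e(1)[OF D] _ c]) (use D e(3)[OF D] in auto)
    then show "iso_comp (e D) c \<in> C.span (\<Union>D\<in>?A. wedge sC \<Delta>C UNIV (\<iota> ` D) K1)"
      using D by (intro C.span_base) blast
  qed
  finally show ?thesis .
qed

text \<open>The image of each C(\<tau>) and the line through \<iota>(1) lie in C_0, so the wedges
  lie in C_0 \<and> C_0 = C_1, which is stable under H. Conversely, \<open>proj_split\<close>
  reduces elements of C_1 to products r h with r in R \<inter> C_1, and each simple subcoalgebra in
  the decomposition of r is some C(\<tau>).\<close>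

theorem Cf_one:
  assumes cs: "cosemisimple sH \<Delta>H"
  shows "Cf 1 = ssum (Cf 0) (C.span (\<Union>\<tau>\<in>comod_classes sH \<Delta>H \<epsilon>H.
    right_span sC act (wedge sC \<Delta>C UNIV (\<iota> ` class_coalg sH \<Delta>H \<tau>) K1)))" (is "_ = ssum _ ?Z")
proof
  have "right_span sC act (wedge sC \<Delta>C UNIV (\<iota> ` class_coalg sH \<Delta>H \<tau>) K1) \<subseteq> Cf 1" for \<tau>
    unfolding right_span_def
  proof (rule C.span_minimal[OF _ subspace_Cf], clarify)
    fix c h assume c: "c \<in> wedge sC \<Delta>C UNIV (\<iota> ` class_coalg sH \<Delta>H \<tau>) K1"
    have "wedge sC \<Delta>C UNIV (\<iota> ` class_coalg sH \<Delta>H \<tau>) K1 \<subseteq> wedge sC \<Delta>C UNIV (Cf 0) (Cf 0)"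
    proof (rule C.wedge_mono)
      show "\<iota> ` class_coalg sH \<Delta>H \<tau> \<subseteq> Cf 0" using iota_Cf by blast
      show "K1 \<subseteq> Cf 0" using coinv_Cf_0 by blast
    qed
    then have "c \<in> Cf 1" using c by auto
    then show "act c h \<in> Cf 1" by (rule act_Cf)
  qed
  then have "?Z \<subseteq> Cf 1" by (intro C.span_minimal subspace_Cf) auto
  then show "ssum (Cf 0) ?Z \<subseteq> Cf 1"
    using C.corad_filt_mono[of 0 1] C.subspace_add[OF subspace_Cf[of 1]] by (auto simp: ssum_def)
  have sZ: "C.subspace ?Z" by simp
  have "Cf 1 \<subseteq> ?Z"
  proof
    fix c assume c: "c \<in> Cf 1"
    have act_Z: "act r h \<in> ?Z" if r: "r \<in> R" "r \<in> Cf 1" for r h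
    proof -
      have "C.span (\<Union>D\<in>{D. simple_subcoalgebra sH \<Delta>H D}. wedge sC \<Delta>C UNIV (\<iota> ` D) K1) \<subseteq> {x. act x h \<in> ?Z}"
      proof (rule C.span_minimal)
        show "C.subspace {x. act x h \<in> ?Z}"
          by (rule subspace_vimage[OF lin_act1[OF lin_id[OF C.vector_space_axioms]] sZ])
        show "(\<Union>D\<in>{D. simple_subcoalgebra sH \<Delta>H D}. wedge sC \<Delta>C UNIV (\<iota> ` D) K1) \<subseteq> {x. act x h \<in> ?Z}"
        proof clarify
          fix D x assume D: "simple_subcoalgebra sH \<Delta>H D" and x: "x \<in> wedge sC \<Delta>C UNIV (\<iota> ` D) K1"
          obtain \<tau> where \<tau>: "\<tau> \<in> comod_classes sH \<Delta>H \<epsilon>H" "class_coalg sH \<Delta>H \<tau> = D"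
            by (rule H.ex_class_coalg[OF D])
          have "act x h \<in> right_span sC act (wedge sC \<Delta>C UNIV (\<iota> ` class_coalg sH \<Delta>H \<tau>) K1)"
            unfolding right_span_def \<tau>(2) by (intro C.span_base) (use x in blast)
          then show "act x h \<in> ?Z" using \<tau>(1) by (intro C.span_base) blast
        qed
      qed
      then show ?thesis using coinv_decompose[OF cs r(1)] r(2) by auto
    qed
    have b: "bilin sC sC sC (\<lambda>a b. act (proj a) (\<pi> b))" by (intro pli)
    have "C.sw (\<lambda>a b. act (proj a) (\<pi> b)) c \<in> ?Z"
      by (rule C.sw_mem[OF b subspace_Cf Cf_right[OF c] sZ]) (rule act_Z[OF IntD1[OF proj_Cf] IntD2[OF proj_Cf]])
    then show "c \<in> ?Z" by (simp add: proj_split)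
  qed
  also have "?Z \<subseteq> ssum (Cf 0) ?Z" by (rule ssum_right[OF C.subspace_0[OF subspace_Cf]])
  finally show "Cf 1 \<subseteq> ssum (Cf 0) ?Z" .
qed

end

text \<open>H and \<open>C\<close> live on different types, so the identification of C_0 with H as
  right module coalgebras is carried by \<open>\<iota>\<close>; accordingly \<iota>(1) is the unit
  of H seen inside \<open>C\<close>.\<close>

theorem theorem5p17:
  fixes sH :: "'k::field \<Rightarrow> 'h::ring_1 \<Rightarrow> 'h"
    and \<Delta>H :: "'h \<Rightarrow> ('h, 'h, 'k) tensor" and \<epsilon>H :: "'h \<Rightarrow> 'k" and S :: "'h \<Rightarrow> 'h"
    and sC :: "'k \<Rightarrow> 'c::ab_group_add \<Rightarrow> 'c"
    and \<Delta>C :: "'c \<Rightarrow> ('c, 'c, 'k) tensor" and \<epsilon>C :: "'c \<Rightarrow> 'k"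
    and act :: "'c \<Rightarrow> 'h \<Rightarrow> 'c"
    and \<iota> :: "'h \<Rightarrow> 'c" and \<pi> :: "'c \<Rightarrow> 'h"
  assumes "hopf_algebra sH \<Delta>H \<epsilon>H S"
    and "cosemisimple sH \<Delta>H"
    and "right_module_coalgebra sH \<Delta>H \<epsilon>H S sC \<Delta>C \<epsilon>C act"
    and "coalgebra_map sH \<Delta>H \<epsilon>H sC \<Delta>C \<epsilon>C \<iota>"
    and "\<forall>g h. \<iota> (g * h) = act (\<iota> g) h"
    and "inj \<iota>"
    and "range \<iota> = coradical sC \<Delta>C UNIV"
    and "coalgebra_map sC \<Delta>C \<epsilon>C sH \<Delta>H \<epsilon>H \<pi>"
    and "\<forall>c h. \<pi> (act c h) = \<pi> c * h"
    and "\<forall>h. \<pi> (\<iota> h) = h"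
  shows
    "(\<forall>n. HMHH_isomorphic sH \<Delta>H \<epsilon>H
        (sub_bicomod sH sC \<Delta>C act \<pi> (corad_filt sC \<Delta>C UNIV n))
        (smash_bicomod sH \<Delta>H sC \<Delta>C \<pi>
          (corad_filt sC (coinv_comult S sC \<Delta>C act \<pi>) (coinv sH sC \<Delta>C \<pi>) n)))
     \<and> (\<forall>n\<ge>1. \<exists>B. free_right_basis act (corad_filt sC \<Delta>C UNIV n) B \<and>
          (\<forall>r\<in>B. \<exists>t \<in> tspace sC sC (corad_filt sC \<Delta>C UNIV (n - 1)) (corad_filt sC \<Delta>C UNIV (n - 1)).
            \<Delta>C r = tsum sH sC (\<lambda>h c. tens sC sC (\<iota> h) c) (left_coact sH sC \<Delta>C \<pi> r)
                   + tens sC sC r (\<iota> 1) + t))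
     \<and> corad_filt sC \<Delta>C UNIV 1 =
         ssum (corad_filt sC \<Delta>C UNIV 0)
           (lspan sC (\<Union>\<tau> \<in> comod_classes sH \<Delta>H \<epsilon>H.
             right_span sC act
               (wedge sC \<Delta>C UNIV (\<iota> ` class_coalg sH \<Delta>H \<tau>) (range (\<lambda>a. sC a (\<iota> 1))))))"
proof -
  interpret hopf_splitting sH \<Delta>H \<epsilon>H S sC \<Delta>C \<epsilon>C act \<iota> \<pi>
    using assms by (intro hopf_splitting.intro hopf_splitting_axioms.intro) auto
  show ?thesis
    using Cf_isomorphic_smash Cf_free Cf_one[OF assms(2)] by (intro conjI allI impI) simp_all
qed

end
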